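(* There exists an absolute constant $C>0$ such that the following holds. Let $X\in\mathbb R^d$ be a random vector with mean $\mu_0$, covariance matrix $\Sigma_0\neq0$ and $\mathbb E\|X-\mu_0\|_2^4<\infty$, let $Z=X-\mu_0$, and let $X_1,\dots,X_m$ be i.i.d. copies of $X$. Assume the kurtosis condition $$\sup_{\|\mathbf v\|_2\le1}\frac{\sqrt{\mathbb E\langle Z,\mathbf v\rangle^4}}{\mathbb E\langle Z,\mathbf v\rangle^2}=R<\infty .$$ Let $\sigma_0^2:=\|\mathbb E\|Z\|_2^2ZZ^T\|$, let $0<\sigma_{\min}\le\sigma_0\le\sigma_{\max}$, let $\mathbf r(\Sigma_0)=\mathrm{tr}(\Sigma_0)/\|\Sigma_0\|$, and let $\beta>1$ be such that $\lfloor3.5\beta\rfloor+1\le m/2$. If $m\ge C\beta\,\mathbf r(\Sigma_0)$, then the adaptive estimator $\widehat\Sigma_*$ (see context) satisfies $$\big\|\widehat\Sigma_*-\Sigma_0\big\|\le18R\,\|\Sigma_0\|\sqrt{\frac{\mathbf r(\Sigma_0)\beta}{m}}$$ with probability at least $1-5d\log_2\big(\frac{2\sigma_{\max}}{\sigma_{\min}}\big)e^{-\beta}$.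
   Context: $\|\cdot\|$ is the operator norm of a matrix. The supremum in the kurtosis condition is over those $\mathbf v$ for which the denominator is nonzero. For a real function $\psi$ and a symmetric matrix $A=U\Lambda U^T$, $\psi(A)=U\psi(\Lambda)U^T$ with $\psi$ applied to the eigenvalues. Here $\psi(x)=(|x|\wedge1)\,\mathrm{sign}(x)$. Mean estimator $\widehat\mu$ (median of means): let $k=\lfloor3.5\beta\rfloor+1$, split $X_1,\dots,X_m$ into $k$ disjoint groups $G_1,\dots,G_k$ of size $\lfloor m/k\rfloor$ each, let $\widehat\mu_j=\frac1{|G_j|}\sum_{i\in G_j}X_i$, and let $\widehat\mu=\operatorname{argmin}_{z\in\mathbb R^d}\sum_{j=1}^k\|z-\widehat\mu_j\|_2$ be their geometric median. Adaptive covariance estimator: $\sigma_j:=\sigma_{\min}2^j$, $\mathcal J=\{j\in\mathbb Z:\sigma_{\min}\le\sigma_j<2\sigma_{\max}\}$, $\theta_j=\frac1{\sigma_j}\sqrt{\beta/m}$, $$\widehat\Sigma_{m,j}=\frac1{m\theta_j}\sum_{i=1}^m\psi\big(\theta_j(X_i-\widehat\mu)(X_i-\widehat\mu)^T\big),\quad j\in\mathcal J,$$ $$j_*:=\min\Big\{j\in\mathcal J:\ \forall k\in\mathcal J\text{ with }k>j,\ \|\widehat\Sigma_{m,k}-\widehat\Sigma_{m,j}\|\le6\sigma_k\sqrt{\beta/m}\Big\},\qquad \widehat\Sigma_*:=\widehat\Sigma_{m,j_*}.$$ *)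

theory Defs
  imports "HOL-Probability.Probability" "Jordan_Normal_Form.Determinant"
begin

text \<open>The constant of the main statement must not depend on the dimension. The dimension \<open>d\<close> is
  therefore a natural number, and vectors and matrices are those with explicit carriers
  \<open>carrier_vec d\<close> and \<open>carrier_mat d d\<close> rather than the type-indexed ones.\<close>

unbundle no vec_syntax
unbundle no inner_syntax
hide_type (open) Finite_Cartesian_Product.vec
hide_const (open) Finite_Cartesian_Product.vec Finite_Cartesian_Product.mat
  Finite_Cartesian_Product.row Finite_Cartesian_Product.column
  Determinants.trace Cartesian_Space.orthogonal_matrix

section \<open>Euclidean norm, operator norm, functions of symmetric matrices\<close>

definition vnorm :: "real vec \<Rightarrow> real" where
  "vnorm v = sqrt (v \<bullet> v)"

definition op_norm :: "real mat \<Rightarrow> real" where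
  "op_norm A = (SUP v\<in>{v \<in> carrier_vec (dim_col A). vnorm v \<le> 1}. vnorm (A *\<^sub>v v))"

definition tr :: "real mat \<Rightarrow> real" where
  "tr A = (\<Sum>i<dim_row A. A $$ (i, i))"

definition eff_rank :: "real mat \<Rightarrow> real" where
  "eff_rank S = tr S / op_norm S"

definition outer :: "real vec \<Rightarrow> real mat" where
  "outer v = Matrix.mat (dim_vec v) (dim_vec v) (\<lambda>(i, j). v $ i * v $ j)"

definition spectral_decomp :: "real mat \<Rightarrow> real mat \<Rightarrow> (nat \<Rightarrow> real) \<Rightarrow> bool" where
  "spectral_decomp A U l \<longleftrightarrow>
     U \<in> carrier_mat (dim_row A) (dim_row A) \<and>
     transpose_mat U * U = 1\<^sub>m (dim_row A) \<and>
     A = U * mat_diag (dim_row A) l * transpose_mat U"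

definition mat_fun :: "(real \<Rightarrow> real) \<Rightarrow> real mat \<Rightarrow> real mat" where
  "mat_fun f A =
     (THE B. \<exists>U l. spectral_decomp A U l \<and>
        B = U * mat_diag (dim_row A) (\<lambda>i. f (l i)) * transpose_mat U)"

definition psi :: "real \<Rightarrow> real" where
  "psi x = min \<bar>x\<bar> 1 * sgn x"

text \<open>The value of \<open>mat_fun\<close> does not depend on the chosen spectral decomposition, so the
  definite description denotes whenever one exists.\<close>

lemma mat_fun_eq:
  assumes "spectral_decomp A U l"
  shows "mat_fun f A = U * mat_diag (dim_row A) (\<lambda>i. f (l i)) * transpose_mat U"
proof -
  define n where "n = dim_row A"
  have uniq: "V * mat_diag n (\<lambda>i. f (k i)) * transpose_mat V
      = U * mat_diag n (\<lambda>i. f (l i)) * transpose_mat U"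
    if "spectral_decomp A V k" for V k
  proof -
    have U: "U \<in> carrier_mat n n" and V: "V \<in> carrier_mat n n"
      and Ut: "transpose_mat U \<in> carrier_mat n n" and Vt: "transpose_mat V \<in> carrier_mat n n"
      and UU: "transpose_mat U * U = 1\<^sub>m n" and VV: "transpose_mat V * V = 1\<^sub>m n"
      and AU: "A = U * mat_diag n l * transpose_mat U"
      and AV: "A = V * mat_diag n k * transpose_mat V"
      using assms that by (auto simp: spectral_decomp_def n_def)
    have UU': "U * transpose_mat U = 1\<^sub>m n" and VV': "V * transpose_mat V = 1\<^sub>m n"
      using mat_mult_left_right_inverse[OF Ut U UU] mat_mult_left_right_inverse[OF Vt V VV] .
    define W where "W = transpose_mat V * U"
    have W: "W \<in> carrier_mat n n" using U Vt by (simp add: W_def)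
    have cl: "X * Y \<in> carrier_mat n n" if "X \<in> carrier_mat n n" "Y \<in> carrier_mat n n"
      for X Y :: "real mat" using that by simp
    have one: "X * 1\<^sub>m n = X" "1\<^sub>m n * X = X" if "X \<in> carrier_mat n n" for X :: "real mat"
      using that by simp_all
    have assoc: "X * Y * Z = X * (Y * Z)"
      if "X \<in> carrier_mat n n" "Y \<in> carrier_mat n n" "Z \<in> carrier_mat n n"
      for X Y Z :: "real mat" using that by (rule assoc_mult_mat)
    have D: "mat_diag n g \<in> carrier_mat n n" for g :: "nat \<Rightarrow> real" by simp
    have "transpose_mat V * (U * mat_diag n l * transpose_mat U) * U = W * mat_diag n l"
    proof -
      have "transpose_mat V * (U * mat_diag n l * transpose_mat U) * U
          = transpose_mat V * (U * mat_diag n l) * (transpose_mat U * U)"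
        using U Ut Vt D by (simp add: assoc cl one)
      also have "\<dots> = W * mat_diag n l"
        unfolding UU using U Vt D by (simp add: W_def assoc cl one)
      finally show ?thesis .
    qed
    moreover have "transpose_mat V * (V * mat_diag n k * transpose_mat V) * U = mat_diag n k * W"
    proof -
      have "transpose_mat V * (V * mat_diag n k * transpose_mat V) * U
          = (transpose_mat V * V) * (mat_diag n k * (transpose_mat V * U))"
        using U V Vt D by (simp add: assoc cl)
      also have "\<dots> = mat_diag n k * W"
        unfolding VV using U Vt D by (simp add: W_def assoc cl one)
      finally show ?thesis .
    qed
    ultimately have eq: "W * mat_diag n l = mat_diag n k * W" using AU AV by simp
    have ent: "W $$ (i, j) * l j = k i * W $$ (i, j)" if "i < n" "j < n" for i j
    proof -
      have "(W * mat_diag n l) $$ (i, j) = (mat_diag n k * W) $$ (i, j)" using eq by simp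
      then show ?thesis
        using that by (simp add: mat_diag_mult_left[OF W] mat_diag_mult_right[OF W])
    qed
    have feq: "W * mat_diag n (\<lambda>i. f (l i)) = mat_diag n (\<lambda>i. f (k i)) * W"
      unfolding mat_diag_mult_left[OF W] mat_diag_mult_right[OF W]
    proof (rule eq_matI)
      fix i j
      assume "i < dim_row (Matrix.mat n n (\<lambda>(i, j). f (k i) * W $$ (i, j)))"
        "j < dim_col (Matrix.mat n n (\<lambda>(i, j). f (k i) * W $$ (i, j)))"
      then have ij: "i < n" "j < n" by auto
      from ent[OF ij] have "W $$ (i, j) = 0 \<or> l j = k i" by auto
      then show "Matrix.mat n n (\<lambda>(i, j). W $$ (i, j) * f (l j)) $$ (i, j)
          = Matrix.mat n n (\<lambda>(i, j). f (k i) * W $$ (i, j)) $$ (i, j)"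
        using ij by auto
    qed auto
    have "U * mat_diag n (\<lambda>i. f (l i)) * transpose_mat U
        = (V * transpose_mat V) * (U * mat_diag n (\<lambda>i. f (l i)) * transpose_mat U)"
      unfolding VV' using U D Ut by (simp add: cl one)
    also have "\<dots> = V * (W * mat_diag n (\<lambda>i. f (l i))) * transpose_mat U"
      using U V Ut Vt D by (simp add: W_def assoc cl one)
    also have "\<dots> = V * mat_diag n (\<lambda>i. f (k i)) * transpose_mat V * (U * transpose_mat U)"
      unfolding feq using U V Ut Vt D by (simp add: W_def assoc cl one)
    also have "\<dots> = V * mat_diag n (\<lambda>i. f (k i)) * transpose_mat V"
      unfolding UU' using V Vt D by (simp add: cl one)
    finally show ?thesis by simp
  qed
  show ?thesis
    unfolding mat_fun_def n_def[symmetric]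
    by (rule the_equality) (use assms uniq n_def in blast)+
qed

section \<open>Laws on the \<open>d\<close>-dimensional space\<close>

definition borel_vec :: "nat \<Rightarrow> real vec measure" where
  "borel_vec d =
     vimage_algebra (carrier_vec d) (\<lambda>v. \<lambda>i\<in>{..<d}. v $ i) (\<Pi>\<^sub>M i\<in>{..<d}. borel)"

definition vec_law :: "nat \<Rightarrow> real vec measure \<Rightarrow> bool" where
  "vec_law d D \<longleftrightarrow> prob_space D \<and> sets D = sets (borel_vec d)"

definition mat_expectation :: "nat \<Rightarrow> real vec measure \<Rightarrow> (real vec \<Rightarrow> real mat) \<Rightarrow> real mat" where
  "mat_expectation d D F = Matrix.mat d d (\<lambda>(i, j). \<integral>x. F x $$ (i, j) \<partial>D)"

definition mean_vec :: "nat \<Rightarrow> real vec measure \<Rightarrow> real vec" where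
  "mean_vec d D = Matrix.vec d (\<lambda>i. \<integral>x. x $ i \<partial>D)"

definition covariance :: "nat \<Rightarrow> real vec measure \<Rightarrow> real mat" where
  "covariance d D = mat_expectation d D (\<lambda>x. outer (x - mean_vec d D))"

definition sigma0 :: "nat \<Rightarrow> real vec measure \<Rightarrow> real" where
  "sigma0 d D =
     sqrt (op_norm (mat_expectation d D
       (\<lambda>x. (vnorm (x - mean_vec d D))\<^sup>2 \<cdot>\<^sub>m outer (x - mean_vec d D))))"

definition kurtosis_set :: "nat \<Rightarrow> real vec measure \<Rightarrow> real set" where
  "kurtosis_set d D =
     {sqrt (\<integral>x. ((x - mean_vec d D) \<bullet> v) ^ 4 \<partial>D) / (\<integral>x. ((x - mean_vec d D) \<bullet> v)\<^sup>2 \<partial>D) | v.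
        v \<in> carrier_vec d \<and> vnorm v \<le> 1 \<and> (\<integral>x. ((x - mean_vec d D) \<bullet> v)\<^sup>2 \<partial>D) \<noteq> 0}"

text \<open>An i.i.d. sample \<open>X\<^sub>0, \<dots>, X\<^sub>m\<^sub>-\<^sub>1\<close> with common law \<open>D\<close> is represented by the coordinates of
  the product measure \<open>sample_law m D\<close>. This loses no generality: on any probability space, such a
  sample has this product as its joint law, as the following lemma records. Unlike an arbitrary
  sample space, whose type would be fixed outside the statement, it can be used under an existential
  quantifier without the constant depending on that type.\<close>

definition sample_law :: "nat \<Rightarrow> real vec measure \<Rightarrow> (nat \<Rightarrow> real vec) measure" where
  "sample_law m D = (\<Pi>\<^sub>M i\<in>{..<m}. D)"

lemma (in prob_space) prob_iid_sample:
  assumes "m > 0" and "vec_law d D"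
    and rv: "\<And>i. i < m \<Longrightarrow> random_variable (borel_vec d) (X i)"
    and indep: "indep_vars (\<lambda>_. borel_vec d) X {..<m}"
    and distr: "\<And>i. i < m \<Longrightarrow> distr M (borel_vec d) (X i) = D"
    and A: "A \<in> sets (sample_law m D)"
  shows "prob {w \<in> space M. (\<lambda>i\<in>{..<m}. X i w) \<in> A} = measure (sample_law m D) A"
proof -
  have sD: "sets (\<Pi>\<^sub>M i\<in>{..<m}. borel_vec d) = sets (sample_law m D)"
    unfolding sample_law_def by (rule sets_PiM_cong) (use assms(2) in \<open>auto simp: vec_law_def\<close>)
  have "distr M (\<Pi>\<^sub>M i\<in>{..<m}. borel_vec d) (\<lambda>w. \<lambda>i\<in>{..<m}. X i w)
      = (\<Pi>\<^sub>M i\<in>{..<m}. distr M (borel_vec d) (X i))"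
    using indep_vars_iff_distr_eq_PiM'[where I = "{..<m}" and M' = "\<lambda>_. borel_vec d" and X = X] assms by auto
  also have "\<dots> = sample_law m D"
    unfolding sample_law_def by (rule PiM_cong) (use distr in auto)
  finally have eq: "distr M (\<Pi>\<^sub>M i\<in>{..<m}. borel_vec d) (\<lambda>w. \<lambda>i\<in>{..<m}. X i w) = sample_law m D" .
  have "(\<lambda>w. \<lambda>i\<in>{..<m}. X i w) \<in> M \<rightarrow>\<^sub>M (\<Pi>\<^sub>M i\<in>{..<m}. borel_vec d)"
    using rv by (intro measurable_restrict) auto
  from measure_distr[OF this, of A] show ?thesis
    using A unfolding eq sD by (simp add: vimage_def Int_def conj_commute)
qed

section \<open>The estimators\<close>

definition num_groups :: "real \<Rightarrow> nat" where
  "num_groups \<beta> = nat \<lfloor>3.5 * \<beta>\<rfloor> + 1"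

definition is_grouping :: "nat \<Rightarrow> real \<Rightarrow> (nat \<Rightarrow> nat set) \<Rightarrow> bool" where
  "is_grouping m \<beta> G \<longleftrightarrow>
     disjoint_family_on G {..<num_groups \<beta>} \<and>
     (\<forall>j<num_groups \<beta>. G j \<subseteq> {..<m} \<and> card (G j) = m div num_groups \<beta>)"

definition group_mean :: "nat \<Rightarrow> nat set \<Rightarrow> (nat \<Rightarrow> real vec) \<Rightarrow> real vec" where
  "group_mean d S x = Matrix.vec d (\<lambda>c. (\<Sum>i\<in>S. x i $ c) / real (card S))"

text \<open>A geometric median need not be unique (collinear group means); \<open>muhat\<close> is any rule that
  assigns a minimizer to each sample.\<close>

definition is_mom_estimator ::
  "nat \<Rightarrow> nat \<Rightarrow> real \<Rightarrow> (nat \<Rightarrow> nat set) \<Rightarrow> ((nat \<Rightarrow> real vec) \<Rightarrow> real vec) \<Rightarrow> bool" where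
  "is_mom_estimator d m \<beta> G muhat \<longleftrightarrow>
     (\<forall>x \<in> {..<m} \<rightarrow>\<^sub>E carrier_vec d.
        is_arg_min (\<lambda>z. \<Sum>j<num_groups \<beta>. vnorm (z - group_mean d (G j) x))
          (\<lambda>z. z \<in> carrier_vec d) (muhat x))"

definition grid :: "real \<Rightarrow> int \<Rightarrow> real" where
  "grid smin j = smin * 2 powi j"

definition J_set :: "real \<Rightarrow> real \<Rightarrow> int set" where
  "J_set smin smax = {j. smin \<le> grid smin j \<and> grid smin j < 2 * smax}"

definition trunc_cov :: "nat \<Rightarrow> nat \<Rightarrow> real \<Rightarrow> real vec \<Rightarrow> (nat \<Rightarrow> real vec) \<Rightarrow> real mat" where
  "trunc_cov d m \<theta> mu x =
     (1 / (real m * \<theta>)) \<cdot>\<^sub>m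
       Matrix.mat d d (\<lambda>(a, b). \<Sum>i<m. mat_fun psi (\<theta> \<cdot>\<^sub>m outer (x i - mu)) $$ (a, b))"

definition cov_j ::
  "nat \<Rightarrow> nat \<Rightarrow> real \<Rightarrow> real \<Rightarrow> real vec \<Rightarrow> (nat \<Rightarrow> real vec) \<Rightarrow> int \<Rightarrow> real mat" where
  "cov_j d m \<beta> smin mu x j = trunc_cov d m (1 / grid smin j * sqrt (\<beta> / real m)) mu x"

definition j_star ::
  "nat \<Rightarrow> nat \<Rightarrow> real \<Rightarrow> real \<Rightarrow> real \<Rightarrow> real vec \<Rightarrow> (nat \<Rightarrow> real vec) \<Rightarrow> int" where
  "j_star d m \<beta> smin smax mu x =
     Min {j \<in> J_set smin smax. \<forall>k \<in> J_set smin smax. k > j \<longrightarrow>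
        op_norm (cov_j d m \<beta> smin mu x k - cov_j d m \<beta> smin mu x j)
          \<le> 6 * grid smin k * sqrt (\<beta> / real m)}"

definition cov_star ::
  "nat \<Rightarrow> nat \<Rightarrow> real \<Rightarrow> real \<Rightarrow> real \<Rightarrow> real vec \<Rightarrow> (nat \<Rightarrow> real vec) \<Rightarrow> real mat" where
  "cov_star d m \<beta> smin smax mu x =
     cov_j d m \<beta> smin mu x (j_star d m \<beta> smin smax mu x)"

end

theory Submission
  imports Defs
begin

text \<open>
  The truncation \<open>psi\<close> applied to \<open>\<theta> (X - \<mu>) (X - \<mu>)\<^sup>T\<close> only projects \<open>X - \<mu>\<close> onto the ball of radius
  \<open>1 / sqrt \<theta>\<close>, so each estimator averages outer products of bounded vectors. With the true mean, such an
  average is within \<open>\<beta> / (m \<theta>) + 5/4 \<theta> \<sigma>\<^sub>0\<^sup>2\<close> of \<open>\<Sigma>\<^sub>0\<close>, by a matrix Laplace-transform argument and the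
  Golden--Thompson inequality applied to the centered summands. Replacing the true mean by the median
  of means changes the quadratic form by cross terms. On the untruncated points these are \<open>\<delta>\<close> times the
  empirical mean of bounded vectors; the truncated points contribute little to the quadratic form,
  because \<open>1 \<le> 4 \<theta> \<parallel>X - \<mu>\<parallel>\<^sup>2\<close> there. Both contributions are a small multiple of
  \<open>(S + \<sigma>\<^sub>j) sqrt (\<beta> / m)\<close> with \<open>S = R \<parallel>\<Sigma>\<^sub>0\<parallel> sqrt (r(\<Sigma>\<^sub>0)) \<ge> \<sigma>\<^sub>0\<close> once \<open>m \<ge> C \<beta> r(\<Sigma>\<^sub>0)\<close>.

  Since \<open>\<sigma>\<^sub>0\<close> can be much smaller than \<open>S\<close>, the oracle bound \<open>3 \<sigma>\<^sub>j sqrt (\<beta> / m)\<close> need not hold at every scale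
  \<open>\<sigma>\<^sub>j \<ge> \<sigma>\<^sub>0\<close>. The selection still works: a rejected scale above \<open>\<sigma>\<^sub>0\<close> forces the selected scale to
  be smaller than \<open>S\<close>.
\<close>

section \<open>Euclidean vectors and traces\<close>

text \<open>The median of means is computed from the same sample as the covariance estimators, so
  its distance \<delta> from the true mean is random and dependent on the summands. Every
  probabilistic event therefore refers to the true mean only, and the effect of \<delta> is bounded
  deterministically, uniformly in \<delta> and in the direction \<open>v\<close>. Since
  \<open>muhat\<close> need not be measurable, each probability bound provides a measurable event on
  which the estimate holds. The 5/4 is 1 from the variance of the truncated summands plus 1/4 from
  the truncation bias. That \<open>\<sigma>0\<close> is at most S follows from the kurtosis
  condition by Cauchy-Schwarz, coordinate by coordinate. Probability budget, with L the logarithm in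
  the statement: at most 2L scales occur. At each of them the two signs of the main deviation cost
  2d exp(-\<beta>), in total 4dL exp(-\<beta>). All auxiliary events are taken at level 3\<beta>,
  and their sum fits into the remaining dL exp(-\<beta>). The constant C = 18000^4 is chosen so that
  \<tau> q is at most S / 18000^2, where \<tau> is the trace of the covariance and q = sqrt(\<beta>
  / m).\<close>

lemma vnorm_eq_L2_set: "vnorm v = L2_set (\<lambda>i. v $ i) {0..<dim_vec v}"
  by (simp add: vnorm_def L2_set_def scalar_prod_def power2_eq_square)

lemma vnorm_nonneg [simp]: "0 \<le> vnorm v"
  by (simp add: vnorm_eq_L2_set)

lemma scalar_prod_self_nonneg [simp]: "0 \<le> (v :: real vec) \<bullet> v"
  by (simp add: scalar_prod_def sum_nonneg)

lemma vnorm_sq: "(vnorm v)\<^sup>2 = v \<bullet> v"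
  by (simp add: vnorm_def)

lemma vnorm_sq_sum: "v \<in> carrier_vec n \<Longrightarrow> (vnorm v)\<^sup>2 = (\<Sum>i<n. (v $ i)\<^sup>2)"
  by (simp add: vnorm_sq scalar_prod_def lessThan_atLeast0) (simp add: power2_eq_square)

lemma vnorm_zero [simp]: "vnorm (0\<^sub>v n) = 0"
  by (simp add: vnorm_def)

lemma vnorm_smult [simp]: "vnorm (c \<cdot>\<^sub>v v) = \<bar>c\<bar> * vnorm v"
  by (simp add: vnorm_eq_L2_set L2_set_def power_mult_distrib sum_distrib_left[symmetric] real_sqrt_mult)

lemma vnorm_uminus [simp]: "vnorm (- v) = vnorm v"
  by (simp add: vnorm_def)

lemma vnorm_eq_0_iff: "v \<in> carrier_vec n \<Longrightarrow> vnorm v = 0 \<longleftrightarrow> v = 0\<^sub>v n"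
  by (auto simp: vnorm_eq_L2_set L2_set_eq_0_iff)

lemma vnorm_add_le:
  "v \<in> carrier_vec n \<Longrightarrow> w \<in> carrier_vec n \<Longrightarrow> vnorm (v + w) \<le> vnorm v + vnorm w"
  using L2_set_triangle_ineq[of "\<lambda>i. v $ i" "\<lambda>i. w $ i" "{0..<n}"]
  by (auto simp: vnorm_eq_L2_set cong: L2_set_cong_simp)

lemma vnorm_minus_commute:
  "v \<in> carrier_vec n \<Longrightarrow> w \<in> carrier_vec n \<Longrightarrow> vnorm (v - w) = vnorm (w - v)"
  by (auto simp: vnorm_eq_L2_set L2_set_def power2_commute)

lemma vnorm_minus_le:
  assumes "v \<in> carrier_vec n" "w \<in> carrier_vec n"
  shows "vnorm (v - w) \<le> vnorm v + vnorm w"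
proof -
  have "v - w = v + - w" using assms by auto
  then show ?thesis using vnorm_add_le[of v n "- w"] assms by simp
qed

lemma vnorm_triangle_sub:
  assumes "v \<in> carrier_vec n" "w \<in> carrier_vec n"
  shows "vnorm v \<le> vnorm (v - w) + vnorm w"
proof -
  have "v = (v - w) + w" using assms by auto
  then show ?thesis using vnorm_add_le[of "v - w" n w] assms by simp
qed

lemma abs_scalar_prod_le:
  assumes "v \<in> carrier_vec n" "w \<in> carrier_vec n"
  shows "\<bar>v \<bullet> w\<bar> \<le> vnorm v * vnorm w"
proof -
  have "\<bar>v \<bullet> w\<bar> \<le> (\<Sum>i\<in>{0..<n}. \<bar>v $ i\<bar> * \<bar>w $ i\<bar>)"
    using assms by (auto simp: scalar_prod_def abs_mult[symmetric])
  also have "\<dots> \<le> L2_set (\<lambda>i. v $ i) {0..<n} * L2_set (\<lambda>i. w $ i) {0..<n}"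
    by (rule L2_set_mult_ineq)
  finally show ?thesis using assms by (simp add: vnorm_eq_L2_set)
qed

lemma scalar_prod_sq_le:
  assumes "v \<in> carrier_vec n" "w \<in> carrier_vec n"
  shows "(v \<bullet> w)\<^sup>2 \<le> (vnorm v)\<^sup>2 * (vnorm w)\<^sup>2"
  using power_mono[OF abs_scalar_prod_le[OF assms], of 2] by (simp add: power_mult_distrib)

section \<open>Traces of matrix products\<close>

lemma tr_eq: "A \<in> carrier_mat n n \<Longrightarrow> tr A = (\<Sum>i<n. A $$ (i, i))"
  by (simp add: tr_def)

lemma index_mult_mat_sum:
  "A \<in> carrier_mat n k \<Longrightarrow> B \<in> carrier_mat k m \<Longrightarrow> i < n \<Longrightarrow> j < m \<Longrightarrow>
    (A * B) $$ (i, j) = (\<Sum>l<k. A $$ (i, l) * B $$ (l, j))"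
  by (auto simp: scalar_prod_def lessThan_atLeast0)

lemma tr_mult:
  "A \<in> carrier_mat n n \<Longrightarrow> B \<in> carrier_mat n n \<Longrightarrow>
    tr (A * B) = (\<Sum>i<n. \<Sum>l<n. A $$ (i, l) * B $$ (l, i))"
  by (subst tr_eq[of _ n]) (auto simp: index_mult_mat_sum simp del: index_mult_mat)

lemma tr_comm:
  "A \<in> carrier_mat n n \<Longrightarrow> B \<in> carrier_mat n n \<Longrightarrow> tr (A * B) = tr (B * A)"
  by (simp add: tr_mult mult.commute) (rule sum.swap)

lemma tr_transpose_mult_self:
  "A \<in> carrier_mat n n \<Longrightarrow> tr (transpose_mat A * A) = (\<Sum>i<n. \<Sum>l<n. (A $$ (l, i))\<^sup>2)"
  by (simp add: tr_mult power2_eq_square)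

lemma tr_transpose_mult_self_nonneg:
  "A \<in> carrier_mat n n \<Longrightarrow> 0 \<le> tr (transpose_mat A * A)"
  by (simp add: tr_transpose_mult_self sum_nonneg)

text \<open>Cauchy-Schwarz for the Frobenius inner product, with the entries of \<open>B\<close>
  read in transposed order.\<close>

lemma tr_mult_sq_le:
  assumes A: "A \<in> carrier_mat n n" and B: "B \<in> carrier_mat n n"
  shows "(tr (A * B))\<^sup>2 \<le> tr (transpose_mat A * A) * tr (transpose_mat B * B)"
proof -
  let ?I = "{..<n} \<times> {..<n}"
  have 1: "tr (A * B) = (\<Sum>p\<in>?I. A $$ p * B $$ (snd p, fst p))"
    by (simp add: tr_mult[OF A B] sum.cartesian_product case_prod_unfold)
  have 2: "tr (transpose_mat A * A) = (\<Sum>p\<in>?I. (A $$ p)\<^sup>2)"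
    unfolding tr_transpose_mult_self[OF A]
    by (subst sum.swap) (simp add: sum.cartesian_product case_prod_unfold)
  have 3: "tr (transpose_mat B * B) = (\<Sum>p\<in>?I. (B $$ (snd p, fst p))\<^sup>2)"
    by (simp add: tr_transpose_mult_self[OF B] sum.cartesian_product case_prod_unfold)
  show ?thesis unfolding 1 2 3 by (rule Cauchy_Schwarz_ineq_sum)
qed

section \<open>Powers of matrices\<close>

lemma pow_mat_add:
  "A \<in> carrier_mat n n \<Longrightarrow> A ^\<^sub>m (k + l) = A ^\<^sub>m k * A ^\<^sub>m l"
  for A :: "'a::semiring_1 mat"
proof (induction l)
  case (Suc l)
  then have "A ^\<^sub>m k * A ^\<^sub>m l * A = A ^\<^sub>m k * (A ^\<^sub>m l * A)"
    by (intro assoc_mult_mat) auto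
  with Suc show ?case by simp
qed (auto intro: right_mult_one_mat[symmetric])

lemma pow_mat_Suc_left:
  "A \<in> carrier_mat n n \<Longrightarrow> A ^\<^sub>m Suc k = A * A ^\<^sub>m k" for A :: "'a::semiring_1 mat"
  using pow_mat_add[of A n 1 k] by simp

lemma pow_mat_mult:
  "A \<in> carrier_mat n n \<Longrightarrow> (A ^\<^sub>m k) ^\<^sub>m l = A ^\<^sub>m (k * l)" for A :: "'a::semiring_1 mat"
proof (induction l)
  case (Suc l)
  then show ?case using pow_mat_add[of A n "k * l" k] by (simp add: add.commute)
qed auto

lemma transpose_pow_mat:
  "A \<in> carrier_mat n n \<Longrightarrow> transpose_mat (A ^\<^sub>m k) = (transpose_mat A) ^\<^sub>m k"
  for A :: "'a::comm_semiring_1 mat"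
proof (induction k)
  case (Suc k)
  have "transpose_mat (A ^\<^sub>m k * A) = transpose_mat A * transpose_mat (A ^\<^sub>m k)"
    using Suc.prems by (intro transpose_mult) auto
  with Suc pow_mat_Suc_left[of "transpose_mat A" n k] show ?case by simp
qed auto

lemma pow_mat_mult_rotate:
  fixes A :: "'a::semiring_1 mat"
  assumes "A \<in> carrier_mat n n" "B \<in> carrier_mat n n"
  shows "(A * B) ^\<^sub>m Suc k = A * ((B * A) ^\<^sub>m k * B)"
proof (induction k)
  case 0
  then show ?case using assms by simp
next
  case (Suc k)
  have "(A * B) ^\<^sub>m Suc (Suc k) = A * ((B * A) ^\<^sub>m k * B) * (A * B)"
    using Suc.IH by simp
  also have "\<dots> = A * ((B * A) ^\<^sub>m k * (B * A) * B)"
  proof -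
    define P where "P = (B * A) ^\<^sub>m k"
    have "P \<in> carrier_mat n n" using assms by (simp add: P_def)
    then show ?thesis
      unfolding P_def[symmetric] using assms by (simp add: assoc_mult_mat[of _ n n _ n _ n])
  qed
  finally show ?case by simp
qed

text \<open>Cyclicity of the trace after writing a positive power of \<open>A * B\<close> as
  \<open>A\<close> times a power of \<open>B * A\<close> times \<open>B\<close>.\<close>

lemma tr_pow_mult_comm:
  assumes "A \<in> carrier_mat n n" "B \<in> carrier_mat n n"
  shows "tr ((A * B) ^\<^sub>m k) = tr ((B * A) ^\<^sub>m k)"
proof (cases k)
  case 0
  then show ?thesis using assms by simp
next
  case (Suc l)
  have "tr ((A * B) ^\<^sub>m k) = tr (A * ((B * A) ^\<^sub>m l * B))"
    unfolding Suc using pow_mat_mult_rotate[OF assms] by simp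
  also have "\<dots> = tr ((B * A) ^\<^sub>m l * B * A)"
    by (rule tr_comm[of _ n]) (use assms in auto)
  also have "\<dots> = tr ((B * A) ^\<^sub>m k)"
    unfolding Suc using assms by (simp add: assoc_mult_mat[of _ n n _ n _ n])
  finally show ?thesis .
qed

lemma tr_pow_even_nonneg:
  assumes "A \<in> carrier_mat n n" "transpose_mat A = A"
  shows "0 \<le> tr (A ^\<^sub>m (2 * k))"
proof -
  have "A ^\<^sub>m (2 * k) = transpose_mat (A ^\<^sub>m k) * A ^\<^sub>m k"
    using assms by (simp add: transpose_pow_mat[of _ n] mult_2 pow_mat_add[of _ n])
  then show ?thesis using tr_transpose_mult_self_nonneg[of "A ^\<^sub>m k" n] assms by simp
qed

text \<open>The finite form of the Golden--Thompson inequality: the two bounds are proved together,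
  each step of one using the previous step of the other.\<close>

lemma tr_pow_power2:
  fixes n k :: nat
  shows "(\<forall>Z\<in>carrier_mat n n. \<bar>tr (Z ^\<^sub>m (2 * 2 ^ k))\<bar> \<le> tr ((transpose_mat Z * Z) ^\<^sub>m (2 ^ k))) \<and>
    (\<forall>U\<in>carrier_mat n n. \<forall>V\<in>carrier_mat n n. transpose_mat U = U \<longrightarrow> transpose_mat V = V \<longrightarrow>
      tr ((U * V) ^\<^sub>m (2 ^ k)) \<le> tr (U ^\<^sub>m (2 ^ k) * V ^\<^sub>m (2 ^ k)))"
proof (induction k)
  case 0
  have "\<bar>tr (Z ^\<^sub>m 2)\<bar> \<le> tr (transpose_mat Z * Z)" if Z: "Z \<in> carrier_mat n n" for Z
  proof -
    have "Z ^\<^sub>m 2 = Z * Z" using Z by (simp add: numeral_2_eq_2)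
    then have "(tr (Z ^\<^sub>m 2))\<^sup>2 \<le> (tr (transpose_mat Z * Z))\<^sup>2"
      using tr_mult_sq_le[OF Z Z] by (simp add: power2_eq_square)
    then show ?thesis
      using tr_transpose_mult_self_nonneg[OF Z] by (simp add: abs_le_square_iff[symmetric])
  qed
  then show ?case by auto
next
  case (Suc k)
  let ?N = "2 ^ k :: nat"
  have IHA: "\<bar>tr (Z ^\<^sub>m (2 * ?N))\<bar> \<le> tr ((transpose_mat Z * Z) ^\<^sub>m ?N)"
    if "Z \<in> carrier_mat n n" for Z using Suc.IH that by blast
  have IHB: "tr ((U * V) ^\<^sub>m ?N) \<le> tr (U ^\<^sub>m ?N * V ^\<^sub>m ?N)"
    if "U \<in> carrier_mat n n" "V \<in> carrier_mat n n" "transpose_mat U = U" "transpose_mat V = V"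
    for U V using Suc.IH that by blast
  note assoc = assoc_mult_mat[of _ n n _ n _ n]
  have B: "tr ((U * V) ^\<^sub>m (2 * ?N)) \<le> tr (U ^\<^sub>m (2 * ?N) * V ^\<^sub>m (2 * ?N))"
    if U: "U \<in> carrier_mat n n" and V: "V \<in> carrier_mat n n"
      and "transpose_mat U = U" "transpose_mat V = V" for U V
  proof -
    have UV: "U * V \<in> carrier_mat n n" using U V by simp
    have sq: "transpose_mat (X * X) = X * X" if "X \<in> carrier_mat n n" "transpose_mat X = X" for X :: "real mat"
      using transpose_mult[of X n n X n] that by simp
    have pw: "(X * X) ^\<^sub>m ?N = X ^\<^sub>m (2 * ?N)" if "X \<in> carrier_mat n n" for X :: "real mat"
      using pow_mat_mult[OF that, of 2 ?N] that by (simp add: numeral_2_eq_2)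
    have t: "transpose_mat (U * V) = V * U" using transpose_mult[OF U V] that by simp
    \<comment> \<open>The first bound at \<open>Z = U * V\<close>. Cyclicity turns V U U V into U U
      V V, to which the second bound of the previous step applies with the squares of
      \<open>U\<close> and \<open>V\<close>.\<close>
    have "tr ((U * V) ^\<^sub>m (2 * ?N)) \<le> tr ((V * U * (U * V)) ^\<^sub>m ?N)"
      using IHA[OF UV] t by simp
    also have "\<dots> = tr ((V * (U * U * V)) ^\<^sub>m ?N)" using U V by (simp add: assoc)
    also have "\<dots> = tr ((U * U * V * V) ^\<^sub>m ?N)"
      by (rule tr_pow_mult_comm) (use U V in auto)
    also have "\<dots> = tr (((U * U) * (V * V)) ^\<^sub>m ?N)" using U V by (simp add: assoc)
    also have "\<dots> \<le> tr ((U * U) ^\<^sub>m ?N * (V * V) ^\<^sub>m ?N)"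
      by (rule IHB) (use U V that sq in auto)
    finally show ?thesis using pw U V by simp
  qed
  have A: "\<bar>tr (Z ^\<^sub>m (2 * (2 * ?N)))\<bar> \<le> tr ((transpose_mat Z * Z) ^\<^sub>m (2 * ?N))"
    if Z: "Z \<in> carrier_mat n n" for Z
  proof -
    \<comment> \<open>The first bound of the previous step is applied to Z Z. By cyclicity the
      resulting trace is that of a power of U V, so the second bound separates the factors. Equal
      powers of U and V have equal traces, hence Cauchy-Schwarz leaves only U.\<close>
    define U V where "U = transpose_mat Z * Z" and "V = Z * transpose_mat Z"
    have U: "U \<in> carrier_mat n n" and V: "V \<in> carrier_mat n n" using Z by (auto simp: U_def V_def)
    have Us: "transpose_mat U = U" and Vs: "transpose_mat V = V"
      using Z by (auto simp: U_def V_def transpose_mult[of _ n n _ n])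
    have "\<bar>tr (Z ^\<^sub>m (2 * (2 * ?N)))\<bar> = \<bar>tr ((Z * Z) ^\<^sub>m (2 * ?N))\<bar>"
      using pow_mat_mult[OF Z, of 2 "2 * ?N"] Z by (simp add: numeral_2_eq_2)
    also have "\<dots> \<le> tr ((transpose_mat (Z * Z) * (Z * Z)) ^\<^sub>m ?N)" by (rule IHA) (use Z in auto)
    also have "transpose_mat (Z * Z) * (Z * Z) = transpose_mat Z * (U * Z)"
      using Z by (simp add: U_def assoc transpose_mult[of _ n n _ n])
    also have "tr ((transpose_mat Z * (U * Z)) ^\<^sub>m ?N) = tr ((U * Z * transpose_mat Z) ^\<^sub>m ?N)"
      by (rule tr_pow_mult_comm) (use U Z in auto)
    also have "\<dots> = tr ((U * V) ^\<^sub>m ?N)" using U Z by (simp add: V_def assoc)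
    also have "\<dots> \<le> tr (U ^\<^sub>m ?N * V ^\<^sub>m ?N)" by (rule IHB[OF U V Us Vs])
    also have "\<dots> \<le> tr (U ^\<^sub>m (2 * ?N))"
    proof -
      have p: "transpose_mat (X ^\<^sub>m ?N) * X ^\<^sub>m ?N = X ^\<^sub>m (2 * ?N)"
        if "X \<in> carrier_mat n n" "transpose_mat X = X" for X :: "real mat"
        using that by (simp add: transpose_pow_mat[of _ n] mult_2 pow_mat_add[of _ n])
      have "tr (V ^\<^sub>m (2 * ?N)) = tr (U ^\<^sub>m (2 * ?N))"
        unfolding U_def V_def by (rule tr_pow_mult_comm) (use Z in auto)
      then have "(tr (U ^\<^sub>m ?N * V ^\<^sub>m ?N))\<^sup>2 \<le> (tr (U ^\<^sub>m (2 * ?N)))\<^sup>2"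
        using tr_mult_sq_le[of "U ^\<^sub>m ?N" n "V ^\<^sub>m ?N"] p[OF U Us] p[OF V Vs] U V
        by (simp add: power2_eq_square)
      moreover have "0 \<le> tr (U ^\<^sub>m (2 * ?N))" by (rule tr_pow_even_nonneg[OF U Us])
      ultimately show ?thesis by (rule power2_le_imp_le)
    qed
    finally show ?thesis by (simp add: U_def)
  qed
  show ?case using A B by simp
qed

section \<open>Matrices of bounded operator norm\<close>

text \<open>An operator norm bound as a predicate: it passes to sums, products and powers without
  any reasoning about the supremum in \<open>op_norm\<close>.\<close>

definition mat_bound :: "nat \<Rightarrow> real mat \<Rightarrow> real \<Rightarrow> bool" where
  "mat_bound n A c \<longleftrightarrow> A \<in> carrier_mat n n \<and> (\<forall>v\<in>carrier_vec n. vnorm (A *\<^sub>v v) \<le> c * vnorm v)"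

lemma mat_boundD:
  "mat_bound n A c \<Longrightarrow> A \<in> carrier_mat n n"
  "mat_bound n A c \<Longrightarrow> v \<in> carrier_vec n \<Longrightarrow> vnorm (A *\<^sub>v v) \<le> c * vnorm v"
  by (auto simp: mat_bound_def)

lemma smult_mat_mult_vec:
  "A \<in> carrier_mat nr nc \<Longrightarrow> v \<in> carrier_vec nc \<Longrightarrow> (c \<cdot>\<^sub>m A) *\<^sub>v v = c \<cdot>\<^sub>v (A *\<^sub>v v)"
  for A :: "'a::comm_semiring_1 mat"
  by (intro eq_vecI) (auto simp: scalar_prod_def sum_distrib_left mult.assoc)

lemma mat_bound_mono: "mat_bound n A c \<Longrightarrow> c \<le> c' \<Longrightarrow> mat_bound n A c'"
  unfolding mat_bound_def by (meson mult_right_mono order_trans vnorm_nonneg)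

lemma mat_bound_one: "mat_bound n (1\<^sub>m n) 1"
  by (simp add: mat_bound_def)

lemma mat_bound_zero: "0 \<le> c \<Longrightarrow> mat_bound n (0\<^sub>m n n) c"
proof -
  have "0\<^sub>m n n *\<^sub>v v = 0\<^sub>v n" if "v \<in> carrier_vec n" for v :: "real vec"
    using that by (intro eq_vecI) (auto simp: scalar_prod_def)
  then show "0 \<le> c \<Longrightarrow> mat_bound n (0\<^sub>m n n) c" by (auto simp: mat_bound_def)
qed

lemma mat_bound_smult: "mat_bound n A c \<Longrightarrow> mat_bound n (k \<cdot>\<^sub>m A) (\<bar>k\<bar> * c)"
  by (auto simp: mat_bound_def smult_mat_mult_vec[of _ n n] mult_left_mono mult.assoc)

lemma mat_bound_add:
  assumes "mat_bound n A c" "mat_bound n B e"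
  shows "mat_bound n (A + B) (c + e)"
  unfolding mat_bound_def
proof (intro conjI ballI)
  fix v :: "real vec" assume v: "v \<in> carrier_vec n"
  have "vnorm ((A + B) *\<^sub>v v) \<le> vnorm (A *\<^sub>v v) + vnorm (B *\<^sub>v v)"
    using assms v by (subst add_mult_distrib_mat_vec[of _ n n]) (auto simp: mat_bound_def intro!: vnorm_add_le[of _ n])
  then show "vnorm ((A + B) *\<^sub>v v) \<le> (c + e) * vnorm v"
    using mat_boundD(2)[OF assms(1) v] mat_boundD(2)[OF assms(2) v] by (simp add: algebra_simps)
qed (use assms in \<open>auto simp: mat_bound_def\<close>)

lemma mat_bound_mult:
  assumes "mat_bound n A c" "mat_bound n B e" "0 \<le> c"
  shows "mat_bound n (A * B) (c * e)"
  unfolding mat_bound_def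
proof (intro conjI ballI)
  fix v :: "real vec" assume v: "v \<in> carrier_vec n"
  have A: "A \<in> carrier_mat n n" and B: "B \<in> carrier_mat n n" using assms by (auto simp: mat_bound_def)
  have "vnorm (A * B *\<^sub>v v) = vnorm (A *\<^sub>v (B *\<^sub>v v))" using A B v by simp
  also have "\<dots> \<le> c * vnorm (B *\<^sub>v v)" using mat_boundD(2)[OF assms(1)] B v by simp
  also have "\<dots> \<le> c * (e * vnorm v)" using mat_boundD(2)[OF assms(2) v] \<open>0 \<le> c\<close> by (intro mult_left_mono)
  finally show "vnorm (A * B *\<^sub>v v) \<le> c * e * vnorm v" by (simp add: mult.assoc)
qed (use assms in \<open>auto simp: mat_bound_def\<close>)

lemma mat_bound_pow:
  assumes "mat_bound n A c" "0 \<le> c"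
  shows "mat_bound n (A ^\<^sub>m k) (c ^ k)"
proof (induction k)
  case 0
  then show ?case using mat_bound_one[of n] mat_boundD(1)[OF assms(1)] by simp
next
  case (Suc k)
  then show ?case using mat_bound_mult[OF Suc assms(1)] assms(2) by (simp add: mult.commute)
qed

lemma mat_bound_abs_tr_le:
  assumes "mat_bound n A c"
  shows "\<bar>tr A\<bar> \<le> real n * c"
proof -
  have A: "A \<in> carrier_mat n n" using assms by (simp add: mat_bound_def)
  have "\<bar>A $$ (i, i)\<bar> \<le> c" if "i < n" for i
  proof -
    have e: "vnorm (unit_vec n i) = 1" using that by (simp add: vnorm_def)
    have "A $$ (i, i) = unit_vec n i \<bullet> (A *\<^sub>v unit_vec n i)"
      using A that by (simp add: scalar_prod_left_unit[of _ n])
    also have "\<bar>\<dots>\<bar> \<le> vnorm (unit_vec n i) * vnorm (A *\<^sub>v unit_vec n i)"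
      by (rule abs_scalar_prod_le[of _ n]) (use A in auto)
    finally show ?thesis using mat_boundD(2)[OF assms, of "unit_vec n i"] e by simp
  qed
  then have "\<bar>tr A\<bar> \<le> (\<Sum>i<n. c)"
    unfolding tr_eq[OF A] by (intro order_trans[OF sum_abs] sum_mono) auto
  then show ?thesis by simp
qed

lemma tr_minus: "A \<in> carrier_mat n n \<Longrightarrow> B \<in> carrier_mat n n \<Longrightarrow> tr (A - B) = tr A - tr B"
  using tr_eq[OF minus_carrier_mat[of B n n A]] by (simp add: tr_eq[of _ n] sum_subtractf)

text \<open>Telescoping, one factor at a time. The assumption \<open>1 \<le> c\<close> lets every
  summand be bounded with the same power of \<open>c\<close>.\<close>

lemma mat_bound_pow_diff:
  assumes A: "mat_bound n A c" and B: "mat_bound n B c" and c: "1 \<le> c"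
    and D: "mat_bound n (A - B) e" and e: "0 \<le> e"
  shows "mat_bound n (A ^\<^sub>m k - B ^\<^sub>m k) (real k * c ^ k * e)"
proof (induction k)
  case 0
  then show ?case
    using mat_boundD(1)[OF A] mat_boundD(1)[OF B] mat_bound_zero[of 0 n]
    by (simp add: minus_r_inv_mat[of _ n n])
next
  case (Suc k)
  have Ac: "A \<in> carrier_mat n n" and Bc: "B \<in> carrier_mat n n" using A B by (auto simp: mat_bound_def)
  define P Q where "P = A ^\<^sub>m k" and "Q = B ^\<^sub>m k"
  have P: "P \<in> carrier_mat n n" and Q: "Q \<in> carrier_mat n n" using Ac Bc by (auto simp: P_def Q_def)
  have "P * A - Q * B = P * (A - B) + (P - Q) * B"
    using P Q Ac Bc mult_carrier_mat[OF P Ac] mult_carrier_mat[OF P Bc] mult_carrier_mat[OF Q Bc]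
    by (subst mult_minus_distrib_mat[of _ n n], simp_all, subst minus_mult_distrib_mat[of _ n n], simp_all)
       (intro eq_matI, auto)
  moreover have "mat_bound n (P * (A - B)) (c ^ k * e)"
    unfolding P_def by (rule mat_bound_mult[OF mat_bound_pow[OF A] D]) (use c in auto)
  moreover have "mat_bound n ((P - Q) * B) (real k * c ^ k * e * c)"
    unfolding P_def Q_def by (rule mat_bound_mult[OF Suc.IH B]) (use c e in auto)
  ultimately have "mat_bound n (P * A - Q * B) (c ^ k * e + real k * c ^ k * e * c)"
    using mat_bound_add by metis
  then have "mat_bound n (P * A - Q * B) (real (Suc k) * c ^ Suc k * e)"
  proof (rule mat_bound_mono)
    have "c ^ k * e \<le> c ^ Suc k * e" using c e by (intro mult_right_mono power_increasing) auto
    then show "c ^ k * e + real k * c ^ k * e * c \<le> real (Suc k) * c ^ Suc k * e"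
      by (simp add: algebra_simps)
  qed
  then show ?case by (simp add: P_def Q_def)
qed

section \<open>The approximate trace exponential\<close>

text \<open>The matrix exponential is replaced throughout by the polynomials \<open>(I + A / N)\<^sup>N\<close>; this avoids
  both the functional calculus and questions of measurability.\<close>

definition lin_exp :: "nat \<Rightarrow> nat \<Rightarrow> real mat \<Rightarrow> real mat" where
  "lin_exp n N A = 1\<^sub>m n + (1 / real N) \<cdot>\<^sub>m A"

definition tr_exp :: "nat \<Rightarrow> nat \<Rightarrow> real mat \<Rightarrow> real" where
  "tr_exp n N A = tr (lin_exp n N A ^\<^sub>m N)"

lemma lin_exp_carrier [simp]: "A \<in> carrier_mat n n \<Longrightarrow> lin_exp n N A \<in> carrier_mat n n"
  by (simp add: lin_exp_def)

lemma lin_exp_dim [simp]: "A \<in> carrier_mat n n \<Longrightarrow> dim_row (lin_exp n N A) = n"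
   "A \<in> carrier_mat n n \<Longrightarrow> dim_col (lin_exp n N A) = n"
  by (simp_all add: lin_exp_def)

lemma lin_exp_symmetric:
  assumes "A \<in> carrier_mat n n" "transpose_mat A = A"
  shows "transpose_mat (lin_exp n N A) = lin_exp n N A"
proof (rule eq_matI)
  fix i j assume "i < dim_row (lin_exp n N A)" "j < dim_col (lin_exp n N A)"
  then have ij: "i < n" "j < n" using assms by auto
  have "A $$ (j, i) = A $$ (i, j)" using assms ij by (metis carrier_matD index_transpose_mat(1))
  then show "transpose_mat (lin_exp n N A) $$ (i, j) = lin_exp n N A $$ (i, j)"
    using assms ij by (auto simp: lin_exp_def)
qed (use assms in auto)

lemma lin_exp_mult_vec:
  assumes "A \<in> carrier_mat n n" "v \<in> carrier_vec n"
  shows "lin_exp n N A *\<^sub>v v = v + (1 / real N) \<cdot>\<^sub>v (A *\<^sub>v v)"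
  unfolding lin_exp_def using assms
  by (subst add_mult_distrib_mat_vec[of _ n n]) (auto simp: smult_mat_mult_vec[of _ n n])

lemma mat_bound_lin_exp:
  assumes "mat_bound n A c"
  shows "mat_bound n (lin_exp n N A) (1 + c / real N)"
  using mat_bound_add[OF mat_bound_one mat_bound_smult[OF assms, of "1 / real N"]]
  by (simp add: lin_exp_def)

lemma lin_exp_mult:
  assumes A: "A \<in> carrier_mat n n" and B: "B \<in> carrier_mat n n"
  shows "lin_exp n N A * lin_exp n N B
    = lin_exp n N (A + B) + (1 / (real N)\<^sup>2) \<cdot>\<^sub>m (A * B)"
proof -
  have "lin_exp n N A * lin_exp n N B
      = lin_exp n N A * 1\<^sub>m n + lin_exp n N A * ((1 / real N) \<cdot>\<^sub>m B)"
    unfolding lin_exp_def[of n N B] using A B by (intro mult_add_distrib_mat) auto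
  also have "lin_exp n N A * ((1 / real N) \<cdot>\<^sub>m B) = (1 / real N) \<cdot>\<^sub>m (lin_exp n N A * B)"
    using A B by (intro mult_smult_distrib) auto
  also have "lin_exp n N A * B = B + (1 / real N) \<cdot>\<^sub>m (A * B)"
    unfolding lin_exp_def using A B
    by (subst add_mult_distrib_mat[of _ n n]) (auto simp: mult_smult_assoc_mat[of _ n n _ n])
  finally show ?thesis
    using A B mult_carrier_mat[OF A B]
    by (intro eq_matI) (auto simp: lin_exp_def algebra_simps power2_eq_square simp del: index_mult_mat(1))
qed

lemma power_one_plus_le_exp:
  assumes "0 \<le> x" "N > 0"
  shows "(1 + x / real N) ^ N \<le> exp x"
proof -
  have "(1 + x / real N) ^ N \<le> exp (x / real N) ^ N"
    using assms by (intro power_mono) auto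
  also have "\<dots> = exp x" using assms by (simp flip: exp_of_nat_mult)
  finally show ?thesis .
qed

text \<open>Golden-Thompson for the polynomial exponential. The factors \<open>lin_exp n N A\<close>
  and \<open>lin_exp n N B\<close> multiply to \<open>lin_exp n N (A + B)\<close> up to A B / N^2;
  after N factors this is an error of order 1/N, and the trace costs a further factor
  \<open>n\<close>. The finite trace inequality forces \<open>N\<close> to be a power of
  two.\<close>

lemma tr_exp_add_le:
  assumes A: "mat_bound n A a" and B: "mat_bound n B 1" and a: "0 \<le> a"
    and sA: "transpose_mat A = A" and sB: "transpose_mat B = B" and N: "N = 2 ^ k"
  shows "tr_exp n N (A + B) \<le> tr (lin_exp n N A ^\<^sub>m N * lin_exp n N B ^\<^sub>m N)
    + real n * (a * exp (a + 1)) / real N"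
proof -
  have Ac: "A \<in> carrier_mat n n" and Bc: "B \<in> carrier_mat n n" using A B by (auto simp: mat_bound_def)
  have N0: "N > 0" "real N > 0" using N by auto
  define X Y where "X = lin_exp n N (A + B)" and "Y = lin_exp n N A * lin_exp n N B"
  \<comment> \<open>A common bound, at least 1, for both matrices to be compared; its N-th power
    stays below exp(a + 1) for every \<open>N\<close>.\<close>
  define c where "c = (1 + a / real N) * (1 + 1 / real N)"
  have Xc: "X \<in> carrier_mat n n" and Yc: "Y \<in> carrier_mat n n" using Ac Bc by (auto simp: X_def Y_def)
  have c1: "1 \<le> c" unfolding c_def using a N0 by (simp add: algebra_simps)
  have X: "mat_bound n X c"
    unfolding X_def by (rule mat_bound_mono[OF mat_bound_lin_exp[OF mat_bound_add[OF A B]]])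
      (use a N0 in \<open>simp add: c_def algebra_simps add_divide_distrib\<close>)
  have Y: "mat_bound n Y c"
    unfolding Y_def c_def by (intro mat_bound_mult mat_bound_lin_exp A B) (use a in auto)
  have "X - Y = (- (1 / (real N)\<^sup>2)) \<cdot>\<^sub>m (A * B)"
    unfolding X_def Y_def lin_exp_mult[OF Ac Bc] using Ac Bc mult_carrier_mat[OF Ac Bc]
    by (intro eq_matI) (auto simp del: index_mult_mat(1))
  then have D: "mat_bound n (X - Y) (a / (real N)\<^sup>2)"
    using mat_bound_smult[OF mat_bound_mult[OF A B a], of "- (1 / (real N)\<^sup>2)"] by simp
  have "\<bar>tr (X ^\<^sub>m N) - tr (Y ^\<^sub>m N)\<bar> \<le> real n * (real N * c ^ N * (a / (real N)\<^sup>2))"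
    using mat_bound_abs_tr_le[OF mat_bound_pow_diff[OF X Y c1 D]] a Xc Yc by (simp add: tr_minus[of _ n])
  also have "\<dots> \<le> real n * (real N * exp (a + 1) * (a / (real N)\<^sup>2))"
  proof -
    have "c ^ N = (1 + a / real N) ^ N * (1 + 1 / real N) ^ N" by (simp add: c_def power_mult_distrib)
    also have "\<dots> \<le> exp a * exp 1"
      using a N0 by (intro mult_mono power_one_plus_le_exp) auto
    finally show ?thesis using a
      by (intro mult_left_mono mult_right_mono) (auto simp: exp_add)
  qed
  also have "\<dots> = real n * (a * exp (a + 1)) / real N" using N0 by (simp add: power2_eq_square)
  finally have "tr (X ^\<^sub>m N) \<le> tr (Y ^\<^sub>m N) + real n * (a * exp (a + 1)) / real N" by linarith
  moreover have "tr (Y ^\<^sub>m N) \<le> tr (lin_exp n N A ^\<^sub>m N * lin_exp n N B ^\<^sub>m N)"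
    unfolding Y_def N using tr_pow_power2[of n k] Ac Bc sA sB by (simp add: lin_exp_symmetric)
  ultimately show ?thesis by (simp add: tr_exp_def X_def)
qed

text \<open>The remainder is kept in the form F R F, so that later it can be paid for by the squared
  norm of \<open>F v\<close>. By construction \<open>R\<close> is a polynomial in \<open>F\<close>
  with nonnegative coefficients, and the bound is its value at F = 1.\<close>

lemma lin_exp_pow_expansion:
  assumes F: "mat_bound n F 1" and N: "N > 0"
  shows "\<exists>R. mat_bound n R ((1 + 1 / real N) ^ k - 1 - real k / real N) \<and>
    (\<forall>v\<in>carrier_vec n. lin_exp n N F ^\<^sub>m k *\<^sub>v v
       = v + (real k / real N) \<cdot>\<^sub>v (F *\<^sub>v v) + F *\<^sub>v (R *\<^sub>v (F *\<^sub>v v)))"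
proof (induction k)
  case 0
  have "v = v + 0 \<cdot>\<^sub>v (F *\<^sub>v v) + F *\<^sub>v (0\<^sub>m n n *\<^sub>v (F *\<^sub>v v))" if "v \<in> carrier_vec n" for v
    using F that by (intro eq_vecI) (auto simp: mat_bound_def scalar_prod_def)
  then show ?case
    using mat_boundD(1)[OF F] by (intro exI[of _ "0\<^sub>m n n"]) (auto simp: mat_bound_zero)
next
  case (Suc k)
  have Fc: "F \<in> carrier_mat n n" using F by (simp add: mat_bound_def)
  obtain R where R: "mat_bound n R ((1 + 1 / real N) ^ k - 1 - real k / real N)"
    and ex: "\<And>v. v \<in> carrier_vec n \<Longrightarrow> lin_exp n N F ^\<^sub>m k *\<^sub>v v
       = v + (real k / real N) \<cdot>\<^sub>v (F *\<^sub>v v) + F *\<^sub>v (R *\<^sub>v (F *\<^sub>v v))"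
    using Suc by blast
  have Rc: "R \<in> carrier_mat n n" using R by (simp add: mat_bound_def)
  define r where "r = (1 + 1 / real N) ^ k - 1 - real k / real N"
  \<comment> \<open>Multiplying 1 + (k/N) F + F R F by 1 + F/N leaves, between the outer factors F,
    exactly these three terms.\<close>
  define R' where "R' = R + (1 / real N) \<cdot>\<^sub>m (F * R) + (real k / (real N)\<^sup>2) \<cdot>\<^sub>m 1\<^sub>m n"
  have "mat_bound n R' (r + \<bar>1 / real N\<bar> * (1 * r) + \<bar>real k / (real N)\<^sup>2\<bar> * 1)"
    unfolding R'_def r_def by (intro mat_bound_add mat_bound_smult mat_bound_mult F R mat_bound_one) auto
  moreover have "r + \<bar>1 / real N\<bar> * (1 * r) + \<bar>real k / (real N)\<^sup>2\<bar> * 1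
      = (1 + 1 / real N) ^ Suc k - 1 - real (Suc k) / real N"
    using N by (simp add: r_def field_simps power2_eq_square)
  ultimately have R': "mat_bound n R' ((1 + 1 / real N) ^ Suc k - 1 - real (Suc k) / real N)" by simp
  have "lin_exp n N F ^\<^sub>m Suc k *\<^sub>v v
      = v + (real (Suc k) / real N) \<cdot>\<^sub>v (F *\<^sub>v v) + F *\<^sub>v (R' *\<^sub>v (F *\<^sub>v v))"
    if v: "v \<in> carrier_vec n" for v
  proof -
    define w where "w = F *\<^sub>v v"
    define y where "y = R *\<^sub>v w"
    have w: "w \<in> carrier_vec n" using Fc v by (simp add: w_def)
    have y: "y \<in> carrier_vec n" using Rc w by (simp add: y_def)
    define x where "x = v + (real k / real N) \<cdot>\<^sub>v w + F *\<^sub>v y"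
    have x: "x \<in> carrier_vec n" using Fc w y v by (simp add: x_def)
    have "lin_exp n N F ^\<^sub>m Suc k *\<^sub>v v = lin_exp n N F *\<^sub>v x"
      unfolding pow_mat_Suc_left[OF lin_exp_carrier[OF Fc]] using Fc v ex[OF v]
      by (simp add: x_def w_def y_def assoc_mult_mat_vec[of _ n n _ n])
    also have "\<dots> = x + (1 / real N) \<cdot>\<^sub>v (F *\<^sub>v x)" by (rule lin_exp_mult_vec[OF Fc x])
    also have "F *\<^sub>v x = w + (real k / real N) \<cdot>\<^sub>v (F *\<^sub>v w) + F *\<^sub>v (F *\<^sub>v y)"
      unfolding x_def using Fc v w y
      by (simp add: mult_add_distrib_mat_vec[of _ n n] mult_mat_vec[of _ n n] assoc_add_vec[of _ n] w_def)
    also have "x + (1 / real N) \<cdot>\<^sub>v \<dots> = v + (real (Suc k) / real N) \<cdot>\<^sub>v w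
        + (F *\<^sub>v y + (1 / real N) \<cdot>\<^sub>v (F *\<^sub>v (F *\<^sub>v y)) + (real k / (real N)\<^sup>2) \<cdot>\<^sub>v (F *\<^sub>v w))"
      unfolding x_def using Fc v w y
      by (intro eq_vecI) (auto simp: algebra_simps add_divide_distrib power2_eq_square simp del: index_mult_mat_vec)
    also have "F *\<^sub>v y + (1 / real N) \<cdot>\<^sub>v (F *\<^sub>v (F *\<^sub>v y)) + (real k / (real N)\<^sup>2) \<cdot>\<^sub>v (F *\<^sub>v w)
        = F *\<^sub>v (y + (1 / real N) \<cdot>\<^sub>v (F *\<^sub>v y) + (real k / (real N)\<^sup>2) \<cdot>\<^sub>v w)"
      using Fc w y by (simp add: mult_add_distrib_mat_vec[of _ n n] mult_mat_vec[of _ n n] assoc_add_vec[of _ n])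
    also have "y + (1 / real N) \<cdot>\<^sub>v (F *\<^sub>v y) + (real k / (real N)\<^sup>2) \<cdot>\<^sub>v w = R' *\<^sub>v w"
      unfolding R'_def y_def using Fc Rc w
      by (simp add: add_mult_distrib_mat_vec[of _ n n] smult_mat_mult_vec[of _ n n] assoc_mult_mat_vec[of _ n n _ n] assoc_add_vec[of _ n])
    finally show ?thesis by (simp add: w_def)
  qed
  with R' show ?case by blast
qed

text \<open>Matrix form of exp x \<le> 1 + x + x^2 for |x| \<le> 1: the remainder matrix has norm at
  most (1 + 1/N)^N - 2, which is at most 3 - 2.\<close>

lemma lin_exp_pow_quad_le:
  assumes F: "mat_bound n F 1" and sF: "transpose_mat F = F" and N: "N > 0" and v: "v \<in> carrier_vec n"
  shows "v \<bullet> (lin_exp n N F ^\<^sub>m N *\<^sub>v v) \<le> (vnorm v)\<^sup>2 + v \<bullet> (F *\<^sub>v v) + (vnorm (F *\<^sub>v v))\<^sup>2"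
proof -
  have Fc: "F \<in> carrier_mat n n" using F by (simp add: mat_bound_def)
  define w where "w = F *\<^sub>v v"
  have w: "w \<in> carrier_vec n" using Fc v by (simp add: w_def)
  obtain R where R: "mat_bound n R ((1 + 1 / real N) ^ N - 1 - real N / real N)"
    and ex: "lin_exp n N F ^\<^sub>m N *\<^sub>v v = v + (real N / real N) \<cdot>\<^sub>v w + F *\<^sub>v (R *\<^sub>v w)"
    using lin_exp_pow_expansion[OF F N, of N] v unfolding w_def by blast
  have Rc: "R \<in> carrier_mat n n" using R by (simp add: mat_bound_def)
  have "(1 + 1 / real N) ^ N \<le> exp 1" using power_one_plus_le_exp[of 1 N] N by simp
  also have "exp 1 \<le> (3::real)" by (rule exp_le)
  finally have R1: "mat_bound n R 1" using mat_bound_mono[OF R, of 1] N by simp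
  have "v \<bullet> (F *\<^sub>v (R *\<^sub>v w)) = w \<bullet> (R *\<^sub>v w)"
    using transpose_vec_mult_scalar[OF Fc, of "R *\<^sub>v w" v] Rc v w sF by (simp add: w_def)
  also have "\<dots> \<le> vnorm w * vnorm (R *\<^sub>v w)" using abs_scalar_prod_le[of w n "R *\<^sub>v w"] Rc w by simp
  also have "\<dots> \<le> (vnorm w)\<^sup>2"
    using mat_boundD(2)[OF R1 w] by (simp add: power2_eq_square mult_left_mono)
  finally have 1: "v \<bullet> (F *\<^sub>v (R *\<^sub>v w)) \<le> (vnorm w)\<^sup>2" .
  have "lin_exp n N F ^\<^sub>m N *\<^sub>v v = v + w + F *\<^sub>v (R *\<^sub>v w)" using ex N by simp
  then have "v \<bullet> (lin_exp n N F ^\<^sub>m N *\<^sub>v v) = v \<bullet> v + v \<bullet> w + v \<bullet> (F *\<^sub>v (R *\<^sub>v w))"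
    using Fc Rc v w by (simp add: scalar_prod_add_distrib[of _ n])
  then show ?thesis using 1 by (simp add: vnorm_sq w_def)
qed

text \<open>Turns a trace against a square into quadratic forms of \<open>Q\<close> on fixed
  vectors. Bounds on these forms can then be integrated one vector at a time, without an order on
  matrices.\<close>

lemma tr_symmetric_square_mult:
  assumes W: "W \<in> carrier_mat n n" and sW: "transpose_mat W = W" and Q: "Q \<in> carrier_mat n n"
  shows "tr (W * W * Q) = (\<Sum>i<n. col W i \<bullet> (Q *\<^sub>v col W i))"
proof -
  have rc: "row W i = col W i" if "i < n" for i
    using W that by (metis carrier_matD(2) row_transpose sW)
  have "tr (W * W * Q) = tr (W * (W * Q))" using W Q by simp
  also have "\<dots> = tr (W * Q * W)" by (rule tr_comm[of _ n]) (use W Q in auto)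
  also have "\<dots> = tr (W * (Q * W))" using W Q by simp
  also have "\<dots> = (\<Sum>i<n. col W i \<bullet> (Q *\<^sub>v col W i))"
    unfolding tr_eq[OF mult_carrier_mat[OF W mult_carrier_mat[OF Q W]]]
    using W Q by (intro sum.cong) (auto simp: rc col_mult2)
  finally show ?thesis .
qed

lemma vnorm_mult_mat_vec_sq_le:
  assumes A: "A \<in> carrier_mat n n" and v: "v \<in> carrier_vec n"
  shows "(vnorm (A *\<^sub>v v))\<^sup>2 \<le> tr (transpose_mat A * A) * (vnorm v)\<^sup>2"
proof -
  have "(vnorm (A *\<^sub>v v))\<^sup>2 = (\<Sum>i<n. (row A i \<bullet> v)\<^sup>2)"
    using A v by (subst vnorm_sq_sum[of _ n]) auto
  also have "\<dots> \<le> (\<Sum>i<n. (vnorm (row A i))\<^sup>2 * (vnorm v)\<^sup>2)"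
    using A v by (intro sum_mono scalar_prod_sq_le[of _ n]) auto
  also have "\<dots> = (\<Sum>i<n. \<Sum>l<n. (A $$ (i, l))\<^sup>2) * (vnorm v)\<^sup>2"
    unfolding sum_distrib_right[symmetric]
    using A by (intro arg_cong2[where f = "(*)"] sum.cong refl) (auto simp: vnorm_sq_sum[of _ n])
  also have "(\<Sum>i<n. \<Sum>l<n. (A $$ (i, l))\<^sup>2) = tr (transpose_mat A * A)"
    unfolding tr_transpose_mult_self[OF A] by (rule sum.swap)
  finally show ?thesis .
qed

text \<open>Replaces the comparison of the largest eigenvalue with the trace. Repeated use of
  \<open>(v \<bullet> X v)^2 \<le> |X v|^2 = v \<bullet> X X v\<close> moves the power inside the
  form, and the Frobenius norm then dominates.\<close>

lemma tr_pow_ge_quad: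
  assumes A: "A \<in> carrier_mat n n" and sA: "transpose_mat A = A"
    and v: "v \<in> carrier_vec n" "vnorm v = 1"
  shows "(v \<bullet> (A *\<^sub>v v)) ^ (2 * 2 ^ k) \<le> tr (A ^\<^sub>m (2 * 2 ^ k))"
proof -
  have sq: "transpose_mat (X * X) = X * X" "X * X \<in> carrier_mat n n" "v \<bullet> (X * X *\<^sub>v v) = (vnorm (X *\<^sub>v v))\<^sup>2"
    "(v \<bullet> (X *\<^sub>v v))\<^sup>2 \<le> (vnorm (X *\<^sub>v v))\<^sup>2"
    if X: "X \<in> carrier_mat n n" "transpose_mat X = X" for X
  proof -
    show "transpose_mat (X * X) = X * X" using transpose_mult[of X n n X n] X by simp
    show "v \<bullet> (X * X *\<^sub>v v) = (vnorm (X *\<^sub>v v))\<^sup>2"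
      using transpose_vec_mult_scalar[OF X(1), of "X *\<^sub>v v" v] X v by (simp add: vnorm_sq)
    show "(v \<bullet> (X *\<^sub>v v))\<^sup>2 \<le> (vnorm (X *\<^sub>v v))\<^sup>2"
      using scalar_prod_sq_le[of v n "X *\<^sub>v v"] X v by simp
  qed (use X in auto)
  have "(v \<bullet> (X *\<^sub>v v)) ^ (2 ^ Suc k) \<le> v \<bullet> (X ^\<^sub>m (2 ^ Suc k) *\<^sub>v v)"
    if "X \<in> carrier_mat n n" "transpose_mat X = X" for X
    using that
  proof (induction k arbitrary: X)
    case 0
    then show ?case using sq[of X] by (simp add: numeral_2_eq_2)
  next
    case (Suc k)
    have "(v \<bullet> (X *\<^sub>v v)) ^ (2 ^ Suc (Suc k)) = ((v \<bullet> (X *\<^sub>v v))\<^sup>2) ^ (2 ^ Suc k)"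
      by (simp flip: power_mult)
    also have "\<dots> \<le> (v \<bullet> (X * X *\<^sub>v v)) ^ (2 ^ Suc k)"
      using sq[of X] Suc.prems by (intro power_mono) auto
    also have "\<dots> \<le> v \<bullet> ((X * X) ^\<^sub>m (2 ^ Suc k) *\<^sub>v v)" by (rule Suc.IH) (use sq[of X] Suc.prems in auto)
    also have "(X * X) ^\<^sub>m (2 ^ Suc k) = X ^\<^sub>m (2 ^ Suc (Suc k))"
      using pow_mat_mult[OF Suc.prems(1), of 2 "2 ^ Suc k"] Suc.prems by (simp add: numeral_2_eq_2)
    finally show ?case .
  qed
  from this[OF A sA] have "(v \<bullet> (A *\<^sub>v v)) ^ (2 * 2 ^ k) \<le> v \<bullet> (A ^\<^sub>m (2 * 2 ^ k) *\<^sub>v v)" by simp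
  also have "\<dots> = (vnorm (A ^\<^sub>m (2 ^ k) *\<^sub>v v))\<^sup>2"
    using sq(3)[of "A ^\<^sub>m (2 ^ k)"] A sA
    by (simp add: transpose_pow_mat[of _ n] mult_2 pow_mat_add[of _ n])
  also have "\<dots> \<le> tr (A ^\<^sub>m (2 * 2 ^ k))"
    using vnorm_mult_mat_vec_sq_le[of "A ^\<^sub>m (2 ^ k)" n v] A sA v
    by (simp add: transpose_pow_mat[of _ n] mult_2 pow_mat_add[of _ n])
  finally show ?thesis .
qed

section \<open>A matrix tail bound\<close>

lemma quad_form_sum:
  assumes "A \<in> carrier_mat n n" "v \<in> carrier_vec n" "w \<in> carrier_vec n"
  shows "v \<bullet> (A *\<^sub>v w) = (\<Sum>i<n. \<Sum>j<n. v $ i * (A $$ (i, j) * w $ j))"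
  using assms by (auto simp: scalar_prod_def sum_distrib_left lessThan_atLeast0)

lemma vnorm_mult_mat_vec_sum:
  assumes "A \<in> carrier_mat n n" "v \<in> carrier_vec n"
  shows "(vnorm (A *\<^sub>v v))\<^sup>2 = (\<Sum>i<n. (\<Sum>j<n. A $$ (i, j) * v $ j)\<^sup>2)"
  using assms by (subst vnorm_sq_sum[of _ n]) (auto simp: scalar_prod_def lessThan_atLeast0)

lemma borel_measurable_pow_mat:
  fixes A :: "'a \<Rightarrow> real mat"
  assumes c: "\<And>x. A x \<in> carrier_mat n n"
    and m: "\<And>i j. i < n \<Longrightarrow> j < n \<Longrightarrow> (\<lambda>x. A x $$ (i, j)) \<in> borel_measurable M"
    and ij: "i < n" "j < n"
  shows "(\<lambda>x. (A x ^\<^sub>m k) $$ (i, j)) \<in> borel_measurable M"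
  using ij
proof (induction k arbitrary: i j)
  case 0
  have "A x ^\<^sub>m 0 = 1\<^sub>m n" for x using c[of x] by simp
  then show ?case by simp
next
  case (Suc k)
  have "(A x ^\<^sub>m Suc k) $$ (i, j) = (\<Sum>l<n. (A x ^\<^sub>m k) $$ (i, l) * A x $$ (l, j))" for x
    using index_mult_mat_sum[OF pow_carrier_mat[OF c] c, of i j x k x] Suc.prems by simp
  then show ?case using Suc m by simp
qed

lemma borel_measurable_tr_exp:
  fixes A :: "'a \<Rightarrow> real mat"
  assumes c: "\<And>x. A x \<in> carrier_mat n n"
    and m: "\<And>i j. i < n \<Longrightarrow> j < n \<Longrightarrow> (\<lambda>x. A x $$ (i, j)) \<in> borel_measurable M"
  shows "(\<lambda>x. tr_exp n N (A x)) \<in> borel_measurable M"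
proof -
  have "tr_exp n N (A x) = (\<Sum>i<n. (lin_exp n N (A x) ^\<^sub>m N) $$ (i, i))" for x
    unfolding tr_exp_def by (rule tr_eq) (use c in auto)
  moreover have "(\<lambda>x. (lin_exp n N (A x) ^\<^sub>m N) $$ (i, i)) \<in> borel_measurable M" if "i < n" for i
  proof (rule borel_measurable_pow_mat[where n = n])
    fix a b assume ab: "a < n" "b < n"
    have "lin_exp n N (A x) $$ (a, b) = 1\<^sub>m n $$ (a, b) + 1 / real N * A x $$ (a, b)" for x
      using ab carrier_matD[OF c[of x]] by (simp add: lin_exp_def)
    then show "(\<lambda>x. lin_exp n N (A x) $$ (a, b)) \<in> borel_measurable M" using m[OF ab] by simp
  qed (use c that in auto)
  ultimately show ?thesis by simp
qed

text \<open>The assumption \<open>moment\<close> bounds first and second moment together and from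
  above only. It thus covers centered matrices, positive matrices with small mean, and dilations of
  vectors with a small bias.\<close>

locale bounded_random_matrix = prob_space D for D :: "'a measure" +
  fixes n :: nat and F :: "'a \<Rightarrow> real mat" and \<rho> :: real
  assumes entries: "\<And>i j. i < n \<Longrightarrow> j < n \<Longrightarrow> (\<lambda>x. F x $$ (i, j)) \<in> borel_measurable D"
    and bounded: "\<And>x. x \<in> space D \<Longrightarrow> mat_bound n (F x) 1"
    and symmetric: "\<And>x. x \<in> space D \<Longrightarrow> transpose_mat (F x) = F x"
    and moment: "\<And>v. v \<in> carrier_vec n \<Longrightarrow>
      (\<integral>x. v \<bullet> (F x *\<^sub>v v) + (vnorm (F x *\<^sub>v v))\<^sup>2 \<partial>D) \<le> \<rho> * (vnorm v)\<^sup>2"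
    and rho_nonneg: "0 \<le> \<rho>"
begin

definition partial_sum :: "nat \<Rightarrow> (nat \<Rightarrow> 'a) \<Rightarrow> real mat" where
  "partial_sum m x = Matrix.mat n n (\<lambda>(i, j). \<Sum>k<m. F (x k) $$ (i, j))"

lemma carrier: "x \<in> space D \<Longrightarrow> F x \<in> carrier_mat n n"
  using bounded mat_boundD(1) by blast

lemma partial_sum_carrier [simp]: "partial_sum m x \<in> carrier_mat n n"
  by (simp add: partial_sum_def)

lemma partial_sum_Suc:
  assumes "x m \<in> space D"
  shows "partial_sum (Suc m) x = partial_sum m x + F (x m)"
  using carrier[OF assms] by (intro eq_matI) (auto simp: partial_sum_def)

lemma partial_sum_bound:
  "(\<And>k. k < m \<Longrightarrow> x k \<in> space D) \<Longrightarrow>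
    mat_bound n (partial_sum m x) (real m) \<and> transpose_mat (partial_sum m x) = partial_sum m x"
proof (induction m)
  case 0
  have "partial_sum 0 x = 0\<^sub>m n n" by (intro eq_matI) (auto simp: partial_sum_def)
  then show ?case by (simp add: mat_bound_zero)
next
  case (Suc m)
  then have x: "x m \<in> space D" by simp
  have "transpose_mat (partial_sum m x + F (x m)) = transpose_mat (partial_sum m x) + transpose_mat (F (x m))"
    by (rule transpose_add[of _ n n]) (use carrier[OF x] in auto)
  then show ?case
    using Suc mat_bound_add[of n "partial_sum m x" "real m" "F (x m)" 1] bounded[OF x] symmetric[OF x]
    by (simp add: partial_sum_Suc[of x m, OF x] add.commute)
qed

lemma partial_sum_quad:
  assumes x: "\<And>k. k < m \<Longrightarrow> x k \<in> space D" and v: "v \<in> carrier_vec n"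
  shows "v \<bullet> (partial_sum m x *\<^sub>v v) = (\<Sum>k<m. v \<bullet> (F (x k) *\<^sub>v v))"
  using x
proof (induction m)
  case 0
  have "partial_sum 0 x = 0\<^sub>m n n" by (intro eq_matI) (auto simp: partial_sum_def)
  moreover have "0\<^sub>m n n *\<^sub>v v = 0\<^sub>v n" using v by (intro eq_vecI) (auto simp: scalar_prod_def)
  ultimately show ?case using v by simp
next
  case (Suc m)
  then have x: "x m \<in> space D" by simp
  show ?case
    using Suc v carrier[OF x]
    by (simp add: partial_sum_Suc[of x m, OF x] add_mult_distrib_mat_vec[of _ n n]
        scalar_prod_add_distrib[of _ n] mult_mat_vec_carrier[of _ n n])
qed

lemma integrable_quad:
  assumes v: "v \<in> carrier_vec n"
  shows "integrable D (\<lambda>x. v \<bullet> (F x *\<^sub>v v) + (vnorm (F x *\<^sub>v v))\<^sup>2)"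
proof (rule integrable_const_bound[where B = "2 * (vnorm v)\<^sup>2"])
  have "v \<bullet> (F x *\<^sub>v v) + (vnorm (F x *\<^sub>v v))\<^sup>2
      = (\<Sum>i<n. \<Sum>j<n. v $ i * (F x $$ (i, j) * v $ j)) + (\<Sum>i<n. (\<Sum>j<n. F x $$ (i, j) * v $ j)\<^sup>2)"
    if "x \<in> space D" for x
    using quad_form_sum[OF carrier[OF that] v v] vnorm_mult_mat_vec_sum[OF carrier[OF that] v] by simp
  moreover have "(\<lambda>x. (\<Sum>i<n. \<Sum>j<n. v $ i * (F x $$ (i, j) * v $ j))
      + (\<Sum>i<n. (\<Sum>j<n. F x $$ (i, j) * v $ j)\<^sup>2)) \<in> borel_measurable D"
    using entries by (intro borel_measurable_add borel_measurable_sum borel_measurable_times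
        borel_measurable_power borel_measurable_const) auto
  ultimately show "(\<lambda>x. v \<bullet> (F x *\<^sub>v v) + (vnorm (F x *\<^sub>v v))\<^sup>2) \<in> borel_measurable D"
    by (subst measurable_cong) auto
  show "AE x in D. norm (v \<bullet> (F x *\<^sub>v v) + (vnorm (F x *\<^sub>v v))\<^sup>2) \<le> 2 * (vnorm v)\<^sup>2"
  proof (rule AE_I2)
    fix x assume x: "x \<in> space D"
    have b: "vnorm (F x *\<^sub>v v) \<le> vnorm v" using mat_boundD(2)[OF bounded[OF x] v] by simp
    have "\<bar>v \<bullet> (F x *\<^sub>v v)\<bar> \<le> vnorm v * vnorm (F x *\<^sub>v v)"
      by (rule abs_scalar_prod_le[of _ n]) (use v carrier[OF x] in auto)
    also have "\<dots> \<le> vnorm v * vnorm v" by (rule mult_left_mono[OF b]) simp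
    finally have 1: "\<bar>v \<bullet> (F x *\<^sub>v v)\<bar> \<le> (vnorm v)\<^sup>2" by (simp add: power2_eq_square)
    have "(vnorm (F x *\<^sub>v v))\<^sup>2 \<le> (vnorm v)\<^sup>2" by (rule power_mono[OF b]) simp
    with 1 show "norm (v \<bullet> (F x *\<^sub>v v) + (vnorm (F x *\<^sub>v v))\<^sup>2) \<le> 2 * (vnorm v)\<^sup>2"
      unfolding real_norm_def using zero_le_power2[of "vnorm (F x *\<^sub>v v)"] by linarith
  qed
qed

text \<open>One step of the Laplace-transform argument: Golden-Thompson splits off the fresh
  summand, the quadratic bound for its exponential is integrated, and \<open>moment\<close> produces
  the factor 1 + \<rho>. The nonnegative integral spares an integrability proof for
  \<open>tr_exp\<close>.\<close>

lemma nn_integral_tr_exp_step: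
  assumes A: "mat_bound n A a" "transpose_mat A = A" and a: "0 \<le> a" and N: "N = 2 ^ Suc k"
  shows "(\<integral>\<^sup>+y. ennreal (tr_exp n N (A + F y)) \<partial>D)
    \<le> ennreal ((1 + \<rho>) * tr_exp n N A + real n * (a * exp (a + 1)) / real N)"
proof -
  define err where "err = real n * (a * exp (a + 1)) / real N"
  have Ac: "A \<in> carrier_mat n n" using A by (simp add: mat_bound_def)
  \<comment> \<open>Since \<open>N\<close> is twice \<open>2 ^ k\<close>, the N-th power is the
    square of the symmetric \<open>W\<close>, and the trace splits over the columns of
    \<open>W\<close>.\<close>
  define W where "W = lin_exp n N A ^\<^sub>m (2 ^ k)"
  have W: "W \<in> carrier_mat n n" using Ac by (simp add: W_def)
  have sW: "transpose_mat W = W"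
    using Ac A by (simp add: W_def transpose_pow_mat[of _ n] lin_exp_symmetric)
  have WW: "lin_exp n N A ^\<^sub>m N = W * W"
    using pow_mat_add[of "lin_exp n N A" n "2 ^ k" "2 ^ k"] Ac by (simp add: W_def N mult_2)
  define q where "q i y = col W i \<bullet> (F y *\<^sub>v col W i) + (vnorm (F y *\<^sub>v col W i))\<^sup>2" for i y
  define g where "g y = (\<Sum>i<n. (vnorm (col W i))\<^sup>2
      + q i y) + err" for y
  have cW: "col W i \<in> carrier_vec n" if "i < n" for i using W that by auto
  have trW: "(\<Sum>i<n. (vnorm (col W i))\<^sup>2) = tr_exp n N A"
    using tr_symmetric_square_mult[OF W sW one_carrier_mat] W
    by (simp add: tr_exp_def WW vnorm_sq one_mult_mat_vec[OF cW])
  have le: "tr_exp n N (A + F y) \<le> g y" if y: "y \<in> space D" for y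
  proof -
    have "tr_exp n N (A + F y) \<le> tr (W * W * lin_exp n N (F y) ^\<^sub>m N) + err"
      using tr_exp_add_le[OF A(1) bounded[OF y] a A(2) symmetric[OF y] N] by (simp add: WW err_def)
    also have "tr (W * W * lin_exp n N (F y) ^\<^sub>m N)
        = (\<Sum>i<n. col W i \<bullet> (lin_exp n N (F y) ^\<^sub>m N *\<^sub>v col W i))"
      by (rule tr_symmetric_square_mult[OF W sW]) (use carrier[OF y] in auto)
    also have "\<dots> \<le> (\<Sum>i<n. (vnorm (col W i))\<^sup>2
        + q i y)"
      using lin_exp_pow_quad_le[OF bounded[OF y] symmetric[OF y] _ cW, of N] N
      by (intro sum_mono) (simp add: add.assoc q_def)
    finally show ?thesis by (simp add: g_def)
  qed
  have iq: "integrable D (q i)" if "i < n" for i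
    unfolding q_def by (rule integrable_quad[OF cW[OF that]])
  have int: "integrable D g"
    unfolding g_def using iq by (intro Bochner_Integration.integrable_add Bochner_Integration.integrable_sum) auto
  have g0: "0 \<le> g y" if y: "y \<in> space D" for y
  proof -
    have "0 \<le> tr_exp n N (A + F y)"
    proof -
      have "transpose_mat (A + F y) = A + F y"
        using transpose_add[OF Ac carrier[OF y]] A symmetric[OF y] by simp
      then show ?thesis
        unfolding tr_exp_def N using tr_pow_even_nonneg[of "lin_exp n (2 ^ Suc k) (A + F y)" n "2 ^ k"]
          Ac carrier[OF y] by (simp add: lin_exp_symmetric)
    qed
    then show ?thesis using le[OF y] by linarith
  qed
  have "(\<integral>\<^sup>+y. ennreal (tr_exp n N (A + F y)) \<partial>D) \<le> (\<integral>\<^sup>+y. ennreal (g y) \<partial>D)"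
    using le by (intro nn_integral_mono ennreal_leI) auto
  also have "\<dots> = ennreal (\<integral>y. g y \<partial>D)" using int g0 by (intro nn_integral_eq_integral AE_I2) auto
  also have "(\<integral>y. g y \<partial>D) = (\<Sum>i<n. (vnorm (col W i))\<^sup>2
      + (\<integral>y. q i y \<partial>D)) + err"
  proof -
    have i1: "integrable D (\<lambda>y. (vnorm (col W i))\<^sup>2
      + q i y)" if "i < n" for i
      using iq[OF that] by (intro Bochner_Integration.integrable_add) auto
    have "(\<integral>y. g y \<partial>D) = (\<integral>y. (\<Sum>i<n. (vnorm (col W i))\<^sup>2
      + q i y) \<partial>D) + (\<integral>y. err \<partial>D)"
      unfolding g_def using i1 by (intro Bochner_Integration.integral_add Bochner_Integration.integrable_sum) auto
    also have "(\<integral>y. (\<Sum>i<n. (vnorm (col W i))\<^sup>2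
      + q i y) \<partial>D)
      = (\<Sum>i<n. \<integral>y. (vnorm (col W i))\<^sup>2
      + q i y \<partial>D)"
      using i1 by (intro Bochner_Integration.integral_sum) auto
    also have "\<dots> = (\<Sum>i<n. (vnorm (col W i))\<^sup>2
      + (\<integral>y. q i y \<partial>D))"
      using iq by (intro sum.cong refl) (simp add: Bochner_Integration.integral_add prob_space)
    finally show ?thesis by (simp add: prob_space)
  qed
  also have "\<dots> \<le> (\<Sum>i<n. (vnorm (col W i))\<^sup>2 + \<rho> * (vnorm (col W i))\<^sup>2) + err"
    using moment[OF cW] unfolding q_def by (intro add_right_mono sum_mono add_left_mono) auto
  also have "\<dots> = (1 + \<rho>) * tr_exp n N A + err"
    by (simp add: sum.distrib trW[symmetric] sum_distrib_left[symmetric] algebra_simps)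
  finally show ?thesis by (simp add: err_def ennreal_leI)
qed

lemma borel_measurable_partial_sum:
  assumes "i < n" "j < n" "m \<le> l"
  shows "(\<lambda>x. partial_sum m x $$ (i, j)) \<in> borel_measurable (PiM {..<l} (\<lambda>_. D))"
proof -
  have "(\<lambda>x. F (x k) $$ (i, j)) \<in> borel_measurable (PiM {..<l} (\<lambda>_. D))" if "k < m" for k
    using that assms by (intro measurable_compose[where g = "\<lambda>y. F y $$ (i, j)" and f = "\<lambda>x. x k" and N = D] measurable_component_singleton entries) auto
  then show ?thesis using assms by (simp add: partial_sum_def)
qed

text \<open>Fubini in the last coordinate. The error is taken at a fixed horizon \<open>l\<close>,
  which bounds the norm of every partial sum, so it is the same in each step of the
  induction.\<close>

lemma nn_integral_tr_exp:
  assumes N: "N = 2 ^ Suc k" and "m \<le> l"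
  shows "(\<integral>\<^sup>+x. ennreal (tr_exp n N (partial_sum m x)) \<partial>PiM {..<m} (\<lambda>_. D))
    \<le> ennreal ((1 + \<rho>) ^ m * (real n + real m * (real n * (real l * exp (real l + 1)) / real N)))"
  using \<open>m \<le> l\<close>
proof (induction m)
  case 0
  have "lin_exp n N (partial_sum 0 x) = 1\<^sub>m n" for x
    by (intro eq_matI) (auto simp: partial_sum_def lin_exp_def)
  moreover have "1\<^sub>m n ^\<^sub>m j = (1\<^sub>m n :: real mat)" for j by (induction j) auto
  ultimately have "tr_exp n N (partial_sum 0 x) = real n" for x
    by (simp add: tr_exp_def tr_def)
  then show ?case by (simp add: PiM_empty nn_integral_count_space_finite)
next
  case (Suc m)
  interpret product_sigma_finite "\<lambda>_::nat. D" by standard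
  define err where "err = real n * (real l * exp (real l + 1)) / real N"
  have err: "0 \<le> err" by (simp add: err_def)
  have tr0: "0 \<le> tr_exp n N (partial_sum m x)" if "x \<in> space (PiM {..<m} (\<lambda>_. D))" for x
  proof -
    have "transpose_mat (partial_sum m x) = partial_sum m x"
      using that by (intro conjunct2[OF partial_sum_bound]) (auto simp: space_PiM)
    then show ?thesis
      unfolding tr_exp_def N using tr_pow_even_nonneg[of "lin_exp n (2 ^ Suc k) (partial_sum m x)" n "2 ^ k"]
      by (simp add: lin_exp_symmetric)
  qed
  have "(\<integral>\<^sup>+x. ennreal (tr_exp n N (partial_sum (Suc m) x)) \<partial>PiM {..<Suc m} (\<lambda>_. D))
      = (\<integral>\<^sup>+x. \<integral>\<^sup>+y. ennreal (tr_exp n N (partial_sum (Suc m) (x(m := y)))) \<partial>D \<partial>PiM {..<m} (\<lambda>_. D))"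
  proof -
    have "(\<lambda>x. ennreal (tr_exp n N (partial_sum (Suc m) x))) \<in> borel_measurable (PiM {..<Suc m} (\<lambda>_. D))"
      by (intro measurable_compose[OF _ measurable_ennreal] borel_measurable_tr_exp borel_measurable_partial_sum) auto
    then show ?thesis
      using product_nn_integral_insert[of "{..<m}" m "\<lambda>x. ennreal (tr_exp n N (partial_sum (Suc m) x))"]
      by (simp add: lessThan_Suc)
  qed
  also have "\<dots> \<le> (\<integral>\<^sup>+x. ennreal ((1 + \<rho>) * tr_exp n N (partial_sum m x) + err) \<partial>PiM {..<m} (\<lambda>_. D))"
  proof (rule nn_integral_mono)
    fix x assume x: "x \<in> space (PiM {..<m} (\<lambda>_. D))"
    then have xs: "x i \<in> space D" if "i < m" for i using that by (auto simp: space_PiM)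
    have eq: "partial_sum (Suc m) (x(m := y)) = partial_sum m x + F y" if "y \<in> space D" for y
      using partial_sum_Suc[of "x(m := y)" m] that by (simp add: partial_sum_def)
    have b: "mat_bound n (partial_sum m x) (real m)" "transpose_mat (partial_sum m x) = partial_sum m x"
      using partial_sum_bound[of m x] xs by auto
    have "(\<integral>\<^sup>+y. ennreal (tr_exp n N (partial_sum (Suc m) (x(m := y)))) \<partial>D)
        = (\<integral>\<^sup>+y. ennreal (tr_exp n N (partial_sum m x + F y)) \<partial>D)"
      by (intro nn_integral_cong) (simp add: eq)
    also have "\<dots> \<le> ennreal ((1 + \<rho>) * tr_exp n N (partial_sum m x) + real n * (real l * exp (real l + 1)) / real N)"
      by (rule nn_integral_tr_exp_step[OF mat_bound_mono[OF b(1)] b(2) _ N]) (use Suc.prems in auto)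
    finally show "(\<integral>\<^sup>+y. ennreal (tr_exp n N (partial_sum (Suc m) (x(m := y)))) \<partial>D)
      \<le> ennreal ((1 + \<rho>) * tr_exp n N (partial_sum m x) + err)" by (simp add: err_def)
  qed
  also have "\<dots> = (\<integral>\<^sup>+x. ennreal (1 + \<rho>) * ennreal (tr_exp n N (partial_sum m x)) + ennreal err \<partial>PiM {..<m} (\<lambda>_. D))"
    using rho_nonneg err tr0 by (intro nn_integral_cong) (simp add: ennreal_plus ennreal_mult)
  also have "\<dots> = ennreal (1 + \<rho>) * (\<integral>\<^sup>+x. ennreal (tr_exp n N (partial_sum m x)) \<partial>PiM {..<m} (\<lambda>_. D)) + ennreal err"
  proof -
    interpret P: prob_space "PiM {..<m} (\<lambda>_. D)" by (rule prob_space_PiM) (rule prob_space_axioms)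
    have [measurable]: "(\<lambda>x. tr_exp n N (partial_sum m x)) \<in> borel_measurable (PiM {..<m} (\<lambda>_. D))"
      by (intro borel_measurable_tr_exp borel_measurable_partial_sum) auto
    show ?thesis by (subst nn_integral_add) (auto simp: nn_integral_cmult P.emeasure_space_1)
  qed
  also have "\<dots> \<le> ennreal (1 + \<rho>) * ennreal ((1 + \<rho>) ^ m * (real n + real m * err)) + ennreal err"
    using Suc by (intro add_right_mono mult_left_mono) (auto simp: err_def)
  also have "\<dots> = ennreal ((1 + \<rho>) * ((1 + \<rho>) ^ m * (real n + real m * err)) + err)"
    using rho_nonneg err by (simp add: ennreal_mult ennreal_plus)
  also have "\<dots> \<le> ennreal ((1 + \<rho>) ^ Suc m * (real n + real (Suc m) * err))"
  proof (rule ennreal_leI)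
    have "1 * err \<le> (1 + \<rho>) ^ Suc m * err" using rho_nonneg err by (intro mult_right_mono one_le_power) auto
    then show "(1 + \<rho>) * ((1 + \<rho>) ^ m * (real n + real m * err)) + err \<le> (1 + \<rho>) ^ Suc m * (real n + real (Suc m) * err)"
      by (simp add: algebra_simps)
  qed
  finally show ?case by (simp add: err_def)
qed

text \<open>Markov's inequality for the approximate trace exponential at level t = m \<rho> + b. The
  conclusion holds for all \<open>v\<close> on a single event, which is what an operator norm bound
  requires.\<close>

theorem matrix_tail:
  assumes b: "0 \<le> b"
  shows "\<exists>A\<in>sets (PiM {..<m} (\<lambda>_. D)). 1 - real n * exp (- b) \<le> measure (PiM {..<m} (\<lambda>_. D)) A \<and>
    (\<forall>x\<in>A. \<forall>v\<in>carrier_vec n. (\<Sum>k<m. v \<bullet> (F (x k) *\<^sub>v v)) \<le> (real m * \<rho> + b) * (vnorm v)\<^sup>2)"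
proof -
  let ?P = "PiM {..<m} (\<lambda>_. D)"
  interpret P: prob_space ?P by (rule prob_space_PiM) (rule prob_space_axioms)
  define t where "t = real m * \<rho> + b"
  have t: "0 \<le> t" using b rho_nonneg by (simp add: t_def)
  define N where "N k = (2::nat) ^ Suc k" for k
  have N0: "0 < N k" for k by (simp add: N_def)
  \<comment> \<open>The threshold has the same form as the lower bound (1 + \<lambda> / N)^N on the
    trace for a value \<lambda> of the quadratic form at a unit vector. Hence each
    \<open>A k\<close> gives \<lambda> \<le> t with no loss, for every finite
    \<open>N\<close>.\<close>
  define A where "A k = {x \<in> space ?P. tr_exp n (N k) (partial_sum m x) \<le> (1 + t / real (N k)) ^ N k}" for k
  have meas [measurable]: "(\<lambda>x. tr_exp n (N k) (partial_sum m x)) \<in> borel_measurable ?P" for k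
    by (intro borel_measurable_tr_exp borel_measurable_partial_sum) auto
  have A: "A k \<in> sets ?P" for k unfolding A_def by measurable
  have good: "(\<Sum>k<m. v \<bullet> (F (x k) *\<^sub>v v)) \<le> t * (vnorm v)\<^sup>2"
    if x: "x \<in> A k" and v: "v \<in> carrier_vec n" for x v k
  proof (cases "vnorm v = 0")
    case True
    then have "v = 0\<^sub>v n" using v vnorm_eq_0_iff by blast
    moreover have "0\<^sub>v n \<bullet> (F (x i) *\<^sub>v 0\<^sub>v n) = 0" if "i < m" for i
    proof -
      have "x i \<in> space D" using x that by (auto simp: A_def space_PiM)
      then show ?thesis using carrier[of "x i"] by (intro scalar_prod_left_zero) auto
    qed
    ultimately show ?thesis by simp
  next
    case False
    then have v0: "0 < vnorm v" using vnorm_nonneg[of v] by linarith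
    have xs: "x i \<in> space D" if "i < m" for i using x that by (auto simp: A_def space_PiM)
    define S where "S = partial_sum m x"
    have S: "S \<in> carrier_mat n n" "transpose_mat S = S" using partial_sum_bound[of m x] xs by (auto simp: S_def)
    define u where "u = (1 / vnorm v) \<cdot>\<^sub>v v"
    have u: "u \<in> carrier_vec n" "vnorm u = 1" using v v0 by (auto simp: u_def)
    have L: "lin_exp n (N k) S \<in> carrier_mat n n" "transpose_mat (lin_exp n (N k) S) = lin_exp n (N k) S"
      using S by (auto simp: lin_exp_symmetric)
    have q: "u \<bullet> (lin_exp n (N k) S *\<^sub>v u) = 1 + (u \<bullet> (S *\<^sub>v u)) / real (N k)"
      using u S vnorm_sq[of u] by (simp add: lin_exp_mult_vec scalar_prod_add_distrib[of _ n])
    have le: "(1 + (u \<bullet> (S *\<^sub>v u)) / real (N k)) ^ N k \<le> (1 + t / real (N k)) ^ N k"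
    proof -
      have "(u \<bullet> (lin_exp n (N k) S *\<^sub>v u)) ^ N k \<le> tr_exp n (N k) S"
        using tr_pow_ge_quad[OF L u, of k] by (simp add: tr_exp_def N_def)
      also have "\<dots> \<le> (1 + t / real (N k)) ^ N k" using x by (simp add: A_def S_def)
      finally show ?thesis unfolding q .
    qed
    have "u \<bullet> (S *\<^sub>v u) \<le> t"
    proof (rule ccontr)
      assume "\<not> u \<bullet> (S *\<^sub>v u) \<le> t"
      then have "1 + t / real (N k) < 1 + (u \<bullet> (S *\<^sub>v u)) / real (N k)"
        using N0[of k] by (simp add: divide_strict_right_mono)
      then have "(1 + t / real (N k)) ^ N k < (1 + (u \<bullet> (S *\<^sub>v u)) / real (N k)) ^ N k"
        using t N0[of k] by (intro power_strict_mono) auto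
      with le show False by simp
    qed
    moreover have "u \<bullet> (S *\<^sub>v u) = (v \<bullet> (S *\<^sub>v v)) / (vnorm v)\<^sup>2"
      unfolding u_def using v S by (simp add: mult_mat_vec[of _ n n] power2_eq_square)
    ultimately have "v \<bullet> (S *\<^sub>v v) \<le> t * (vnorm v)\<^sup>2" using v0 by (simp add: pos_divide_le_eq)
    then show ?thesis using partial_sum_quad[of m x v] xs v by (simp add: S_def)
  qed
  define g where "g k = (1 + \<rho>) ^ m * (real n + real m * (real n * (real m * exp (real m + 1)) / real (N k)))
    / (1 + t / real (N k)) ^ N k" for k
  \<comment> \<open>The union over \<open>k\<close> is at least as likely as each
    \<open>A k\<close>; only the failure bounds \<open>g k\<close> pass to the limit, not the
    events.\<close>
  have prob: "1 - g k \<le> P.prob (\<Union>k. A k)" for k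
  proof -
    define c where "c = (1 + t / real (N k)) ^ N k"
    have c: "0 < c" unfolding c_def using t by (intro zero_less_power add_pos_nonneg) auto
    have "emeasure ?P (space ?P - A k)
        \<le> emeasure ?P {x \<in> space ?P. 1 \<le> ennreal (1 / c) * ennreal (tr_exp n (N k) (partial_sum m x))}"
    proof (rule emeasure_mono)
      show "space ?P - A k \<subseteq> {x \<in> space ?P. 1 \<le> ennreal (1 / c) * ennreal (tr_exp n (N k) (partial_sum m x))}"
      proof
        fix x assume x: "x \<in> space ?P - A k"
        then have "c < tr_exp n (N k) (partial_sum m x)" by (auto simp: A_def c_def)
        then have "1 \<le> 1 / c * tr_exp n (N k) (partial_sum m x)" using c by simp
        then have "ennreal 1 \<le> ennreal (1 / c * tr_exp n (N k) (partial_sum m x))" by (rule ennreal_leI)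
        also have "\<dots> = ennreal (1 / c) * ennreal (tr_exp n (N k) (partial_sum m x))"
          using c by (intro ennreal_mult') auto
        finally show "x \<in> {x \<in> space ?P. 1 \<le> ennreal (1 / c) * ennreal (tr_exp n (N k) (partial_sum m x))}"
          using x by simp
      qed
    qed measurable
    also have "\<dots> \<le> ennreal (1 / c) * (\<integral>\<^sup>+x. ennreal (tr_exp n (N k) (partial_sum m x)) * indicator (space ?P) x \<partial>?P)"
      by (rule nn_integral_Markov_inequality) auto
    also have "(\<integral>\<^sup>+x. ennreal (tr_exp n (N k) (partial_sum m x)) * indicator (space ?P) x \<partial>?P)
        = (\<integral>\<^sup>+x. ennreal (tr_exp n (N k) (partial_sum m x)) \<partial>?P)"
      by (intro nn_integral_cong) simp
    also have "ennreal (1 / c) * \<dots> \<le> ennreal (1 / c) * ennreal ((1 + \<rho>) ^ m *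
        (real n + real m * (real n * (real m * exp (real m + 1)) / real (N k))))"
      by (intro mult_left_mono nn_integral_tr_exp[of _ k]) (auto simp: N_def)
    also have "\<dots> = ennreal (g k)"
      using c rho_nonneg by (simp add: ennreal_mult'[symmetric] g_def c_def)
    finally have "emeasure ?P (space ?P - A k) \<le> ennreal (g k)" .
    moreover have "0 \<le> g k" using c rho_nonneg by (simp add: g_def c_def[symmetric])
    ultimately have "P.prob (space ?P - A k) \<le> g k" by (simp add: P.emeasure_eq_measure)
    then have "1 - g k \<le> P.prob (A k)" using P.prob_compl[OF A[of k]] by simp
    also have "\<dots> \<le> P.prob (\<Union>k. A k)" using A by (intro P.finite_measure_mono) auto
    finally show ?thesis .
  qed
  have "g \<longlonglongrightarrow> (1 + \<rho>) ^ m * (real n + real m * 0) / exp t"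
    unfolding g_def
  proof (intro tendsto_intros)
    have sub: "filterlim N sequentially sequentially"
      by (rule filterlim_subseq) (auto simp: N_def strict_mono_def)
    then have r: "filterlim (\<lambda>k. real (N k)) at_top sequentially"
      by (rule filterlim_compose[OF filterlim_real_sequentially])
    show "(\<lambda>k. real n * (real m * exp (real m + 1)) / real (N k)) \<longlonglongrightarrow> 0"
      by (rule real_tendsto_divide_at_top[OF tendsto_const r])
    show "(\<lambda>k. (1 + t / real (N k)) ^ N k) \<longlonglongrightarrow> exp t"
      by (rule filterlim_compose[OF tendsto_exp_limit_sequentially sub])
  qed auto
  then have "(\<lambda>k. 1 - g k) \<longlonglongrightarrow> 1 - (1 + \<rho>) ^ m * real n / exp t"
    by (intro tendsto_intros) simp
  then have "1 - (1 + \<rho>) ^ m * real n / exp t \<le> P.prob (\<Union>k. A k)"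
    using prob by (intro LIMSEQ_le_const2) auto
  \<comment> \<open>Here 1 + \<rho> \<le> exp \<rho> cancels the part m \<rho> of \<open>t\<close>,
    and exp(-b) remains.\<close>
  moreover have "(1 + \<rho>) ^ m * real n / exp t \<le> real n * exp (- b)"
  proof -
    have "(1 + \<rho>) ^ m \<le> exp \<rho> ^ m" using rho_nonneg by (intro power_mono) auto
    also have "\<dots> = exp (real m * \<rho>)" by (simp flip: exp_of_nat_mult)
    finally have "(1 + \<rho>) ^ m * real n / exp t \<le> exp (real m * \<rho>) * real n / exp t"
      by (intro divide_right_mono mult_right_mono) auto
    also have "\<dots> = real n * exp (- b)" by (simp add: t_def exp_add exp_minus field_simps)
    finally show ?thesis .
  qed
  ultimately have "1 - real n * exp (- b) \<le> P.prob (\<Union>k. A k)" by linarith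
  moreover have "(\<Union>k. A k) \<in> sets ?P" using A by auto
  ultimately show ?thesis using good unfolding t_def by blast
qed

end

section \<open>Operator norm and quadratic forms\<close>

lemma mat_bound_frobenius:
  assumes A: "A \<in> carrier_mat n n"
  shows "mat_bound n A (sqrt (tr (transpose_mat A * A)))"
  unfolding mat_bound_def
proof (intro conjI ballI A)
  fix v :: "real vec" assume v: "v \<in> carrier_vec n"
  have "(vnorm (A *\<^sub>v v))\<^sup>2 \<le> (sqrt (tr (transpose_mat A * A)) * vnorm v)\<^sup>2"
    using vnorm_mult_mat_vec_sq_le[OF A v] tr_transpose_mult_self_nonneg[OF A]
    by (simp add: power_mult_distrib)
  then show "vnorm (A *\<^sub>v v) \<le> sqrt (tr (transpose_mat A * A)) * vnorm v"
    by (rule power2_le_imp_le) (use tr_transpose_mult_self_nonneg[OF A] in auto)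
qed

lemma op_norm_le:
  assumes "mat_bound n A c" "0 \<le> c"
  shows "op_norm A \<le> c"
  unfolding op_norm_def
proof (rule cSUP_least)
  have "0\<^sub>v (dim_col A) \<in> {v \<in> carrier_vec (dim_col A). vnorm v \<le> 1}" by simp
  then show "{v \<in> carrier_vec (dim_col A). vnorm v \<le> 1} \<noteq> {}" by blast
next
  fix v assume "v \<in> {v \<in> carrier_vec (dim_col A). vnorm v \<le> 1}"
  then have "v \<in> carrier_vec n" "vnorm v \<le> 1" using mat_boundD(1)[OF assms(1)] by auto
  then show "vnorm (A *\<^sub>v v) \<le> c"
    using mat_boundD(2)[OF assms(1), of v] mult_left_mono[of "vnorm v" 1 c] assms(2) by simp
qed

text \<open>The Frobenius norm shows that the set under the real supremum is bounded above, without
  which \<open>SUP\<close> would carry no information.\<close>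

lemma vnorm_mult_le_op_norm:
  assumes A: "A \<in> carrier_mat n n" and u: "u \<in> carrier_vec n" "vnorm u \<le> 1"
  shows "vnorm (A *\<^sub>v u) \<le> op_norm A"
  unfolding op_norm_def
proof (rule cSUP_upper)
  define c where "c = sqrt (tr (transpose_mat A * A))"
  have c: "mat_bound n A c" "0 \<le> c"
    using mat_bound_frobenius[OF A] tr_transpose_mult_self_nonneg[OF A] by (auto simp: c_def)
  show "bdd_above ((\<lambda>v. vnorm (A *\<^sub>v v)) ` {v \<in> carrier_vec (dim_col A). vnorm v \<le> 1})"
  proof (rule bdd_aboveI2)
    fix w assume "w \<in> {v \<in> carrier_vec (dim_col A). vnorm v \<le> 1}"
    then have "w \<in> carrier_vec n" "vnorm w \<le> 1" using A by auto
    then show "vnorm (A *\<^sub>v w) \<le> c"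
      using mat_boundD(2)[OF c(1), of w] mult_left_mono[of "vnorm w" 1 c] c(2) by simp
  qed
qed (use u A in auto)

lemma mat_bound_op_norm:
  assumes A: "A \<in> carrier_mat n n"
  shows "mat_bound n A (op_norm A)"
  unfolding mat_bound_def
proof (intro conjI ballI A)
  fix v :: "real vec" assume v: "v \<in> carrier_vec n"
  show "vnorm (A *\<^sub>v v) \<le> op_norm A * vnorm v"
  proof (cases "vnorm v = 0")
    case True
    then show ?thesis using mat_boundD(2)[OF mat_bound_frobenius[OF A] v] by simp
  next
    case False
    then have v0: "0 < vnorm v" using vnorm_nonneg[of v] by linarith
    have "vnorm (A *\<^sub>v ((1 / vnorm v) \<cdot>\<^sub>v v)) \<le> op_norm A"
      by (rule vnorm_mult_le_op_norm[OF A]) (use v v0 in auto)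
    moreover have "A *\<^sub>v ((1 / vnorm v) \<cdot>\<^sub>v v) = (1 / vnorm v) \<cdot>\<^sub>v (A *\<^sub>v v)"
      by (rule mult_mat_vec[OF A v])
    ultimately show ?thesis using v0 by (simp add: pos_divide_le_eq)
  qed
qed

lemma op_norm_nonneg:
  assumes A: "A \<in> carrier_mat n n"
  shows "0 \<le> op_norm A"
  by (rule order_trans[OF vnorm_nonneg vnorm_mult_le_op_norm[OF A, of "0\<^sub>v n"]]) simp_all

lemma abs_quad_le_op_norm:
  assumes A: "A \<in> carrier_mat n n" and v: "v \<in> carrier_vec n"
  shows "\<bar>v \<bullet> (A *\<^sub>v v)\<bar> \<le> op_norm A * (vnorm v)\<^sup>2"
proof -
  have "\<bar>v \<bullet> (A *\<^sub>v v)\<bar> \<le> vnorm v * vnorm (A *\<^sub>v v)"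
    by (rule abs_scalar_prod_le[of _ n]) (use A v in auto)
  also have "\<dots> \<le> vnorm v * (op_norm A * vnorm v)"
    using mat_boundD(2)[OF mat_bound_op_norm[OF A] v] by (intro mult_left_mono) auto
  finally show ?thesis by (simp add: power2_eq_square mult_ac)
qed

lemma vnorm_add_sq:
  assumes "v \<in> carrier_vec n" "w \<in> carrier_vec n"
  shows "(vnorm (v + w))\<^sup>2 = (vnorm v)\<^sup>2 + 2 * (v \<bullet> w) + (vnorm w)\<^sup>2"
  using assms comm_scalar_prod[OF assms]
  by (simp add: vnorm_sq scalar_prod_add_distrib[of _ n] add_scalar_prod_distrib[of _ n])

lemma vnorm_minus_sq:
  assumes "v \<in> carrier_vec n" "w \<in> carrier_vec n"
  shows "(vnorm (v - w))\<^sup>2 = (vnorm v)\<^sup>2 - 2 * (v \<bullet> w) + (vnorm w)\<^sup>2"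
  using assms comm_scalar_prod[OF assms]
  by (simp add: vnorm_sq scalar_prod_minus_distrib[of _ n] minus_scalar_prod_distrib[of _ n])

text \<open>Polarization: for a symmetric matrix the quadratic form controls the norm with the same
  constant. All later operator norm bounds reduce to this.\<close>

lemma mat_bound_quad:
  assumes A: "A \<in> carrier_mat n n" and sA: "transpose_mat A = A" and c: "0 \<le> c"
    and q: "\<And>v. v \<in> carrier_vec n \<Longrightarrow> \<bar>v \<bullet> (A *\<^sub>v v)\<bar> \<le> c * (vnorm v)\<^sup>2"
  shows "mat_bound n A c"
  unfolding mat_bound_def
proof (intro conjI ballI A)
  fix v :: "real vec" assume v: "v \<in> carrier_vec n"
  have Av: "A *\<^sub>v v \<in> carrier_vec n" using A v by simp
  show "vnorm (A *\<^sub>v v) \<le> c * vnorm v"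
  proof (cases "vnorm (A *\<^sub>v v) = 0 \<or> vnorm v = 0")
    case True
    then show ?thesis
    proof
      assume "vnorm v = 0"
      then show ?thesis using mat_boundD(2)[OF mat_bound_frobenius[OF A] v] by simp
    qed (use c in auto)
  next
    case False
    define a b where "a = vnorm (A *\<^sub>v v)" and "b = vnorm v"
    have ab: "0 < a" "0 < b" using False vnorm_nonneg[of v] vnorm_nonneg[of "A *\<^sub>v v"]
      unfolding a_def b_def by linarith+
    \<comment> \<open>The image \<open>A v\<close> rescaled to the length of \<open>v\<close>. Then
      |u + v|^2 + |u - v|^2 = 4 |v|^2, so polarization costs no factor.\<close>
    define u where "u = (b / a) \<cdot>\<^sub>v (A *\<^sub>v v)"
    have u: "u \<in> carrier_vec n" and nu: "vnorm u = b" using Av ab by (auto simp: u_def a_def)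
    have Au: "A *\<^sub>v u \<in> carrier_vec n" using A u by simp
    have sym: "v \<bullet> (A *\<^sub>v u) = u \<bullet> (A *\<^sub>v v)"
      using transpose_vec_mult_scalar[OF A u v] comm_scalar_prod[OF u Av] sA by simp
    have "4 * (u \<bullet> (A *\<^sub>v v)) = (u + v) \<bullet> (A *\<^sub>v (u + v)) - (u - v) \<bullet> (A *\<^sub>v (u - v))"
      using u v Av Au sym A
      by (simp add: mult_add_distrib_mat_vec[of _ n n] mult_minus_distrib_mat_vec[of _ n n]
          scalar_prod_add_distrib[of _ n] add_scalar_prod_distrib[of _ n]
          scalar_prod_minus_distrib[of _ n] minus_scalar_prod_distrib[of _ n])
    also have "\<dots> \<le> c * (vnorm (u + v))\<^sup>2 + c * (vnorm (u - v))\<^sup>2"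
      using q[of "u + v"] q[of "u - v"] u v by (simp add: abs_le_iff)
    also have "\<dots> = 4 * (c * b\<^sup>2)"
      using u v by (simp add: vnorm_add_sq[of _ n] vnorm_minus_sq[of _ n] nu b_def algebra_simps)
    finally have "u \<bullet> (A *\<^sub>v v) \<le> c * b\<^sup>2" by simp
    moreover have "u \<bullet> (A *\<^sub>v v) = b * a"
    proof -
      have "u \<bullet> (A *\<^sub>v v) = (b / a) * a\<^sup>2" unfolding u_def using Av by (simp add: vnorm_sq a_def)
      then show ?thesis using ab by (simp add: power2_eq_square)
    qed
    ultimately have "b * a \<le> b * (c * b)" by (simp add: power2_eq_square mult_ac)
    then show ?thesis using ab by (simp add: a_def b_def)
  qed
qed

lemma op_norm_le_quad:
  assumes "A \<in> carrier_mat n n" "transpose_mat A = A" "0 \<le> c"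
    and "\<And>v. v \<in> carrier_vec n \<Longrightarrow> \<bar>v \<bullet> (A *\<^sub>v v)\<bar> \<le> c * (vnorm v)\<^sup>2"
  shows "op_norm A \<le> c"
  by (rule op_norm_le[OF mat_bound_quad]) (use assms in auto)

lemma quad_bounds_mat_bound:
  assumes "A \<in> carrier_mat n n" "transpose_mat A = A"
    and "\<And>v. v \<in> carrier_vec n \<Longrightarrow> - (c * (vnorm v)\<^sup>2) \<le> v \<bullet> (A *\<^sub>v v) \<and> v \<bullet> (A *\<^sub>v v) \<le> c * (vnorm v)\<^sup>2" "0 \<le> c"
  shows "mat_bound n A c"
  using assms by (intro mat_bound_quad) (auto simp: abs_le_iff minus_le_iff)

lemma abs_index_le_vnorm: "v \<in> carrier_vec n \<Longrightarrow> i < n \<Longrightarrow> \<bar>v $ i\<bar> \<le> vnorm v"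
  using member_le_L2_set[of "{0..<n}" i "\<lambda>i. \<bar>v $ i\<bar>"]
  by (simp add: vnorm_eq_L2_set L2_set_def)

lemma abs_entry_le:
  assumes "mat_bound n A c" "i < n" "j < n"
  shows "\<bar>A $$ (i, j)\<bar> \<le> c"
proof -
  have A: "A \<in> carrier_mat n n" using assms mat_boundD by blast
  have "A $$ (i, j) = (A *\<^sub>v unit_vec n j) $ i" using A assms by simp
  also have "\<bar>\<dots>\<bar> \<le> vnorm (A *\<^sub>v unit_vec n j)" using A assms by (intro abs_index_le_vnorm[of _ n]) auto
  also have "\<dots> \<le> c" using mat_boundD(2)[OF assms(1), of "unit_vec n j"] assms by (simp add: vnorm_def)
  finally show ?thesis .
qed

lemma symmetric_entry:
  assumes "A \<in> carrier_mat n n" "transpose_mat A = A" "i < n" "j < n"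
  shows "A $$ (j, i) = A $$ (i, j)"
proof -
  have "transpose_mat A $$ (i, j) = A $$ (j, i)" using assms(1,3,4) by simp
  then show ?thesis using assms(2) by simp
qed

lemma outer_carrier [simp]: "z \<in> carrier_vec d \<Longrightarrow> outer z \<in> carrier_mat d d"
  by (simp add: outer_def)

lemma outer_index [simp]:
  "z \<in> carrier_vec d \<Longrightarrow> i < d \<Longrightarrow> j < d \<Longrightarrow> outer z $$ (i, j) = z $ i * z $ j"
  by (simp add: outer_def)

section \<open>Truncation of vectors\<close>

text \<open>Projection onto the ball of radius \<open>1 / sqrt \<theta>\<close>: the truncated outer product
  \<open>psi (\<theta> z z\<^sup>T) / \<theta>\<close> is the outer product of the projected vector.\<close>

definition clip :: "real \<Rightarrow> real vec \<Rightarrow> real vec" where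
  "clip \<theta> z = (if \<theta> * (vnorm z)\<^sup>2 \<le> 1 then z else (1 / (sqrt \<theta> * vnorm z)) \<cdot>\<^sub>v z)"

lemma clip_carrier [simp]: "z \<in> carrier_vec d \<Longrightarrow> clip \<theta> z \<in> carrier_vec d"
  by (simp add: clip_def)

text \<open>Covers both branches of \<open>clip\<close> by one contraction factor; strict
  contraction occurs only if the image lies on the boundary sphere.\<close>

lemma clip_scale:
  assumes "0 < \<theta>"
  obtains s where "0 \<le> s" "s \<le> 1" "clip \<theta> z = s \<cdot>\<^sub>v z" "\<theta> * (s * vnorm z)\<^sup>2 \<le> 1"
    "s < 1 \<Longrightarrow> s * vnorm z = 1 / sqrt \<theta>"
proof (cases "\<theta> * (vnorm z)\<^sup>2 \<le> 1")
  case True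
  then show ?thesis by (intro that[of 1]) (auto simp: clip_def)
next
  case False
  then have "vnorm z \<noteq> 0" by auto
  then have z: "0 < vnorm z" using vnorm_nonneg[of z] by linarith
  have 1: "1 < sqrt \<theta> * vnorm z"
  proof -
    have "1\<^sup>2 < (sqrt \<theta> * vnorm z)\<^sup>2" using False assms by (simp add: power_mult_distrib)
    then show ?thesis by (rule power2_less_imp_less) (use z assms in auto)
  qed
  show ?thesis
  proof (rule that[of "1 / (sqrt \<theta> * vnorm z)"])
    show "\<theta> * (1 / (sqrt \<theta> * vnorm z) * vnorm z)\<^sup>2 \<le> 1"
      using z assms by (simp add: power_mult_distrib power_divide)
  qed (use False 1 z assms in \<open>auto simp: clip_def\<close>)
qed

lemma vnorm_clip_le:
  assumes "0 < \<theta>"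
  shows "\<theta> * (vnorm (clip \<theta> z))\<^sup>2 \<le> 1" "vnorm (clip \<theta> z) \<le> vnorm z"
proof -
  obtain s where s: "0 \<le> s" "s \<le> 1" "clip \<theta> z = s \<cdot>\<^sub>v z" "\<theta> * (s * vnorm z)\<^sup>2 \<le> 1"
    using clip_scale[OF assms] by metis
  show "\<theta> * (vnorm (clip \<theta> z))\<^sup>2 \<le> 1" using s by simp
  show "vnorm (clip \<theta> z) \<le> vnorm z" using s mult_right_mono[of s 1 "vnorm z"] by simp
qed

lemma clip_scalar_prod_sq_le:
  assumes "0 < \<theta>" "z \<in> carrier_vec d" "v \<in> carrier_vec d"
  shows "(clip \<theta> z \<bullet> v)\<^sup>2 \<le> (z \<bullet> v)\<^sup>2"
proof -
  obtain s where s: "0 \<le> s" "s \<le> 1" "clip \<theta> z = s \<cdot>\<^sub>v z"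
    using clip_scale[OF assms(1)] by metis
  have "clip \<theta> z \<bullet> v = s * (z \<bullet> v)" unfolding s(3) using assms by simp
  then show ?thesis
    using s mult_right_mono[of "s\<^sup>2" 1 "(z \<bullet> v)\<^sup>2"] by (simp add: power_mult_distrib power_le_one)
qed

text \<open>The variational inequality of the nearest-point projection onto a ball. If
  \<open>z\<close> is truly truncated, its image has the maximal length, so by Cauchy-Schwarz no
  \<open>y\<close> in the ball reaches further in the direction of \<open>z\<close>.\<close>

lemma clip_projection:
  assumes "0 < \<theta>" "z \<in> carrier_vec d" "y \<in> carrier_vec d" "\<theta> * (vnorm y)\<^sup>2 \<le> 1"
  shows "(z - clip \<theta> z) \<bullet> (y - clip \<theta> z) \<le> 0"
proof -
  obtain s where s: "0 \<le> s" "s \<le> 1" "clip \<theta> z = s \<cdot>\<^sub>v z"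
    "s < 1 \<Longrightarrow> s * vnorm z = 1 / sqrt \<theta>"
    using clip_scale[OF assms(1)] by metis
  have e: "(z - clip \<theta> z) \<bullet> (y - clip \<theta> z) = (1 - s) * (z \<bullet> y - s * (vnorm z)\<^sup>2)"
    unfolding s(3) using assms comm_scalar_prod[OF assms(2,3)]
    by (simp add: vnorm_sq scalar_prod_minus_distrib[of _ d] minus_scalar_prod_distrib[of _ d] algebra_simps)
  show ?thesis
  proof (cases "s < 1")
    case True
    have "(sqrt \<theta> * vnorm y)\<^sup>2 \<le> 1\<^sup>2" using assms by (simp add: power_mult_distrib)
    then have "sqrt \<theta> * vnorm y \<le> 1" by (rule power2_le_imp_le) simp
    then have y: "vnorm y \<le> 1 / sqrt \<theta>" using assms by (simp add: pos_le_divide_eq mult.commute)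
    have "z \<bullet> y \<le> vnorm z * vnorm y" using abs_scalar_prod_le[OF assms(2,3)] by simp
    also have "\<dots> \<le> vnorm z * (s * vnorm z)" using mult_left_mono[OF y, of "vnorm z"] s(4)[OF True] by simp
    finally have "z \<bullet> y - s * (vnorm z)\<^sup>2 \<le> 0" by (simp add: power2_eq_square mult_ac)
    then show ?thesis unfolding e using True by (simp add: mult_nonneg_nonpos)
  qed (use s e in simp)
qed

text \<open>Adding the variational inequalities of the two projections gives nonexpansiveness.
  Consequently an error in the mean moves each truncated point by no more than that error.\<close>

lemma clip_lipschitz:
  assumes \<theta>: "0 < \<theta>" and z: "z \<in> carrier_vec d" and w: "w \<in> carrier_vec d"
  shows "vnorm (clip \<theta> z - clip \<theta> w) \<le> vnorm (z - w)"
proof -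
  define p q where "p = clip \<theta> z" and "q = clip \<theta> w"
  have p: "p \<in> carrier_vec d" and q: "q \<in> carrier_vec d" using z w by (auto simp: p_def q_def)
  have 1: "(z - p) \<bullet> (q - p) \<le> 0"
    unfolding p_def by (rule clip_projection) (use assms q vnorm_clip_le in \<open>auto simp: q_def\<close>)
  have 2: "(w - q) \<bullet> (p - q) \<le> 0"
    unfolding q_def by (rule clip_projection) (use assms p vnorm_clip_le in \<open>auto simp: p_def\<close>)
  have "(vnorm (p - q))\<^sup>2 - (z - w) \<bullet> (p - q) = (z - p) \<bullet> (q - p) + (w - q) \<bullet> (p - q)"
    using z w p q comm_scalar_prod[OF p q]
    by (simp add: vnorm_sq scalar_prod_minus_distrib[of _ d] minus_scalar_prod_distrib[of _ d])
  then have "(vnorm (p - q))\<^sup>2 \<le> (z - w) \<bullet> (p - q)" using 1 2 by linarith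
  also have "\<dots> \<le> vnorm (z - w) * vnorm (p - q)"
    using abs_scalar_prod_le[of "z - w" d "p - q"] z w p q by simp
  finally have "vnorm (p - q) * vnorm (p - q) \<le> vnorm (z - w) * vnorm (p - q)"
    by (simp add: power2_eq_square)
  moreover have "vnorm (p - q) = 0 \<or> 0 < vnorm (p - q)" using vnorm_nonneg[of "p - q"] by linarith
  ultimately show ?thesis unfolding p_def q_def using vnorm_nonneg[of "z - w"] by auto
qed

text \<open>Both \<open>z\<close> and \<open>\<delta>\<close> have at most half the truncation
  radius, so their difference stays inside the ball. This is the origin of the factor 4 in
  \<open>far\<close>.\<close>

lemma clip_shift:
  assumes \<theta>: "0 < \<theta>" and z: "z \<in> carrier_vec d" and \<delta>: "\<delta> \<in> carrier_vec d" and s: "4 * \<theta> * (vnorm \<delta>)\<^sup>2 \<le> 1"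
    and near: "4 * \<theta> * (vnorm z)\<^sup>2 < 1"
  shows "clip \<theta> z = z" "clip \<theta> (z - \<delta>) = z - \<delta>"
proof -
  have r: "sqrt \<theta> * vnorm w \<le> 1 / 2" if "4 * \<theta> * (vnorm w)\<^sup>2 \<le> 1" for w
  proof (rule power2_le_imp_le)
    show "(sqrt \<theta> * vnorm w)\<^sup>2 \<le> (1 / 2)\<^sup>2" using that \<theta> by (simp add: power_mult_distrib power_divide)
  qed simp
  have "\<theta> * (vnorm z)\<^sup>2 \<le> 1" using near \<theta> zero_le_power2[of "vnorm z"] by (simp add: mult.assoc)
  then show "clip \<theta> z = z" by (simp add: clip_def)
  have "sqrt \<theta> * vnorm (z - \<delta>) \<le> sqrt \<theta> * (vnorm z + vnorm \<delta>)"
    using vnorm_minus_le[OF z \<delta>] \<theta> by (intro mult_left_mono) auto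
  also have "\<dots> \<le> 1" using r[of z] r[of \<delta>] s near by (simp add: distrib_left)
  finally have "(sqrt \<theta> * vnorm (z - \<delta>))\<^sup>2 \<le> 1" using \<theta> by (intro power_le_one) auto
  then have "\<theta> * (vnorm (z - \<delta>))\<^sup>2 \<le> 1" using \<theta> by (simp add: power_mult_distrib)
  then show "clip \<theta> (z - \<delta>) = z - \<delta>" by (simp add: clip_def)
qed

text \<open>The witness is a Householder reflection.\<close>

lemma exists_orthogonal_first_column:
  assumes u: "u \<in> carrier_vec d" "vnorm u = 1" and d: "0 < d"
  shows "\<exists>U\<in>carrier_mat d d. transpose_mat U * U = 1\<^sub>m d \<and> (\<forall>i<d. U $$ (i, 0) = u $ i)"
proof -
  define w where "w i = u $ i - (if i = 0 then 1 else 0)" for i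
  define q where "q = (\<Sum>i<d. (w i)\<^sup>2)"
  \<comment> \<open>If \<open>u\<close> is already the first unit vector, then \<open>q = 0\<close>
    and division by zero gives \<open>c = 0\<close>; the reflection degenerates to the identity, as
    wanted.\<close>
  define c where "c = 2 / q"
  define U where "U = Matrix.mat d d (\<lambda>(i, j). (if i = j then 1 else 0) - c * w i * w j)"
  have uu: "(\<Sum>i<d. (u $ i)\<^sup>2) = 1" using vnorm_sq_sum[OF u(1)] u(2) by simp
  \<comment> \<open>As \<open>u\<close> has length 1, subtracting the first unit vector gives
    squared length 2 - 2 u_0. This identity makes the first column come out as
    \<open>u\<close>.\<close>
  have q: "q = - 2 * w 0"
  proof -
    have "(w i)\<^sup>2 = (u $ i)\<^sup>2 + (if i = 0 then 1 - 2 * u $ 0 else 0)" for i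
      by (simp add: w_def power2_eq_square algebra_simps)
    then have "q = 1 + (1 - 2 * u $ 0)" using uu d by (simp add: q_def sum.distrib)
    then show ?thesis by (simp add: w_def)
  qed
  have U: "U \<in> carrier_mat d d" by (simp add: U_def)
  have "transpose_mat U * U = 1\<^sub>m d"
  proof (rule eq_matI)
    fix i j assume "i < dim_row (1\<^sub>m d)" "j < dim_col (1\<^sub>m d)"
    then have ij: "i < d" "j < d" by auto
    have cq: "c * (c * q) = 2 * c" by (cases "q = 0") (auto simp: c_def)
    have "(transpose_mat U * U) $$ (i, j) = (\<Sum>k<d. ((if k = i then 1 else 0) - c * w k * w i) * ((if k = j then 1 else 0) - c * w k * w j))"
      using ij U by (subst index_mult_mat_sum[of _ d d _ d]) (auto simp: U_def)
    also have "\<dots> = (\<Sum>k<d. (if k = i then (if k = j then 1 else 0) - c * w k * w j else 0)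
        - (if k = j then c * w k * w i else 0) + c * (c * (w k)\<^sup>2) * w i * w j)"
      by (intro sum.cong) (auto simp: power2_eq_square algebra_simps)
    also have "\<dots> = ((if i = j then 1 else 0) - c * w i * w j) - c * w j * w i + c * (c * q) * w i * w j"
      using ij by (simp add: sum.distrib sum_subtractf q_def sum_distrib_left sum_distrib_right mult.assoc)
    also have "\<dots> = 1\<^sub>m d $$ (i, j)" unfolding cq using ij by (simp add: algebra_simps)
    finally show "(transpose_mat U * U) $$ (i, j) = 1\<^sub>m d $$ (i, j)" .
  qed (use U in auto)
  moreover have "U $$ (i, 0) = u $ i" if i: "i < d" for i
  proof (cases "q = 0")
    case True
    then have "w i = 0" using i by (simp add: q_def sum_nonneg_eq_0_iff)
    then show ?thesis using i d by (simp add: U_def w_def split: if_splits)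
  next
    case False
    then have "c * w 0 = - 1" unfolding c_def q by auto
    moreover have "c * w i * w 0 = (c * w 0) * w i" by simp
    ultimately have "c * w i * w 0 = - w i" by simp
    then show ?thesis using i d by (simp add: U_def w_def)
  qed
  ultimately show ?thesis using U by blast
qed

lemma spectral_decomp_rank_one:
  assumes u: "u \<in> carrier_vec d" "vnorm u = 1"
    and U: "U \<in> carrier_mat d d" "\<And>i. i < d \<Longrightarrow> U $$ (i, 0) = u $ i" and d: "0 < d"
  shows "U * mat_diag d (\<lambda>i. if i = 0 then k else 0) * transpose_mat U = k \<cdot>\<^sub>m outer u"
proof (rule eq_matI)
  fix i j assume "i < dim_row (k \<cdot>\<^sub>m outer u)" "j < dim_col (k \<cdot>\<^sub>m outer u)"
  then have ij: "i < d" "j < d" using u by (auto simp: outer_def)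
  have "(U * mat_diag d (\<lambda>i. if i = 0 then k else 0) * transpose_mat U) $$ (i, j)
      = (\<Sum>l<d. U $$ (i, l) * (if l = 0 then k else 0) * U $$ (j, l))"
    unfolding mat_diag_mult_right[OF U(1)]
    using ij U by (subst index_mult_mat_sum[of _ d d _ d]) auto
  also have "\<dots> = (\<Sum>l<d. if l = 0 then U $$ (i, l) * k * U $$ (j, l) else 0)"
    by (intro sum.cong) auto
  also have "\<dots> = U $$ (i, 0) * k * U $$ (j, 0)" using d by simp
  also have "\<dots> = (k \<cdot>\<^sub>m outer u) $$ (i, j)" using ij u U(2) by (simp add: outer_def)
  finally show "(U * mat_diag d (\<lambda>i. if i = 0 then k else 0) * transpose_mat U) $$ (i, j) = (k \<cdot>\<^sub>m outer u) $$ (i, j)" .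
qed (use u U in \<open>auto simp: outer_def\<close>)

text \<open>An orthogonal matrix whose first column is z / |z| diagonalizes the rank-one matrix. All
  remaining eigenvalues are 0, so \<open>f 0 = 0\<close> keeps the result of rank at most one. The
  zero vector has no direction and is treated apart.\<close>

lemma mat_fun_outer:
  assumes z: "z \<in> carrier_vec d" and f: "f 0 = 0"
  shows "mat_fun f (\<theta> \<cdot>\<^sub>m outer z)
    = (if vnorm z = 0 then 0\<^sub>m d d else (f (\<theta> * (vnorm z)\<^sup>2) / (vnorm z)\<^sup>2) \<cdot>\<^sub>m outer z)"
proof (cases "vnorm z = 0")
  case True
  then have z0: "z = 0\<^sub>v d" using vnorm_eq_0_iff[OF z] by simp
  have dd: "dim_row (\<theta> \<cdot>\<^sub>m outer z) = d" using z by (simp add: outer_def)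
  have zero: "1\<^sub>m d * mat_diag d (\<lambda>_. 0) * transpose_mat (1\<^sub>m d) = (0\<^sub>m d d :: real mat)"
    by (intro eq_matI) (auto simp: mat_diag_def scalar_prod_def)
  have "spectral_decomp (\<theta> \<cdot>\<^sub>m outer z) (1\<^sub>m d) (\<lambda>_. 0)"
    unfolding spectral_decomp_def dd zero using z0 by (auto simp: outer_def)
  then have "mat_fun f (\<theta> \<cdot>\<^sub>m outer z) = 1\<^sub>m d * mat_diag d (\<lambda>_. f 0) * transpose_mat (1\<^sub>m d)"
    using mat_fun_eq dd by simp
  then show ?thesis using True zero f by simp
next
  case False
  then have n0: "0 < vnorm z" using vnorm_nonneg[of z] by linarith
  have d: "0 < d"
  proof (rule ccontr)
    assume "\<not> 0 < d"
    then have "z = 0\<^sub>v d" using z by auto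
    then show False using False by simp
  qed
  define u where "u = (1 / vnorm z) \<cdot>\<^sub>v z"
  have u: "u \<in> carrier_vec d" "vnorm u = 1" using z n0 by (auto simp: u_def)
  have sc: "k \<cdot>\<^sub>m outer u = (k / (vnorm z)\<^sup>2) \<cdot>\<^sub>m outer z" for k
    using z by (intro eq_matI) (auto simp: outer_def u_def power2_eq_square)
  obtain U where U: "U \<in> carrier_mat d d" "transpose_mat U * U = 1\<^sub>m d" "\<And>i. i < d \<Longrightarrow> U $$ (i, 0) = u $ i"
    using exists_orthogonal_first_column[OF u d] by auto
  have dd: "dim_row (\<theta> \<cdot>\<^sub>m outer z) = d" using z by (simp add: outer_def)
  let ?l = "\<lambda>i::nat. if i = 0 then \<theta> * (vnorm z)\<^sup>2 else 0"
  have "U * mat_diag d ?l * transpose_mat U = \<theta> \<cdot>\<^sub>m outer z"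
    using spectral_decomp_rank_one[OF u U(1,3) d, of "\<theta> * (vnorm z)\<^sup>2"] sc n0 by simp
  then have "spectral_decomp (\<theta> \<cdot>\<^sub>m outer z) U ?l"
    unfolding spectral_decomp_def dd using U by metis
  then have "mat_fun f (\<theta> \<cdot>\<^sub>m outer z) = U * mat_diag d (\<lambda>i. f (?l i)) * transpose_mat U"
    using mat_fun_eq dd by simp
  also have "(\<lambda>i. f (?l i)) = (\<lambda>i. if i = 0 then f (\<theta> * (vnorm z)\<^sup>2) else 0)" using f by auto
  finally show ?thesis using False by (simp add: spectral_decomp_rank_one[OF u U(1,3) d] sc)
qed

text \<open>On nonnegative arguments \<open>psi\<close> is the minimum with 1, and
  \<open>min (\<theta> * (vnorm z)\<^sup>2) 1 / (vnorm z)\<^sup>2\<close> is \<theta> times the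
  square of the clipping factor.\<close>

lemma mat_fun_psi_outer:
  assumes z: "z \<in> carrier_vec d" and \<theta>: "0 < \<theta>"
  shows "mat_fun psi (\<theta> \<cdot>\<^sub>m outer z) = \<theta> \<cdot>\<^sub>m outer (clip \<theta> z)"
proof (cases "vnorm z = 0")
  case True
  then have "z = 0\<^sub>v d" using vnorm_eq_0_iff[OF z] by simp
  then show ?thesis
    using z by (subst mat_fun_outer[OF z]) (auto simp: psi_def clip_def outer_def)
next
  case False
  then have n0: "0 < vnorm z" using vnorm_nonneg[of z] by linarith
  have "psi (\<theta> * (vnorm z)\<^sup>2) = min (\<theta> * (vnorm z)\<^sup>2) 1" using n0 \<theta> by (simp add: psi_def)
  then have "mat_fun psi (\<theta> \<cdot>\<^sub>m outer z) = (min (\<theta> * (vnorm z)\<^sup>2) 1 / (vnorm z)\<^sup>2) \<cdot>\<^sub>m outer z"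
    using False by (subst mat_fun_outer[OF z]) (auto simp: psi_def)
  also have "\<dots> = \<theta> \<cdot>\<^sub>m outer (clip \<theta> z)"
  proof -
    have sq: "sqrt \<theta> * vnorm z * (sqrt \<theta> * vnorm z) = \<theta> * (vnorm z * vnorm z)"
      using \<theta> by (simp add: mult.assoc mult.left_commute)
    show ?thesis
      using z n0 \<theta> by (intro eq_matI) (auto simp: outer_def clip_def power2_eq_square sq)
  qed
  finally show ?thesis .
qed

section \<open>The truncated estimator as a sum of squares of clipped vectors\<close>

lemma outer_quad:
  assumes "z \<in> carrier_vec d" "v \<in> carrier_vec d"
  shows "v \<bullet> (outer z *\<^sub>v v) = (z \<bullet> v)\<^sup>2"
proof -
  have "outer z *\<^sub>v v = (z \<bullet> v) \<cdot>\<^sub>v z"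
    using assms by (intro eq_vecI) (auto simp: outer_def scalar_prod_def sum_distrib_left sum_distrib_right mult_ac)
  then show ?thesis using assms comm_scalar_prod[OF assms] by (simp add: power2_eq_square)
qed

text \<open>The factor \<theta> of the truncated outer product cancels the one in the normalization.
  From here on the functional calculus does not appear; only sums of squares remain.\<close>

lemma trunc_cov_quad:
  assumes \<theta>: "0 < \<theta>" and z: "\<And>i. i < m \<Longrightarrow> x i - mu \<in> carrier_vec d" and v: "v \<in> carrier_vec d"
  shows "v \<bullet> (trunc_cov d m \<theta> mu x *\<^sub>v v) = (\<Sum>i<m. (clip \<theta> (x i - mu) \<bullet> v)\<^sup>2) / real m"
proof -
  have e: "trunc_cov d m \<theta> mu x $$ (a, b) = (\<Sum>i<m. outer (clip \<theta> (x i - mu)) $$ (a, b)) / real m"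
    if "a < d" "b < d" for a b
  proof -
    have "(\<Sum>i<m. mat_fun psi (\<theta> \<cdot>\<^sub>m outer (x i - mu)) $$ (a, b))
        = (\<Sum>i<m. \<theta> * outer (clip \<theta> (x i - mu)) $$ (a, b))"
    proof (rule sum.cong)
      fix i assume "i \<in> {..<m}"
      then have "x i - mu \<in> carrier_vec d" using z by auto
      then show "mat_fun psi (\<theta> \<cdot>\<^sub>m outer (x i - mu)) $$ (a, b) = \<theta> * outer (clip \<theta> (x i - mu)) $$ (a, b)"
        using that \<theta> carrier_matD[OF outer_carrier[OF clip_carrier[of "x i - mu" d \<theta>]]]
        by (simp add: mat_fun_psi_outer del: outer_index)
    qed simp
    then show ?thesis using that \<theta>
      by (simp add: trunc_cov_def sum_distrib_left[symmetric])
  qed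
  have "trunc_cov d m \<theta> mu x \<in> carrier_mat d d" by (simp add: trunc_cov_def)
  then have "v \<bullet> (trunc_cov d m \<theta> mu x *\<^sub>v v)
      = (\<Sum>a<d. \<Sum>b<d. v $ a * ((\<Sum>i<m. outer (clip \<theta> (x i - mu)) $$ (a, b)) / real m * v $ b))"
    using quad_form_sum[OF _ v v] e by simp
  also have "\<dots> = (\<Sum>i<m. \<Sum>a<d. \<Sum>b<d. v $ a * (outer (clip \<theta> (x i - mu)) $$ (a, b) * v $ b)) / real m"
  proof -
    have "(\<Sum>i<m. \<Sum>a<d. \<Sum>b<d. v $ a * (outer (clip \<theta> (x i - mu)) $$ (a, b) * v $ b))
        = (\<Sum>a<d. \<Sum>b<d. \<Sum>i<m. v $ a * (outer (clip \<theta> (x i - mu)) $$ (a, b) * v $ b))"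
      by (simp only: sum.swap[where A = "{..<m}" and B = "{..<d}"])
    then show ?thesis
      by (simp add: sum_distrib_left sum_distrib_right sum_divide_distrib)
  qed
  also have "(\<Sum>i<m. \<Sum>a<d. \<Sum>b<d. v $ a * (outer (clip \<theta> (x i - mu)) $$ (a, b) * v $ b))
      = (\<Sum>i<m. (clip \<theta> (x i - mu) \<bullet> v)\<^sup>2)"
    using z v by (intro sum.cong refl) (simp add: quad_form_sum[symmetric] outer_quad[of _ d])
  finally show ?thesis .
qed

lemma trunc_cov_symmetric:
  assumes \<theta>: "0 < \<theta>" and z: "\<And>i. i < m \<Longrightarrow> x i - mu \<in> carrier_vec d"
  shows "transpose_mat (trunc_cov d m \<theta> mu x) = trunc_cov d m \<theta> mu x"
proof (rule eq_matI)
  fix a b assume "a < dim_row (trunc_cov d m \<theta> mu x)" "b < dim_col (trunc_cov d m \<theta> mu x)"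
  then have ab: "a < d" "b < d" by (auto simp: trunc_cov_def)
  have "mat_fun psi (\<theta> \<cdot>\<^sub>m outer (x i - mu)) $$ (b, a) = mat_fun psi (\<theta> \<cdot>\<^sub>m outer (x i - mu)) $$ (a, b)"
    if "i < m" for i
    unfolding mat_fun_psi_outer[OF z[OF that] \<theta>]
    using ab carrier_matD[OF outer_carrier[OF clip_carrier[OF z[OF that], of \<theta>]]] clip_carrier[OF z[OF that], of \<theta>]
    by simp
  then show "transpose_mat (trunc_cov d m \<theta> mu x) $$ (a, b) = trunc_cov d m \<theta> mu x $$ (a, b)"
    using ab by (simp add: trunc_cov_def)
qed (auto simp: trunc_cov_def)

lemma trunc_cov_carrier [simp]: "trunc_cov d m \<theta> mu x \<in> carrier_mat d d"
  by (simp add: trunc_cov_def)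

section \<open>Moments of the law\<close>

locale moment_law =
  fixes d :: nat and D :: "real vec measure"
  assumes law: "vec_law d D"
    and int1: "\<And>i. i < d \<Longrightarrow> integrable D (\<lambda>x. x $ i)"
    and int4: "integrable D (\<lambda>x. vnorm (x - mean_vec d D) ^ 4)"

sublocale moment_law \<subseteq> prob_space D
  using law by (simp add: vec_law_def)

context moment_law
begin

definition Z :: "real vec \<Rightarrow> real vec" where
  "Z x = x - mean_vec d D"

lemma space_D: "space D = carrier_vec d"
proof -
  have "space D = space (borel_vec d)" using law sets_eq_imp_space_eq by (auto simp: vec_law_def)
  then show ?thesis by (simp add: borel_vec_def)
qed

lemma mean_carrier [simp]: "mean_vec d D \<in> carrier_vec d"
  by (simp add: mean_vec_def)

lemma dim_mean [simp]: "dim_vec (mean_vec d D) = d"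
  by (simp add: mean_vec_def)

lemma dim_Z [simp]: "dim_vec (Z x) = d"
  by (simp add: Z_def)

lemma Z_carrier [simp]: "x \<in> carrier_vec d \<Longrightarrow> Z x \<in> carrier_vec d"
  by (simp add: Z_def)

lemma Z_index: "i < d \<Longrightarrow> Z x $ i = x $ i - (\<integral>x. x $ i \<partial>D)"
  by (simp add: Z_def mean_vec_def)

lemma measurable_index [measurable]:
  assumes "i < d"
  shows "(\<lambda>x. x $ i) \<in> borel_measurable D"
proof -
  have s: "sets D = sets (borel_vec d)" using law by (simp add: vec_law_def)
  have "(\<lambda>v. \<lambda>i\<in>{..<d}. v $ i :: real) \<in> borel_vec d \<rightarrow>\<^sub>M (\<Pi>\<^sub>M i\<in>{..<d}. borel)"
    unfolding borel_vec_def by (rule measurable_vimage_algebra1) (auto simp: space_PiM)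
  from measurable_compose[OF this measurable_component_singleton[of i]] assms
  have "(\<lambda>v. (\<lambda>i\<in>{..<d}. v $ i) i) \<in> borel_measurable (borel_vec d)" by simp
  then show ?thesis using assms by (simp add: measurable_cong_sets[OF s refl])
qed

lemma measurable_Z_index [measurable]: "i < d \<Longrightarrow> (\<lambda>x. Z x $ i) \<in> borel_measurable D"
  by (simp add: Z_index)

lemma measurable_scalar_prod:
  fixes v :: "real vec"
  assumes "\<And>i. i < d \<Longrightarrow> (\<lambda>x. f x $ i) \<in> borel_measurable M" "v \<in> carrier_vec d"
  shows "(\<lambda>x. f x \<bullet> v) \<in> borel_measurable M"
  unfolding scalar_prod_def
  by (intro borel_measurable_sum borel_measurable_times borel_measurable_const) (use assms in auto)

lemma measurable_vnorm:
  assumes "\<And>i. i < d \<Longrightarrow> (\<lambda>x. f x $ i) \<in> borel_measurable M"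
    "\<And>x. x \<in> space M \<Longrightarrow> f x \<in> carrier_vec d"
  shows "(\<lambda>x. vnorm (f x)) \<in> borel_measurable M"
proof -
  have "(\<lambda>x. sqrt (\<Sum>i<d. f x $ i * f x $ i)) \<in> borel_measurable M" using assms by simp
  moreover have "vnorm (f x) = sqrt (\<Sum>i<d. f x $ i * f x $ i)" if "x \<in> space M" for x
    using assms(2)[OF that] by (simp add: vnorm_def scalar_prod_def lessThan_atLeast0)
  ultimately show ?thesis by (subst measurable_cong) auto
qed

lemma measurable_vnorm_Z [measurable]: "(\<lambda>x. vnorm (Z x)) \<in> borel_measurable D"
  by (rule measurable_vnorm) (auto simp: space_D)

lemma measurable_Z_prod: "v \<in> carrier_vec d \<Longrightarrow> (\<lambda>x. Z x \<bullet> v) \<in> borel_measurable D"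
  by (rule measurable_scalar_prod) auto

lemma integrable_vnorm_pow:
  assumes "k \<le> 4"
  shows "integrable D (\<lambda>x. vnorm (Z x) ^ k)"
proof (rule Bochner_Integration.integrable_bound)
  show "integrable D (\<lambda>x. 1 + vnorm (Z x) ^ 4)" using int4 unfolding Z_def by simp
  have "vnorm (Z x) ^ k \<le> 1 + vnorm (Z x) ^ 4" for x
  proof (cases "vnorm (Z x) \<le> 1")
    case True
    then have "vnorm (Z x) ^ k \<le> 1" by (intro power_le_one) auto
    then show ?thesis using zero_le_power[OF vnorm_nonneg, of "Z x" 4] by linarith
  next
    case False
    then have "vnorm (Z x) ^ k \<le> vnorm (Z x) ^ 4" using assms by (intro power_increasing) auto
    then show ?thesis by simp
  qed
  then show "AE x in D. norm (vnorm (Z x) ^ k) \<le> norm (1 + vnorm (Z x) ^ 4)"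
    using zero_le_power[of "vnorm (Z _)" 4] by (intro AE_I2) auto
qed measurable

lemma integrable_dominated:
  assumes "k \<le> 4" "f \<in> borel_measurable D"
    and "\<And>x. x \<in> carrier_vec d \<Longrightarrow> \<bar>f x\<bar> \<le> c * vnorm (Z x) ^ k"
  shows "integrable D f"
proof (rule Bochner_Integration.integrable_bound)
  show "integrable D (\<lambda>x. c * vnorm (Z x) ^ k)" using integrable_vnorm_pow[OF assms(1)] by simp
  show "AE x in D. norm (f x) \<le> norm (c * vnorm (Z x) ^ k)"
    using assms(3) by (intro AE_I2) (auto simp: space_D intro: order_trans[OF _ abs_ge_self])
qed fact

lemma Z_prod_sq_le: "v \<in> carrier_vec d \<Longrightarrow> x \<in> carrier_vec d \<Longrightarrow> (Z x \<bullet> v)\<^sup>2 \<le> (vnorm v)\<^sup>2 * vnorm (Z x) ^ 2"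
  using scalar_prod_sq_le[of "Z x" d v] by (simp add: mult.commute)

lemma integrable_Z_prod:
  assumes v: "v \<in> carrier_vec d"
  shows "integrable D (\<lambda>x. Z x \<bullet> v)" "integrable D (\<lambda>x. (Z x \<bullet> v)\<^sup>2)"
    "integrable D (\<lambda>x. (Z x \<bullet> v) ^ 4)" "integrable D (\<lambda>x. (vnorm (Z x))\<^sup>2 * (Z x \<bullet> v)\<^sup>2)"
proof -
  note [measurable] = measurable_Z_prod[OF v]
  show "integrable D (\<lambda>x. Z x \<bullet> v)"
    using abs_scalar_prod_le[of "Z _" d v] v
    by (intro integrable_dominated[of 1 _ "vnorm v"]) (auto simp: mult.commute)
  show "integrable D (\<lambda>x. (Z x \<bullet> v)\<^sup>2)"
    using Z_prod_sq_le[OF v] by (intro integrable_dominated[of 2 _ "(vnorm v)\<^sup>2"]) auto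
  have "(Z x \<bullet> v) ^ 4 \<le> vnorm v ^ 4 * vnorm (Z x) ^ 4" if "x \<in> carrier_vec d" for x
    using power_mono[OF Z_prod_sq_le[OF v that], of 2] by (simp add: power_mult_distrib flip: power_mult)
  then show "integrable D (\<lambda>x. (Z x \<bullet> v) ^ 4)"
    by (intro integrable_dominated[of 4 _ "vnorm v ^ 4"]) auto
  have "(vnorm (Z x))\<^sup>2 * (Z x \<bullet> v)\<^sup>2 \<le> (vnorm v)\<^sup>2 * vnorm (Z x) ^ 4" if "x \<in> carrier_vec d" for x
    using mult_left_mono[OF Z_prod_sq_le[OF v that], of "(vnorm (Z x))\<^sup>2"]
    by (simp add: power2_eq_square power4_eq_xxxx mult_ac)
  then show "integrable D (\<lambda>x. (vnorm (Z x))\<^sup>2 * (Z x \<bullet> v)\<^sup>2)"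
    by (intro integrable_dominated[of 4 _ "(vnorm v)\<^sup>2"]) auto
qed

lemma integral_Z_index: "i < d \<Longrightarrow> (\<integral>x. Z x $ i \<partial>D) = 0"
  using int1 by (simp add: Z_index prob_space)

lemma integral_Z_prod: "v \<in> carrier_vec d \<Longrightarrow> (\<integral>x. Z x \<bullet> v \<partial>D) = 0"
proof -
  assume v: "v \<in> carrier_vec d"
  have "(\<integral>x. Z x \<bullet> v \<partial>D) = (\<integral>x. (\<Sum>i<d. Z x $ i * v $ i) \<partial>D)"
    using v by (simp add: scalar_prod_def lessThan_atLeast0)
  also have "\<dots> = (\<Sum>i<d. (\<integral>x. Z x $ i * v $ i \<partial>D))"
    using int1 by (intro Bochner_Integration.integral_sum) (auto simp: Z_index)
  also have "\<dots> = 0" using integral_Z_index by simp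
  finally show ?thesis .
qed

lemma mat_expectation_quad:
  assumes F: "\<And>x. x \<in> carrier_vec d \<Longrightarrow> F x \<in> carrier_mat d d"
    and int: "\<And>i j. i < d \<Longrightarrow> j < d \<Longrightarrow> integrable D (\<lambda>x. F x $$ (i, j))" and v: "v \<in> carrier_vec d"
  shows "v \<bullet> (mat_expectation d D F *\<^sub>v v) = (\<integral>x. v \<bullet> (F x *\<^sub>v v) \<partial>D)"
    and "integrable D (\<lambda>x. v \<bullet> (F x *\<^sub>v v))"
proof -
  have q: "v \<bullet> (F x *\<^sub>v v) = (\<Sum>i<d. \<Sum>j<d. v $ i * (F x $$ (i, j) * v $ j))" if "x \<in> space D" for x
    using quad_form_sum[OF F v v, of x] that by (simp add: space_D)
  have ii: "integrable D (\<lambda>x. v $ i * (F x $$ (i, j) * v $ j))" if "i < d" "j < d" for i j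
    using int[OF that] by simp
  have "v \<bullet> (mat_expectation d D F *\<^sub>v v) = (\<Sum>i<d. \<Sum>j<d. v $ i * ((\<integral>x. F x $$ (i, j) \<partial>D) * v $ j))"
    by (subst quad_form_sum[of _ d]) (use v in \<open>auto simp: mat_expectation_def\<close>)
  also have "\<dots> = (\<integral>x. (\<Sum>i<d. \<Sum>j<d. v $ i * (F x $$ (i, j) * v $ j)) \<partial>D)"
  proof -
    have "(\<integral>x. (\<Sum>i<d. \<Sum>j<d. v $ i * (F x $$ (i, j) * v $ j)) \<partial>D)
        = (\<Sum>i<d. \<integral>x. (\<Sum>j<d. v $ i * (F x $$ (i, j) * v $ j)) \<partial>D)"
      by (intro Bochner_Integration.integral_sum Bochner_Integration.integrable_sum ii) auto
    also have "\<dots> = (\<Sum>i<d. \<Sum>j<d. \<integral>x. v $ i * (F x $$ (i, j) * v $ j) \<partial>D)"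
      by (intro sum.cong refl Bochner_Integration.integral_sum ii) auto
    finally show ?thesis by simp
  qed
  also have "\<dots> = (\<integral>x. v \<bullet> (F x *\<^sub>v v) \<partial>D)" by (rule Bochner_Integration.integral_cong) (auto simp: q)
  finally show "v \<bullet> (mat_expectation d D F *\<^sub>v v) = (\<integral>x. v \<bullet> (F x *\<^sub>v v) \<partial>D)" .
  have "integrable D (\<lambda>x. (\<Sum>i<d. \<Sum>j<d. v $ i * (F x $$ (i, j) * v $ j)))"
    by (intro Bochner_Integration.integrable_sum ii) auto
  then show "integrable D (\<lambda>x. v \<bullet> (F x *\<^sub>v v))" by (subst Bochner_Integration.integrable_cong[OF refl]) (auto simp: q)
qed

lemma covariance_carrier [simp]: "covariance d D \<in> carrier_mat d d"
  by (simp add: covariance_def mat_expectation_def)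

lemma abs_Z_mult_le:
  assumes "x \<in> carrier_vec d" "i < d" "j < d"
  shows "\<bar>Z x $ i * Z x $ j\<bar> \<le> vnorm (Z x) ^ 2"
  unfolding power2_eq_square abs_mult using assms by (intro mult_mono abs_index_le_vnorm[of _ d]) auto

lemma integrable_Z_mult: "i < d \<Longrightarrow> j < d \<Longrightarrow> integrable D (\<lambda>x. Z x $ i * Z x $ j)"
  using abs_Z_mult_le by (intro integrable_dominated[of 2 _ 1]) auto

lemma covariance_quad:
  assumes v: "v \<in> carrier_vec d"
  shows "v \<bullet> (covariance d D *\<^sub>v v) = (\<integral>x. (Z x \<bullet> v)\<^sup>2 \<partial>D)"
proof -
  have "integrable D (\<lambda>x. outer (Z x) $$ (i, j))" if "i < d" "j < d" for i j
    using integrable_Z_mult[OF that] that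
    by (subst Bochner_Integration.integrable_cong[OF refl, of _ _ "\<lambda>x. Z x $ i * Z x $ j"]) (auto simp: space_D outer_index[of _ d])
  then have "v \<bullet> (covariance d D *\<^sub>v v) = (\<integral>x. v \<bullet> (outer (Z x) *\<^sub>v v) \<partial>D)"
    unfolding covariance_def Z_def[symmetric] using v by (intro mat_expectation_quad) auto
  also have "\<dots> = (\<integral>x. (Z x \<bullet> v)\<^sup>2 \<partial>D)"
    using v by (intro Bochner_Integration.integral_cong) (auto simp: space_D outer_quad[of _ d])
  finally show ?thesis .
qed

lemma covariance_symmetric: "transpose_mat (covariance d D) = covariance d D"
proof (rule eq_matI)
  fix i j assume "i < dim_row (covariance d D)" "j < dim_col (covariance d D)"
  then have ij: "i < d" "j < d" by (auto simp: covariance_def mat_expectation_def)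
  have "(\<integral>x. outer (x - mean_vec d D) $$ (j, i) \<partial>D) = (\<integral>x. outer (x - mean_vec d D) $$ (i, j) \<partial>D)"
    using ij by (intro Bochner_Integration.integral_cong) (auto simp: outer_def)
  then show "transpose_mat (covariance d D) $$ (i, j) = covariance d D $$ (i, j)"
    using ij by (simp add: covariance_def mat_expectation_def)
qed (auto simp: covariance_def mat_expectation_def)

lemma covariance_diag: "i < d \<Longrightarrow> covariance d D $$ (i, i) = (\<integral>x. (Z x $ i)\<^sup>2 \<partial>D)"
  unfolding covariance_def mat_expectation_def Z_def[symmetric]
  by (simp, rule Bochner_Integration.integral_cong) (auto simp: space_D power2_eq_square outer_index[of _ d])

lemma tr_covariance: "tr (covariance d D) = (\<integral>x. (vnorm (Z x))\<^sup>2 \<partial>D)"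
proof -
  have "(\<integral>x. (vnorm (Z x))\<^sup>2 \<partial>D) = (\<integral>x. (\<Sum>i<d. (Z x $ i)\<^sup>2) \<partial>D)"
    by (rule Bochner_Integration.integral_cong) (auto simp: space_D vnorm_sq_sum[of _ d])
  also have "\<dots> = (\<Sum>i<d. (\<integral>x. (Z x $ i)\<^sup>2 \<partial>D))"
    using integrable_Z_mult by (intro Bochner_Integration.integral_sum) (auto simp: power2_eq_square)
  finally show ?thesis by (simp add: tr_eq[of _ d] covariance_diag)
qed

definition M4 :: "real mat" where
  "M4 = mat_expectation d D (\<lambda>x. (vnorm (Z x))\<^sup>2 \<cdot>\<^sub>m outer (Z x))"

lemma M4_carrier [simp]: "M4 \<in> carrier_mat d d"
  by (simp add: M4_def mat_expectation_def)

lemma sigma0_eq: "sigma0 d D = sqrt (op_norm M4)"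
  by (simp add: sigma0_def M4_def Z_def)

lemma M4_symmetric: "transpose_mat M4 = M4"
proof (rule eq_matI)
  fix i j assume "i < dim_row M4" "j < dim_col M4"
  then have ij: "i < d" "j < d" by (auto simp: M4_def mat_expectation_def)
  have "(\<integral>x. ((vnorm (Z x))\<^sup>2 \<cdot>\<^sub>m outer (Z x)) $$ (j, i) \<partial>D) = (\<integral>x. ((vnorm (Z x))\<^sup>2 \<cdot>\<^sub>m outer (Z x)) $$ (i, j) \<partial>D)"
    using ij by (intro Bochner_Integration.integral_cong) (auto simp: outer_def Z_def)
  then show "transpose_mat M4 $$ (i, j) = M4 $$ (i, j)"
    using ij by (simp add: M4_def mat_expectation_def)
qed (auto simp: M4_def mat_expectation_def)

lemma M4_quad:
  assumes v: "v \<in> carrier_vec d"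
  shows "v \<bullet> (M4 *\<^sub>v v) = (\<integral>x. (vnorm (Z x))\<^sup>2 * (Z x \<bullet> v)\<^sup>2 \<partial>D)"
proof -
  have "integrable D (\<lambda>x. ((vnorm (Z x))\<^sup>2 \<cdot>\<^sub>m outer (Z x)) $$ (i, j))" if ij: "i < d" "j < d" for i j
  proof -
    have "integrable D (\<lambda>x. (vnorm (Z x))\<^sup>2 * (Z x $ i * Z x $ j))"
    proof (rule integrable_dominated[of 4 _ 1])
      fix x :: "real vec" assume "x \<in> carrier_vec d"
      from mult_left_mono[OF abs_Z_mult_le[OF this ij], of "(vnorm (Z x))\<^sup>2"]
      show "\<bar>(vnorm (Z x))\<^sup>2 * (Z x $ i * Z x $ j)\<bar> \<le> 1 * vnorm (Z x) ^ 4"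
        by (simp add: abs_mult power2_eq_square power4_eq_xxxx mult_ac)
    qed (use ij in measurable)
    then show ?thesis
      using ij by (subst Bochner_Integration.integrable_cong[OF refl, of _ _ "\<lambda>x. (vnorm (Z x))\<^sup>2 * (Z x $ i * Z x $ j)"])
        (auto simp: space_D outer_def)
  qed
  then have "v \<bullet> (M4 *\<^sub>v v) = (\<integral>x. v \<bullet> ((vnorm (Z x))\<^sup>2 \<cdot>\<^sub>m outer (Z x) *\<^sub>v v) \<partial>D)"
    unfolding M4_def using v by (intro mat_expectation_quad) auto
  also have "\<dots> = (\<integral>x. (vnorm (Z x))\<^sup>2 * (Z x \<bullet> v)\<^sup>2 \<partial>D)"
  proof (intro Bochner_Integration.integral_cong refl)
    fix x assume "x \<in> space D"
    then have x: "Z x \<in> carrier_vec d" by (simp add: space_D)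
    show "v \<bullet> ((vnorm (Z x))\<^sup>2 \<cdot>\<^sub>m outer (Z x) *\<^sub>v v) = (vnorm (Z x))\<^sup>2 * (Z x \<bullet> v)\<^sup>2"
      using v x mult_mat_vec_carrier[OF outer_carrier[OF x] v]
      by (simp add: smult_mat_mult_vec[of _ d d] outer_quad[of _ d])
  qed
  finally show ?thesis .
qed

lemma sigma0_nonneg: "0 \<le> sigma0 d D"
  by (simp add: sigma0_eq op_norm_nonneg[of _ d])

lemma sigma0_sq: "(sigma0 d D)\<^sup>2 = op_norm M4"
  by (simp add: sigma0_eq op_norm_nonneg[of _ d])

text \<open>The form in which \<open>sigma0\<close> enters the variance and bias estimates.\<close>

lemma moment4_le:
  assumes v: "v \<in> carrier_vec d"
  shows "(\<integral>x. (vnorm (Z x))\<^sup>2 * (Z x \<bullet> v)\<^sup>2 \<partial>D) \<le> (sigma0 d D)\<^sup>2 * (vnorm v)\<^sup>2"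
  using abs_quad_le_op_norm[OF M4_carrier v] M4_quad[OF v] by (simp add: sigma0_sq abs_le_iff)

lemma integral_sq_le:
  fixes f :: "real vec \<Rightarrow> real"
  assumes "integrable D f" "integrable D (\<lambda>x. (f x)\<^sup>2)"
  shows "(\<integral>x. f x \<partial>D)\<^sup>2 \<le> (\<integral>x. (f x)\<^sup>2 \<partial>D)"
  using variance_eq[OF assms] variance_positive[of f] by simp

text \<open>By Jensen the squared second moment in direction \<open>v\<close> is at most the fourth
  moment, and one factor \<open>(Z x \<bullet> v)\<^sup>2\<close> is bounded by Cauchy-Schwarz. This
  makes \<open>sigma0\<close> positive, and it keeps the error of the mean below half the truncation
  radius at each scale above \<open>sigma0\<close>.\<close>

lemma op_norm_covariance_le_sigma0: "op_norm (covariance d D) \<le> sigma0 d D"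
proof (rule op_norm_le_quad[OF covariance_carrier covariance_symmetric sigma0_nonneg])
  fix v :: "real vec" assume v: "v \<in> carrier_vec d"
  have "(\<integral>x. (Z x \<bullet> v)\<^sup>2 \<partial>D)\<^sup>2 \<le> (\<integral>x. ((Z x \<bullet> v)\<^sup>2)\<^sup>2 \<partial>D)"
    using integrable_Z_prod[OF v] by (intro integral_sq_le) (auto simp flip: power_mult)
  also have "\<dots> \<le> (\<integral>x. (vnorm v)\<^sup>2 * ((vnorm (Z x))\<^sup>2 * (Z x \<bullet> v)\<^sup>2) \<partial>D)"
  proof (rule integral_mono)
    show "integrable D (\<lambda>x. ((Z x \<bullet> v)\<^sup>2)\<^sup>2)" using integrable_Z_prod[OF v] by (simp flip: power_mult)
    show "integrable D (\<lambda>x. (vnorm v)\<^sup>2 * ((vnorm (Z x))\<^sup>2 * (Z x \<bullet> v)\<^sup>2))"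
      using integrable_Z_prod[OF v] by simp
    fix x assume "x \<in> space D"
    then have "(Z x \<bullet> v)\<^sup>2 \<le> (vnorm v)\<^sup>2 * vnorm (Z x) ^ 2" using v by (intro Z_prod_sq_le) (auto simp: space_D)
    from mult_right_mono[OF this, of "(Z x \<bullet> v)\<^sup>2"]
    show "((Z x \<bullet> v)\<^sup>2)\<^sup>2 \<le> (vnorm v)\<^sup>2 * ((vnorm (Z x))\<^sup>2 * (Z x \<bullet> v)\<^sup>2)"
      by (simp add: power2_eq_square mult_ac)
  qed
  also have "\<dots> = (vnorm v)\<^sup>2 * (\<integral>x. (vnorm (Z x))\<^sup>2 * (Z x \<bullet> v)\<^sup>2 \<partial>D)" by simp
  also have "\<dots> \<le> (vnorm v)\<^sup>2 * ((sigma0 d D)\<^sup>2 * (vnorm v)\<^sup>2)" using moment4_le[OF v] by (intro mult_left_mono) auto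
  also have "\<dots> = (sigma0 d D * (vnorm v)\<^sup>2)\<^sup>2" by (simp add: power2_eq_square mult_ac)
  finally have "\<bar>\<integral>x. (Z x \<bullet> v)\<^sup>2 \<partial>D\<bar> \<le> \<bar>sigma0 d D * (vnorm v)\<^sup>2\<bar>" by (simp only: abs_le_square_iff)
  then show "\<bar>v \<bullet> (covariance d D *\<^sub>v v)\<bar> \<le> sigma0 d D * (vnorm v)\<^sup>2"
    using sigma0_nonneg by (simp add: covariance_quad[OF v] abs_mult)
qed

lemma op_norm_covariance_le_tr: "op_norm (covariance d D) \<le> tr (covariance d D)"
proof (rule op_norm_le_quad[OF covariance_carrier covariance_symmetric])
  show "0 \<le> tr (covariance d D)" by (simp add: tr_covariance)
  fix v :: "real vec" assume v: "v \<in> carrier_vec d"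
  have "(\<integral>x. (Z x \<bullet> v)\<^sup>2 \<partial>D) \<le> (\<integral>x. (vnorm v)\<^sup>2 * (vnorm (Z x))\<^sup>2 \<partial>D)"
    using v integrable_Z_prod(2)[OF v] integrable_vnorm_pow[of 2] Z_prod_sq_le[OF v]
    by (intro integral_mono) (auto simp: space_D)
  then show "\<bar>v \<bullet> (covariance d D *\<^sub>v v)\<bar> \<le> tr (covariance d D) * (vnorm v)\<^sup>2"
    by (simp add: covariance_quad[OF v] tr_covariance mult.commute)
qed

end

text \<open>Integrates the square of b f - a g. The final division by a b fails if one bound is 0;
  then that function vanishes almost everywhere.\<close>

lemma integral_mult_le_of_sq:
  fixes f g :: "'a \<Rightarrow> real"
  assumes f: "integrable M (\<lambda>x. (f x)\<^sup>2)" and g: "integrable M (\<lambda>x. (g x)\<^sup>2)" and fg: "integrable M (\<lambda>x. f x * g x)"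
    and a: "0 \<le> a" "(\<integral>x. (f x)\<^sup>2 \<partial>M) \<le> a\<^sup>2" and b: "0 \<le> b" "(\<integral>x. (g x)\<^sup>2 \<partial>M) \<le> b\<^sup>2"
  shows "(\<integral>x. f x * g x \<partial>M) \<le> a * b"
proof -
  have zero: "(\<integral>x. h x * k x \<partial>M) = 0"
    if h: "integrable M (\<lambda>x. (h x)\<^sup>2)" "(\<integral>x. (h x)\<^sup>2 \<partial>M) \<le> 0" for h k :: "'a \<Rightarrow> real"
  proof -
    have "(\<integral>x. (h x)\<^sup>2 \<partial>M) = 0" using h by (intro antisym) auto
    then have "AE x in M. (h x)\<^sup>2 = 0" using h by (subst (asm) integral_nonneg_eq_0_iff_AE) auto
    then show ?thesis by (intro integral_eq_zero_AE) auto
  qed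
  consider "a = 0" | "b = 0" | "0 < a" "0 < b" using a b by linarith
  then show ?thesis
  proof cases
    case 1
    then show ?thesis using zero[OF f, of g] a by simp
  next
    case 2
    then show ?thesis using zero[OF g, of f] b by (simp add: mult.commute)
  next
    case 3
    have "0 \<le> (\<integral>x. (b * f x - a * g x)\<^sup>2 \<partial>M)" by simp
    also have "\<dots> = (\<integral>x. b\<^sup>2 * (f x)\<^sup>2 - 2 * a * b * (f x * g x) + a\<^sup>2 * (g x)\<^sup>2 \<partial>M)"
      by (intro Bochner_Integration.integral_cong) (auto simp: power2_eq_square algebra_simps)
    also have "\<dots> = b\<^sup>2 * (\<integral>x. (f x)\<^sup>2 \<partial>M) - 2 * a * b * (\<integral>x. f x * g x \<partial>M) + a\<^sup>2 * (\<integral>x. (g x)\<^sup>2 \<partial>M)"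
      using f g fg by simp
    also have "\<dots> \<le> b\<^sup>2 * a\<^sup>2 - 2 * a * b * (\<integral>x. f x * g x \<partial>M) + a\<^sup>2 * b\<^sup>2"
      using a b by (intro add_mono diff_right_mono mult_left_mono) auto
    finally have "(a * b) * (\<integral>x. f x * g x \<partial>M) \<le> (a * b) * (a * b)" by (simp add: power2_eq_square mult_ac)
    then show ?thesis using 3 by simp
  qed
qed

context moment_law
begin

section \<open>Consequences of bounded kurtosis\<close>

lemma op_norm_covariance_pos:
  assumes "covariance d D \<noteq> 0\<^sub>m d d"
  shows "0 < op_norm (covariance d D)"
proof (rule ccontr)
  assume "\<not> 0 < op_norm (covariance d D)"
  then have b: "mat_bound n0 (covariance d D) 0" if "n0 = d" for n0
    using mat_bound_op_norm[OF covariance_carrier] mat_bound_mono that by auto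
  have "covariance d D $$ (i, j) = 0" if "i < d" "j < d" for i j
  proof -
    have "vnorm (covariance d D *\<^sub>v unit_vec d j) = 0"
      using mat_boundD(2)[OF b[OF refl], of "unit_vec d j"] vnorm_nonneg[of "covariance d D *\<^sub>v unit_vec d j"] by simp
    then have "covariance d D *\<^sub>v unit_vec d j = 0\<^sub>v d"
      using vnorm_eq_0_iff[of _ d] mult_mat_vec_carrier[OF covariance_carrier] by auto
    then have "(covariance d D *\<^sub>v unit_vec d j) $ i = 0" using that by simp
    then show ?thesis using that carrier_matD[OF covariance_carrier] by simp
  qed
  then have "covariance d D = 0\<^sub>m d d"
    using carrier_matD[OF covariance_carrier] by (intro eq_matI) auto
  with assms show False by simp
qed

text \<open>Homogeneity reduces an arbitrary vector to a unit vector. In a direction of zero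
  variance the projection vanishes almost everywhere, so both sides are 0 although the quotient is
  excluded from \<open>kurtosis_set\<close>.\<close>

lemma kurtosis_le:
  assumes bdd: "bdd_above (kurtosis_set d D)" and v: "v \<in> carrier_vec d"
  shows "sqrt (\<integral>x. (Z x \<bullet> v) ^ 4 \<partial>D) \<le> Sup (kurtosis_set d D) * (\<integral>x. (Z x \<bullet> v)\<^sup>2 \<partial>D)"
proof (cases "(\<integral>x. (Z x \<bullet> v)\<^sup>2 \<partial>D) = 0")
  case True
  then have "AE x in D. (Z x \<bullet> v)\<^sup>2 = 0"
    using integrable_Z_prod[OF v] by (subst (asm) integral_nonneg_eq_0_iff_AE) auto
  then have "(\<integral>x. (Z x \<bullet> v) ^ 4 \<partial>D) = 0" by (intro integral_eq_zero_AE) auto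
  then show ?thesis using True by simp
next
  case False
  have "vnorm v \<noteq> 0"
  proof
    assume "vnorm v = 0"
    then have "(Z x \<bullet> v)\<^sup>2 = 0" if "x \<in> space D" for x
      using Z_prod_sq_le[OF v, of x] that by (simp add: space_D)
    then have "(\<integral>x. (Z x \<bullet> v)\<^sup>2 \<partial>D) = (\<integral>x. 0 \<partial>D)" by (intro Bochner_Integration.integral_cong) auto
    then show False using False by simp
  qed
  then have n0: "0 < vnorm v" using vnorm_nonneg[of v] by linarith
  define u where "u = (1 / vnorm v) \<cdot>\<^sub>v v"
  have u: "u \<in> carrier_vec d" "vnorm u = 1" using v n0 by (auto simp: u_def)
  have zu: "Z x \<bullet> u = (Z x \<bullet> v) / vnorm v" if "x \<in> space D" for x
    using v that by (simp add: u_def space_D)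
  have e2: "(\<integral>x. (Z x \<bullet> u)\<^sup>2 \<partial>D) = (\<integral>x. (Z x \<bullet> v)\<^sup>2 \<partial>D) / (vnorm v)\<^sup>2"
  proof -
    have "(\<integral>x. (Z x \<bullet> u)\<^sup>2 \<partial>D) = (\<integral>x. (Z x \<bullet> v)\<^sup>2 / (vnorm v)\<^sup>2 \<partial>D)"
      by (intro Bochner_Integration.integral_cong) (auto simp: zu power_divide)
    then show ?thesis by simp
  qed
  have e4: "(\<integral>x. (Z x \<bullet> u) ^ 4 \<partial>D) = (\<integral>x. (Z x \<bullet> v) ^ 4 \<partial>D) / vnorm v ^ 4"
  proof -
    have "(\<integral>x. (Z x \<bullet> u) ^ 4 \<partial>D) = (\<integral>x. (Z x \<bullet> v) ^ 4 / vnorm v ^ 4 \<partial>D)"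
      by (intro Bochner_Integration.integral_cong) (auto simp: zu power_divide)
    then show ?thesis by simp
  qed
  have "sqrt (\<integral>x. (Z x \<bullet> u) ^ 4 \<partial>D) / (\<integral>x. (Z x \<bullet> u)\<^sup>2 \<partial>D) \<in> kurtosis_set d D"
  proof -
    have "(\<integral>x. (Z x \<bullet> u)\<^sup>2 \<partial>D) \<noteq> 0" using e2 False n0 by simp
    then show ?thesis
      unfolding kurtosis_set_def Z_def[symmetric] using u by (intro CollectI exI[of _ u]) auto
  qed
  then have "sqrt (\<integral>x. (Z x \<bullet> u) ^ 4 \<partial>D) / (\<integral>x. (Z x \<bullet> u)\<^sup>2 \<partial>D) \<le> Sup (kurtosis_set d D)"
    using bdd by (rule cSup_upper)
  moreover have "sqrt (vnorm v ^ 4) = (vnorm v)\<^sup>2"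
    by (rule real_sqrt_unique) (auto simp flip: power_mult)
  moreover have "0 \<le> (\<integral>x. (Z x \<bullet> v)\<^sup>2 \<partial>D)" by simp
  then have "0 < (\<integral>x. (Z x \<bullet> v)\<^sup>2 \<partial>D)" using False by linarith
  ultimately show ?thesis using n0 by (simp add: e2 e4 real_sqrt_divide pos_divide_le_eq)
qed

text \<open>Jensen in a direction of positive variance, which exists because the covariance is not
  0.\<close>

lemma kurtosis_ge_1:
  assumes bdd: "bdd_above (kurtosis_set d D)" and nz: "covariance d D \<noteq> 0\<^sub>m d d"
  shows "1 \<le> Sup (kurtosis_set d D)"
proof -
  obtain v where v: "v \<in> carrier_vec d" "(\<integral>x. (Z x \<bullet> v)\<^sup>2 \<partial>D) \<noteq> 0"
  proof (rule ccontr)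
    assume "\<not> thesis"
    then have "(\<integral>x. (Z x \<bullet> v)\<^sup>2 \<partial>D) = 0" if "v \<in> carrier_vec d" for v using that \<open>\<And>v. v \<in> carrier_vec d \<Longrightarrow> _ \<Longrightarrow> thesis\<close> by blast
    then have "op_norm (covariance d D) \<le> 0"
      by (intro op_norm_le_quad[OF covariance_carrier covariance_symmetric]) (auto simp: covariance_quad)
    then show False using op_norm_covariance_pos[OF nz] by simp
  qed
  have "0 \<le> (\<integral>x. (Z x \<bullet> v)\<^sup>2 \<partial>D)" by simp
  then have pos: "0 < (\<integral>x. (Z x \<bullet> v)\<^sup>2 \<partial>D)" using v by linarith
  have "(\<integral>x. (Z x \<bullet> v)\<^sup>2 \<partial>D)\<^sup>2 \<le> (\<integral>x. ((Z x \<bullet> v)\<^sup>2)\<^sup>2 \<partial>D)"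
    using integrable_Z_prod[OF v(1)] by (intro integral_sq_le) (auto simp flip: power_mult)
  then have "(\<integral>x. (Z x \<bullet> v)\<^sup>2 \<partial>D) \<le> sqrt (\<integral>x. (Z x \<bullet> v) ^ 4 \<partial>D)"
    by (intro real_le_rsqrt) (simp flip: power_mult)
  also have "\<dots> \<le> Sup (kurtosis_set d D) * (\<integral>x. (Z x \<bullet> v)\<^sup>2 \<partial>D)" by (rule kurtosis_le[OF bdd v(1)])
  finally show ?thesis using pos by simp
qed

lemma Z_unit_vec: "i < d \<Longrightarrow> x \<in> carrier_vec d \<Longrightarrow> Z x \<bullet> unit_vec d i = Z x $ i"
  by simp

text \<open>Expands the squared norm of Z into its coordinates and applies Cauchy-Schwarz to each
  product. The kurtosis bound in the coordinate direction and in direction \<open>v\<close> gives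
  one factor R each, and the coordinate variances add up to the trace.\<close>

lemma sigma0_sq_le:
  assumes bdd: "bdd_above (kurtosis_set d D)" and nz: "covariance d D \<noteq> 0\<^sub>m d d"
  shows "(sigma0 d D)\<^sup>2 \<le> (Sup (kurtosis_set d D))\<^sup>2 * tr (covariance d D) * op_norm (covariance d D)"
proof -
  define R where "R = Sup (kurtosis_set d D)"
  have R: "1 \<le> R" unfolding R_def by (rule kurtosis_ge_1[OF assms])
  have fourth: "(\<integral>x. ((Z x \<bullet> v)\<^sup>2)\<^sup>2 \<partial>D) \<le> (R * (\<integral>x. (Z x \<bullet> v)\<^sup>2 \<partial>D))\<^sup>2" if v: "v \<in> carrier_vec d" for v
  proof -
    have "(\<integral>x. ((Z x \<bullet> v)\<^sup>2)\<^sup>2 \<partial>D) = (sqrt (\<integral>x. (Z x \<bullet> v) ^ 4 \<partial>D))\<^sup>2" by (simp flip: power_mult)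
    also have "\<dots> \<le> (R * (\<integral>x. (Z x \<bullet> v)\<^sup>2 \<partial>D))\<^sup>2"
      unfolding R_def by (intro power_mono kurtosis_le[OF bdd v]) auto
    finally show ?thesis .
  qed
  have "op_norm M4 \<le> R\<^sup>2 * tr (covariance d D) * op_norm (covariance d D)"
  proof (rule op_norm_le_quad[OF M4_carrier M4_symmetric])
    show "0 \<le> R\<^sup>2 * tr (covariance d D) * op_norm (covariance d D)"
      by (simp add: tr_covariance op_norm_nonneg[OF covariance_carrier])
    fix v :: "real vec" assume v: "v \<in> carrier_vec d"
    let ?b = "\<integral>x. (Z x \<bullet> v)\<^sup>2 \<partial>D"
    have int: "integrable D (\<lambda>x. (Z x $ i)\<^sup>2 * (Z x \<bullet> v)\<^sup>2)" if "i < d" for i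
    proof (rule integrable_dominated[of 4 _ "(vnorm v)\<^sup>2"])
      show "(\<lambda>x. (Z x $ i)\<^sup>2 * (Z x \<bullet> v)\<^sup>2) \<in> borel_measurable D"
        using measurable_Z_prod[OF v] that by measurable
      fix x :: "real vec" assume x: "x \<in> carrier_vec d"
      have "\<bar>Z x $ i\<bar>\<^sup>2 \<le> (vnorm (Z x))\<^sup>2" using abs_index_le_vnorm[of "Z x" d i] x that by (intro power_mono) auto
      then have "(Z x $ i)\<^sup>2 * (Z x \<bullet> v)\<^sup>2 \<le> (vnorm (Z x))\<^sup>2 * ((vnorm v)\<^sup>2 * vnorm (Z x) ^ 2)"
        using Z_prod_sq_le[OF v x] by (intro mult_mono) auto
      also have "\<dots> = (vnorm v)\<^sup>2 * vnorm (Z x) ^ 4"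
        by (simp add: power2_eq_square power4_eq_xxxx mult_ac)
      finally show "\<bar>(Z x $ i)\<^sup>2 * (Z x \<bullet> v)\<^sup>2\<bar> \<le> (vnorm v)\<^sup>2 * vnorm (Z x) ^ 4" by simp
    qed simp
    have each: "(\<integral>x. (Z x $ i)\<^sup>2 * (Z x \<bullet> v)\<^sup>2 \<partial>D) \<le> (R * (\<integral>x. (Z x $ i)\<^sup>2 \<partial>D)) * (R * ?b)" if i: "i < d" for i
    proof (rule integral_mult_le_of_sq[OF _ _ int[OF i]])
      have u: "unit_vec d i \<in> carrier_vec d" by simp
      have eq: "(\<integral>x. (Z x \<bullet> unit_vec d i)\<^sup>2 \<partial>D) = (\<integral>x. (Z x $ i)\<^sup>2 \<partial>D)"
        "(\<integral>x. ((Z x \<bullet> unit_vec d i)\<^sup>2)\<^sup>2 \<partial>D) = (\<integral>x. ((Z x $ i)\<^sup>2)\<^sup>2 \<partial>D)"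
        using Z_unit_vec[OF i] by (auto intro!: Bochner_Integration.integral_cong simp: space_D)
      show "(\<integral>x. ((Z x $ i)\<^sup>2)\<^sup>2 \<partial>D) \<le> (R * (\<integral>x. (Z x $ i)\<^sup>2 \<partial>D))\<^sup>2" using fourth[OF u] eq by simp
      show "integrable D (\<lambda>x. ((Z x $ i)\<^sup>2)\<^sup>2)"
        using integrable_Z_prod(3)[OF u] Z_unit_vec[OF i]
        by (subst Bochner_Integration.integrable_cong[OF refl, of _ _ "\<lambda>x. (Z x \<bullet> unit_vec d i) ^ 4"])
          (auto simp: space_D simp flip: power_mult)
      show "integrable D (\<lambda>x. ((Z x \<bullet> v)\<^sup>2)\<^sup>2)" using integrable_Z_prod(3)[OF v] by (simp flip: power_mult)
      show "(\<integral>x. ((Z x \<bullet> v)\<^sup>2)\<^sup>2 \<partial>D) \<le> (R * ?b)\<^sup>2" by (rule fourth[OF v])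
    qed (use R in auto)
    have b: "?b \<le> op_norm (covariance d D) * (vnorm v)\<^sup>2"
      using abs_quad_le_op_norm[OF covariance_carrier v] by (simp add: covariance_quad[OF v] abs_le_iff)
    have "(\<integral>x. (vnorm (Z x))\<^sup>2 * (Z x \<bullet> v)\<^sup>2 \<partial>D) = (\<integral>x. (\<Sum>i<d. (Z x $ i)\<^sup>2 * (Z x \<bullet> v)\<^sup>2) \<partial>D)"
      by (intro Bochner_Integration.integral_cong) (auto simp: space_D vnorm_sq_sum[of _ d] sum_distrib_right)
    also have "\<dots> = (\<Sum>i<d. \<integral>x. (Z x $ i)\<^sup>2 * (Z x \<bullet> v)\<^sup>2 \<partial>D)"
      using int by (intro Bochner_Integration.integral_sum) auto
    also have "\<dots> \<le> (\<Sum>i<d. (R * (\<integral>x. (Z x $ i)\<^sup>2 \<partial>D)) * (R * ?b))" using each by (intro sum_mono) auto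
    also have "\<dots> = R\<^sup>2 * tr (covariance d D) * ?b"
      by (simp add: tr_eq[of _ d] covariance_diag sum_distrib_left sum_distrib_right power2_eq_square mult_ac)
    also have "\<dots> \<le> R\<^sup>2 * tr (covariance d D) * (op_norm (covariance d D) * (vnorm v)\<^sup>2)"
      using b by (intro mult_left_mono) (auto simp: tr_covariance)
    finally show "\<bar>v \<bullet> (M4 *\<^sub>v v)\<bar> \<le> R\<^sup>2 * tr (covariance d D) * op_norm (covariance d D) * (vnorm v)\<^sup>2"
      by (simp add: M4_quad[OF v] mult.assoc)
  qed
  then show ?thesis by (simp add: sigma0_sq R_def)
qed

section \<open>The median of means\<close>

lemma prob_space_sample: "prob_space (sample_law m D)"
  unfolding sample_law_def by (rule prob_space_PiM) (rule prob_space_axioms)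

lemma sample_component:
  assumes "i < m"
  shows "(\<lambda>x. x i) \<in> sample_law m D \<rightarrow>\<^sub>M D"
  unfolding sample_law_def using assms by (intro measurable_component_singleton) auto

lemma sample_carrier: "x \<in> space (sample_law m D) \<Longrightarrow> i < m \<Longrightarrow> x i \<in> carrier_vec d"
  by (auto simp: sample_law_def space_PiM space_D[symmetric])

lemma indep_sample:
  assumes "0 < m"
  shows "prob_space.indep_vars (sample_law m D) (\<lambda>_. D) (\<lambda>i x. x i) {..<m}"
proof -
  interpret P: prob_space "sample_law m D" by (rule prob_space_sample)
  have "distr (sample_law m D) (PiM {..<m} (\<lambda>_. D)) (\<lambda>x. \<lambda>i\<in>{..<m}. x i) = PiM {..<m} (\<lambda>_. D)"
    unfolding sample_law_def
    by (subst distr_cong[OF refl refl, of _ _ "\<lambda>x. x"]) (auto simp: space_PiM distr_id2)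
  also have "\<dots> = PiM {..<m} (\<lambda>i. distr (sample_law m D) D (\<lambda>x. x i))"
    unfolding sample_law_def using distr_PiM_component[of "{..<m}" "\<lambda>_. D"] prob_space_axioms by (intro PiM_cong) auto
  finally show ?thesis
    using assms by (subst P.indep_vars_iff_distr_eq_PiM') (auto intro: sample_component)
qed

lemma integral_sample_mult:
  fixes f g :: "real vec \<Rightarrow> real"
  assumes ij: "i < m" "j < m" "i \<noteq> j" and f: "integrable D f" and g: "integrable D g"
  shows "(\<integral>x. f (x i) * g (x j) \<partial>sample_law m D) = (\<integral>x. f x \<partial>D) * (\<integral>x. g x \<partial>D)"
    and "integrable (sample_law m D) (\<lambda>x. f (x i) * g (x j))"
proof -
  interpret product_sigma_finite "\<lambda>_::nat. D" by standard
  \<comment> \<open>Pads the two functions with the constant 1 at all other coordinates, so that the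
    product formula over the whole index set applies.\<close>
  define h where "h k = (if k = i then f else if k = j then g else (\<lambda>_. 1))" for k
  have p: "(\<Prod>k\<in>{..<m}. t k) = t i * t j" if "\<And>k. k \<noteq> i \<Longrightarrow> k \<noteq> j \<Longrightarrow> t k = (1::real)" for t
  proof -
    have "(\<Prod>k\<in>{..<m}. t k) = (\<Prod>k\<in>{i, j}. t k)"
      using ij that by (intro prod.mono_neutral_right) auto
    then show ?thesis using ij by simp
  qed
  have hp: "(\<Prod>k\<in>{..<m}. h k (x k)) = f (x i) * g (x j)" for x
    using p[of "\<lambda>k. h k (x k)"] ij by (simp add: h_def)
  have hi: "integrable D (h k)" for k using f g by (simp add: h_def)
  have "(\<integral>x. f (x i) * g (x j) \<partial>sample_law m D) = (\<Prod>k\<in>{..<m}. integral\<^sup>L D (h k))"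
    using product_integral_prod[of "{..<m}" h] hi by (simp add: hp sample_law_def)
  also have "\<dots> = (\<integral>x. f x \<partial>D) * (\<integral>x. g x \<partial>D)"
    using p[of "\<lambda>k. integral\<^sup>L D (h k)"] ij by (simp add: h_def prob_space)
  finally show "(\<integral>x. f (x i) * g (x j) \<partial>sample_law m D) = (\<integral>x. f x \<partial>D) * (\<integral>x. g x \<partial>D)" .
  show "integrable (sample_law m D) (\<lambda>x. f (x i) * g (x j))"
    using product_integrable_prod[of "{..<m}" h] hi by (simp add: hp sample_law_def)
qed

lemma integral_sample_single:
  fixes f :: "real vec \<Rightarrow> real"
  assumes i: "i < m" and f: "integrable D f"
  shows "(\<integral>x. f (x i) \<partial>sample_law m D) = (\<integral>x. f x \<partial>D)" "integrable (sample_law m D) (\<lambda>x. f (x i))"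
proof -
  have d: "distr (sample_law m D) D (\<lambda>x. x i) = D"
    unfolding sample_law_def using i by (intro distr_PiM_component) (auto intro: prob_space_axioms)
  have "integral\<^sup>L (distr (sample_law m D) D (\<lambda>x. x i)) f = (\<integral>x. f (x i) \<partial>sample_law m D)"
    using f by (intro integral_distr sample_component[OF i]) auto
  then show "(\<integral>x. f (x i) \<partial>sample_law m D) = (\<integral>x. f x \<partial>D)" by (simp add: d)
  show "integrable (sample_law m D) (\<lambda>x. f (x i))"
    using integrable_distr[OF sample_component[OF i], of f] f by (simp add: d)
qed

lemma measurable_group_mean:
  assumes "S \<subseteq> {..<m}" "c < d"
  shows "(\<lambda>x. group_mean d S x $ c) \<in> borel_measurable (sample_law m D)"
proof -
  have "(\<lambda>x. x i $ c) \<in> borel_measurable (sample_law m D)" if "i \<in> S" for i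
    using that assms by (intro measurable_compose[OF sample_component measurable_index]) auto
  then show ?thesis using assms by (simp add: group_mean_def)
qed

lemma group_mean_carrier [simp]: "group_mean d S x \<in> carrier_vec d"
  by (simp add: group_mean_def)

text \<open>Expanding the square, the mixed terms vanish by independence and centering, and the
  diagonal ones add up to the trace.\<close>

lemma group_mean_variance:
  assumes S: "S \<subseteq> {..<m}" "S \<noteq> {}"
  shows "integrable (sample_law m D) (\<lambda>x. (vnorm (group_mean d S x - mean_vec d D))\<^sup>2)"
    and "(\<integral>x. (vnorm (group_mean d S x - mean_vec d D))\<^sup>2 \<partial>sample_law m D) = tr (covariance d D) / real (card S)"
proof -
  have fin: "finite S" using S finite_subset by blast
  then have cS: "0 < card S" using S by (simp add: card_gt_0_iff)
  have eq: "(vnorm (group_mean d S x - mean_vec d D))\<^sup>2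
      = (\<Sum>c<d. (\<Sum>i\<in>S. \<Sum>j\<in>S. Z (x i) $ c * Z (x j) $ c)) / (real (card S))\<^sup>2" for x
  proof -
    have "(group_mean d S x - mean_vec d D) $ c = (\<Sum>i\<in>S. Z (x i) $ c) / real (card S)" if "c < d" for c
      using that cS by (simp add: group_mean_def Z_index mean_vec_def sum_subtractf diff_divide_distrib)
    then have "(vnorm (group_mean d S x - mean_vec d D))\<^sup>2 = (\<Sum>c<d. ((\<Sum>i\<in>S. Z (x i) $ c) / real (card S))\<^sup>2)"
      by (subst vnorm_sq_sum[of _ d]) auto
    then show ?thesis by (simp add: power_divide sum_divide_distrib power2_eq_square sum_product)
  qed
  have int1: "integrable D (\<lambda>x. Z x $ c)" if "c < d" for c using int1[OF that] that by (simp add: Z_index)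
  have int: "integrable (sample_law m D) (\<lambda>x. Z (x i) $ c * Z (x j) $ c)" if "i \<in> S" "j \<in> S" "c < d" for i j c
  proof (cases "i = j")
    case True
    then show ?thesis
      using integral_sample_single(2)[of j m "\<lambda>x. Z x $ c * Z x $ c"] integrable_Z_mult that S by auto
  next
    case False
    then show ?thesis
      using integral_sample_mult(2)[of i m j "\<lambda>x. Z x $ c" "\<lambda>x. Z x $ c"] int1 that S by auto
  qed
  have val: "(\<integral>x. Z (x i) $ c * Z (x j) $ c \<partial>sample_law m D) = (if i = j then covariance d D $$ (c, c) else 0)"
    if "i \<in> S" "j \<in> S" "c < d" for i j c
  proof (cases "i = j")
    case True
    then show ?thesis
      using integral_sample_single(1)[of j m "\<lambda>x. Z x $ c * Z x $ c"] integrable_Z_mult that S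
      by (auto simp: covariance_diag power2_eq_square)
  next
    case False
    then show ?thesis
      using integral_sample_mult(1)[of i m j "\<lambda>x. Z x $ c" "\<lambda>x. Z x $ c"] int1 that S
      by (auto simp: integral_Z_index)
  qed
  show "integrable (sample_law m D) (\<lambda>x. (vnorm (group_mean d S x - mean_vec d D))\<^sup>2)"
    unfolding eq using int by (intro integrable_divide Bochner_Integration.integrable_sum) auto
  have "(\<integral>x. (vnorm (group_mean d S x - mean_vec d D))\<^sup>2 \<partial>sample_law m D)
      = (\<integral>x. (\<Sum>c<d. (\<Sum>i\<in>S. \<Sum>j\<in>S. Z (x i) $ c * Z (x j) $ c)) \<partial>sample_law m D) / (real (card S))\<^sup>2"
    unfolding eq by simp
  also have "(\<integral>x. (\<Sum>c<d. (\<Sum>i\<in>S. \<Sum>j\<in>S. Z (x i) $ c * Z (x j) $ c)) \<partial>sample_law m D)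
      = (\<Sum>c<d. \<integral>x. (\<Sum>i\<in>S. \<Sum>j\<in>S. Z (x i) $ c * Z (x j) $ c) \<partial>sample_law m D)"
    using int by (intro Bochner_Integration.integral_sum Bochner_Integration.integrable_sum) auto
  also have "\<dots> = (\<Sum>c<d. \<Sum>i\<in>S. \<integral>x. (\<Sum>j\<in>S. Z (x i) $ c * Z (x j) $ c) \<partial>sample_law m D)"
    using int by (intro sum.cong refl Bochner_Integration.integral_sum Bochner_Integration.integrable_sum) auto
  also have "\<dots> = (\<Sum>c<d. \<Sum>i\<in>S. \<Sum>j\<in>S. \<integral>x. Z (x i) $ c * Z (x j) $ c \<partial>sample_law m D)"
    using int by (intro sum.cong refl Bochner_Integration.integral_sum) auto
  also have "\<dots> = (\<Sum>c<d. \<Sum>i\<in>S. \<Sum>j\<in>S. if i = j then covariance d D $$ (c, c) else 0)"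
    using val by (intro sum.cong refl) auto
  also have "\<dots> = real (card S) * tr (covariance d D)"
    using fin by (simp add: tr_eq[of _ d] sum_distrib_left)
  finally show "(\<integral>x. (vnorm (group_mean d S x - mean_vec d D))\<^sup>2 \<partial>sample_law m D) = tr (covariance d D) / real (card S)"
    using cS by (simp add: power2_eq_square)
qed

end

text \<open>Compare the objective at \<open>z\<close> and at \<open>\<mu>\<close>, with t their
  distance. Each good point raises it by at least t - 2 \<rho>, each bad one lowers it by at most t.
  If t > 4 \<rho>, more than two thirds of the points contribute over t/2 each, and fewer than one
  third cannot compensate.\<close>

lemma geometric_median_close:
  fixes z \<mu> :: "real vec" and k :: nat
  assumes z: "z \<in> carrier_vec d" and \<mu>: "\<mu> \<in> carrier_vec d" and y: "\<And>j. j < k \<Longrightarrow> y j \<in> carrier_vec d"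
    and min: "(\<Sum>j<k. vnorm (z - y j)) \<le> (\<Sum>j<k. vnorm (\<mu> - y j))"
    and bad: "3 * card {j \<in> {..<k}. \<rho> < vnorm (y j - \<mu>)} < k" and \<rho>: "0 \<le> \<rho>"
  shows "vnorm (z - \<mu>) \<le> 4 * \<rho>"
proof -
  define B where "B = {j \<in> {..<k}. \<rho> < vnorm (y j - \<mu>)}"
  define t where "t = vnorm (z - \<mu>)"
  have t: "0 \<le> t" by (simp add: t_def)
  have B: "B \<subseteq> {..<k}" by (auto simp: B_def)
  have cB: "card B \<le> k" using card_mono[OF _ B] by simp
  have cG: "card ({..<k} - B) = k - card B" using B card_Diff_subset[of B "{..<k}"] finite_subset[OF B] by simp
  have tri: "t - vnorm (\<mu> - y j) \<le> vnorm (z - y j)" if "j < k" for j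
  proof -
    have "(z - y j) - (\<mu> - y j) = z - \<mu>" using z \<mu> y[OF that] by (intro eq_vecI) auto
    then show ?thesis using vnorm_minus_le[of "z - y j" d "\<mu> - y j"] z \<mu> y[OF that] by (simp add: t_def)
  qed
  have good: "t - 2 * \<rho> \<le> vnorm (z - y j) - vnorm (\<mu> - y j)" if "j \<in> {..<k} - B" for j
  proof -
    have "vnorm (\<mu> - y j) \<le> \<rho>" using that \<mu> y vnorm_minus_commute[of \<mu> d "y j"] by (auto simp: B_def)
    then show ?thesis using tri[of j] that by simp
  qed
  have bad': "- t \<le> vnorm (z - y j) - vnorm (\<mu> - y j)" if "j \<in> B" for j
  proof -
    have j: "j < k" using that B by auto
    have "(\<mu> - y j) - (z - y j) = \<mu> - z" using z \<mu> y[OF j] by (intro eq_vecI) auto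
    then show ?thesis
      using vnorm_triangle_sub[of "\<mu> - y j" d "z - y j"] z \<mu> y[OF j] vnorm_minus_commute[OF z \<mu>] by (simp add: t_def)
  qed
  have "real (k - card B) * (t - 2 * \<rho>) + real (card B) * (- t)
      \<le> (\<Sum>j\<in>{..<k} - B. vnorm (z - y j) - vnorm (\<mu> - y j)) + (\<Sum>j\<in>B. vnorm (z - y j) - vnorm (\<mu> - y j))"
    using sum_bounded_below[of "{..<k} - B" "t - 2 * \<rho>", OF good] sum_bounded_below[of B "- t", OF bad'] cG
    by (intro add_mono) simp_all
  also have "\<dots> = (\<Sum>j<k. vnorm (z - y j) - vnorm (\<mu> - y j))"
    using sum.subset_diff[OF B, of "\<lambda>j. vnorm (z - y j) - vnorm (\<mu> - y j)"] by simp
  also have "\<dots> \<le> 0" using min by (simp add: sum_subtractf)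
  finally have le: "(real k - real (card B)) * (t - 2 * \<rho>) \<le> real (card B) * t" using cB by (simp add: of_nat_diff)
  have b: "3 * real (card B) < real k" using bad unfolding B_def[symmetric] by linarith
  show ?thesis
  proof (rule ccontr)
    assume "\<not> vnorm (z - \<mu>) \<le> 4 * \<rho>"
    then have r: "4 * \<rho> < t" by (simp add: t_def)
    have "2 * real (card B) * (t / 2) < (real k - real (card B)) * (t / 2)"
      using b r \<rho> by (intro mult_strict_right_mono) auto
    also have "\<dots> \<le> (real k - real (card B)) * (t - 2 * \<rho>)"
      using r cB by (intro mult_left_mono) auto
    finally show False using le by simp
  qed
qed

context moment_law
begin

text \<open>A group mean depends on its own coordinates only; this is what makes disjoint groups
  independent.\<close>

lemma group_mean_restrict: "group_mean d S (restrict x S) = group_mean d S x"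
  by (simp add: group_mean_def)

text \<open>Chebyshev. With failure probability 1/216, the weight 216 on failure has expectation 1 +
  215/216, which is below 2.\<close>

lemma prob_far_group_mean:
  assumes S: "S \<subseteq> {..<m}" "S \<noteq> {}" and \<rho>: "0 < \<rho>2" "216 * tr (covariance d D) \<le> \<rho>2 * real (card S)"
  shows "measure (sample_law m D) {x \<in> space (sample_law m D). \<rho>2 < (vnorm (group_mean d S x - mean_vec d D))\<^sup>2} \<le> 1 / 216"
proof -
  interpret P: prob_space "sample_law m D" by (rule prob_space_sample)
  let ?u = "\<lambda>x. (vnorm (group_mean d S x - mean_vec d D))\<^sup>2"
  have cS: "0 < card S" using S finite_subset by (auto simp: card_gt_0_iff)
  have "P.prob {x \<in> space (sample_law m D). \<rho>2 < ?u x} \<le> P.prob {x \<in> space (sample_law m D). \<rho>2 \<le> ?u x}"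
    using group_mean_variance(1)[OF S] by (intro P.finite_measure_mono) (auto intro!: measurable_sets_Collect)
  also have "\<dots> \<le> (\<integral>x. ?u x \<partial>sample_law m D) / \<rho>2"
    by (rule integral_Markov_inequality_measure[where A = "{}"]) (use group_mean_variance(1)[OF S] \<rho> in auto)
  also have "\<dots> \<le> 1 / 216"
    using \<rho> cS by (simp add: group_mean_variance(2)[OF S] field_simps)
  finally show ?thesis .
qed

lemma measurable_vnorm_group_mean:
  assumes "S \<subseteq> {..<m}"
  shows "(\<lambda>x. vnorm (group_mean d S x - mean_vec d D)) \<in> borel_measurable (sample_law m D)"
proof (rule measurable_vnorm)
  fix i assume "i < d"
  then show "(\<lambda>x. (group_mean d S x - mean_vec d D) $ i) \<in> borel_measurable (sample_law m D)"
    using measurable_group_mean[OF assms] by simp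
qed auto

text \<open>Exponential Markov inequality with weight \<open>216\<close> per bad group, so that \<open>k / 3\<close> bad groups
  contribute \<open>6\<^sup>k\<close>, against an expected weight of at most \<open>2\<^sup>k\<close>.\<close>

lemma prob_many_far_groups:
  fixes G :: "nat \<Rightarrow> nat set" and k :: nat
  assumes disj: "disjoint_family_on G {..<k}" and G: "\<And>j. j < k \<Longrightarrow> G j \<subseteq> {..<m} \<and> G j \<noteq> {}"
    and \<rho>: "0 < \<rho>2" "\<And>j. j < k \<Longrightarrow> 216 * tr (covariance d D) \<le> \<rho>2 * real (card (G j))"
  shows "measure (sample_law m D) {x \<in> space (sample_law m D).
    k \<le> 3 * card {j \<in> {..<k}. \<rho>2 < (vnorm (group_mean d (G j) x - mean_vec d D))\<^sup>2}} \<le> (1 / 3) ^ k"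
proof (cases "k = 0")
  case True
  interpret P: prob_space "sample_law m D" by (rule prob_space_sample)
  show ?thesis using True by simp
next
  case False
  let ?P = "sample_law m D"
  interpret P: prob_space ?P by (rule prob_space_sample)
  define bad where "bad j x \<longleftrightarrow> \<rho>2 < (vnorm (group_mean d (G j) x - mean_vec d D))\<^sup>2" for j x
  define Y where "Y j x = (if bad j x then 216 else 1 :: ennreal)" for j x
  have m0: "0 < m" using G[of 0] False by (cases m) auto
  have meas_bad: "{x \<in> space ?P. bad j x} \<in> sets ?P" if "j < k" for j
  proof -
    have [measurable]: "(\<lambda>x. vnorm (group_mean d (G j) x - mean_vec d D)) \<in> borel_measurable ?P"
      using G[OF that] by (intro measurable_vnorm_group_mean) auto
    show ?thesis unfolding bad_def by measurable
  qed
  have Ymeas: "Y j \<in> borel_measurable ?P" if "j < k" for j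
    unfolding Y_def using meas_bad[OF that] by (intro measurable_If) auto
  have indep: "P.indep_vars (\<lambda>_. borel) Y {..<k}"
  proof -
    \<comment> \<open>Disjoint blocks of independent coordinates are independent. Each weight is
      then a measurable function of the restriction to its block.\<close>
    have "P.indep_vars (\<lambda>j. PiM (G j) (\<lambda>_. D)) (\<lambda>j \<omega>. restrict (\<lambda>i. \<omega> i) (G j)) {..<k}"
      by (rule P.indep_vars_restrict[OF indep_sample[OF m0] _ disj]) (use G in auto)
    then have "P.indep_vars (\<lambda>_. borel) (\<lambda>j \<omega>. Y j (restrict (\<lambda>i. \<omega> i) (G j))) {..<k}"
    proof (rule P.indep_vars_compose2)
      fix j assume j: "j \<in> {..<k}"
      have "(\<lambda>x. (group_mean d (G j) x - mean_vec d D) $ c) \<in> borel_measurable (PiM (G j) (\<lambda>_. D))" if "c < d" for c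
      proof -
        have "(\<lambda>x. x i $ c) \<in> borel_measurable (PiM (G j) (\<lambda>_. D))" if "i \<in> G j" for i
          by (rule measurable_compose[OF measurable_component_singleton[OF that] measurable_index[OF \<open>c < d\<close>]])
        then show ?thesis using that by (simp add: group_mean_def)
      qed
      then have [measurable]: "(\<lambda>x. vnorm (group_mean d (G j) x - mean_vec d D)) \<in> borel_measurable (PiM (G j) (\<lambda>_. D))"
        by (intro measurable_vnorm) auto
      show "Y j \<in> borel_measurable (PiM (G j) (\<lambda>_. D))"
        unfolding Y_def bad_def by measurable
    qed
    then show ?thesis by (simp add: Y_def[abs_def] bad_def group_mean_restrict)
  qed
  have EY: "(\<integral>\<^sup>+x. Y j x \<partial>?P) \<le> 2" if j: "j < k" for j
  proof -
    have "(\<integral>\<^sup>+x. Y j x \<partial>?P) = (\<integral>\<^sup>+x. 1 + 215 * indicator {x \<in> space ?P. bad j x} x \<partial>?P)"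
      by (intro nn_integral_cong) (auto simp: Y_def indicator_def)
    also have "\<dots> = 1 + 215 * emeasure ?P {x \<in> space ?P. bad j x}"
      using meas_bad[OF j] by (subst nn_integral_add) (auto simp: P.emeasure_space_1 nn_integral_cmult_indicator)
    also have "\<dots> \<le> 1 + 215 * ennreal (1 / 216)"
      using prob_far_group_mean[of "G j" m \<rho>2] G[OF j] \<rho>(1) \<rho>(2)[OF j]
      by (intro add_left_mono mult_left_mono) (auto simp: P.emeasure_eq_measure bad_def ennreal_leI)
    also have "\<dots> \<le> 2"
    proof -
      have "1 + 215 * ennreal (1 / 216) = ennreal (1 + 215 * (1 / 216))"
        using ennreal_mult[of 215 "1 / 216"] by (subst ennreal_plus) auto
      also have "\<dots> \<le> ennreal 2" by (rule ennreal_leI) simp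
      finally show ?thesis by simp
    qed
    finally show ?thesis .
  qed
  define N where "N x = card {j \<in> {..<k}. bad j x}" for x
  have prodY: "(\<Prod>j<k. Y j x) = 216 ^ N x" for x
    by (simp add: Y_def N_def prod.If_cases Int_def)
  have "(\<integral>\<^sup>+x. (\<Prod>j<k. Y j x) \<partial>?P) = (\<Prod>j<k. \<integral>\<^sup>+x. Y j x \<partial>?P)"
    by (rule P.indep_vars_nn_integral[OF _ indep]) auto
  also have "\<dots> \<le> 2 ^ k"
  proof -
    have "(\<Prod>j<n. \<integral>\<^sup>+x. Y j x \<partial>?P) \<le> 2 ^ n" if "n \<le> k" for n
      using that
    proof (induction n)
      case (Suc n)
      then show ?case using mult_mono[of "\<Prod>j<n. \<integral>\<^sup>+x. Y j x \<partial>?P" "2 ^ n" "\<integral>\<^sup>+x. Y n x \<partial>?P" 2] EY[of n]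
        by (simp add: mult.commute)
    qed simp
    then show ?thesis by simp
  qed
  finally have E: "(\<integral>\<^sup>+x. (\<Prod>j<k. Y j x) \<partial>?P) \<le> 2 ^ k" .
  have "emeasure ?P {x \<in> space ?P. k \<le> 3 * N x}
      \<le> emeasure ?P {x \<in> space ?P. 1 \<le> ennreal ((1 / 6) ^ k) * (\<Prod>j<k. Y j x)}"
  proof (rule emeasure_mono)
    show "{x \<in> space ?P. k \<le> 3 * N x} \<subseteq> {x \<in> space ?P. 1 \<le> ennreal ((1 / 6) ^ k) * (\<Prod>j<k. Y j x)}"
    proof clarify
      fix x assume "k \<le> 3 * N x"
      then have "(6::real) ^ k \<le> 6 ^ (3 * N x)" by (intro power_increasing) auto
      also have "\<dots> = 216 ^ N x" by (simp add: power_mult)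
      finally have "1 \<le> (1 / 6) ^ k * (216::real) ^ N x" by (simp add: power_divide)
      then have "ennreal 1 \<le> ennreal ((1 / 6) ^ k * 216 ^ N x)" by (rule ennreal_leI)
      also have "\<dots> = ennreal ((1 / 6) ^ k) * (\<Prod>j<k. Y j x)"
        by (simp add: prodY ennreal_mult flip: ennreal_power ennreal_numeral)
      finally show "1 \<le> ennreal ((1 / 6) ^ k) * (\<Prod>j<k. Y j x)" by simp
    qed
    show "{x \<in> space ?P. 1 \<le> ennreal ((1 / 6) ^ k) * (\<Prod>j<k. Y j x)} \<in> sets ?P"
      using Ymeas by (intro measurable_sets_Collect[where P = "\<lambda>y. 1 \<le> ennreal ((1 / 6) ^ k) * y", OF borel_measurable_prod_ennreal]) auto
  qed
  also have "\<dots> \<le> ennreal ((1 / 6) ^ k) * (\<integral>\<^sup>+x. (\<Prod>j<k. Y j x) * indicator (space ?P) x \<partial>?P)"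
    using Ymeas by (intro nn_integral_Markov_inequality borel_measurable_prod_ennreal) auto
  also have "(\<integral>\<^sup>+x. (\<Prod>j<k. Y j x) * indicator (space ?P) x \<partial>?P) = (\<integral>\<^sup>+x. (\<Prod>j<k. Y j x) \<partial>?P)"
    by (intro nn_integral_cong) simp
  also have "ennreal ((1 / 6) ^ k) * \<dots> \<le> ennreal ((1 / 6) ^ k) * 2 ^ k" by (intro mult_left_mono E) simp
  also have "\<dots> = ennreal ((1 / 6) ^ k * 2 ^ k)" by (simp add: ennreal_mult flip: ennreal_power ennreal_numeral)
  also have "(1 / 6) ^ k * 2 ^ k = (1 / 3 :: real) ^ k" by (simp flip: power_mult_distrib)
  finally have "P.prob {x \<in> space ?P. k \<le> 3 * N x} \<le> (1 / 3) ^ k" by (simp add: P.emeasure_eq_measure)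
  then show ?thesis by (simp add: N_def bad_def)
qed

lemma num_groups_bounds:
  assumes "1 < \<beta>"
  shows "3.5 * \<beta> \<le> real (num_groups \<beta>)" "real (num_groups \<beta>) \<le> 4.5 * \<beta>"
proof -
  have f: "0 \<le> \<lfloor>3.5 * \<beta>\<rfloor>" using assms by simp
  have "real (num_groups \<beta>) = real_of_int \<lfloor>3.5 * \<beta>\<rfloor> + 1" using f by (simp add: num_groups_def)
  then show "3.5 * \<beta> \<le> real (num_groups \<beta>)" "real (num_groups \<beta>) \<le> 4.5 * \<beta>"
    using assms floor_correct[of "3.5 * \<beta>"] by linarith+
qed

text \<open>Fewer than a third of the groups are bad except with probability 3^(-k), which is at
  most exp(-3 \<beta>) since k \<ge> 3.5 \<beta>. The event is expressed by group means, so its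
  measurability does not depend on \<open>muhat\<close>.\<close>

theorem mom_concentration:
  assumes \<beta>: "1 < \<beta>" and m: "real (num_groups \<beta>) \<le> real m / 2"
    and G: "is_grouping m \<beta> G" and muhat: "is_mom_estimator d m \<beta> G muhat"
    and \<tau>: "0 < tr (covariance d D)"
  shows "\<exists>A\<in>sets (sample_law m D). 1 - exp (- 3 * \<beta>) \<le> measure (sample_law m D) A \<and>
    (\<forall>x\<in>A. muhat x \<in> carrier_vec d \<and>
      vnorm (muhat x - mean_vec d D) \<le> 180 * sqrt (tr (covariance d D) * \<beta> / real m))"
proof -
  let ?P = "sample_law m D"
  interpret P: prob_space ?P by (rule prob_space_sample)
  define k where "k = num_groups \<beta>"
  define l where "l = m div k"
  define \<tau> where "\<tau> = tr (covariance d D)"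
  have k: "3.5 * \<beta> \<le> real k" "real k \<le> 4.5 * \<beta>" using num_groups_bounds[OF \<beta>] by (auto simp: k_def)
  have k0: "0 < k" using k \<beta> by (cases k) auto
  have "2 * k \<le> m" using m by (simp add: k_def)
  then have l2: "2 \<le> l" using k0 by (simp add: l_def less_eq_div_iff_mult_less_eq)
  \<comment> \<open>Rounding loses at most a factor 2 because \<open>l \<ge> 2\<close>: m \<le> k (l
    + 1) \<le> 4.5 \<beta> * 2 l.\<close>
  have ml: "real m \<le> 9 * \<beta> * real l"
  proof -
    have "m < k * (l + 1)" unfolding l_def using k0 dividend_less_times_div[of k m] by simp
    then have "real m \<le> real k * (real l + 1)"
      by (metis of_nat_1 of_nat_add of_nat_le_iff of_nat_mult less_imp_le)
    also have "\<dots> \<le> (4.5 * \<beta>) * (2 * real l)" using k l2 \<beta> by (intro mult_mono) auto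
    finally show ?thesis by simp
  qed
  \<comment> \<open>Here 1944 = 216 * 9, with 216 from Chebyshev and 9 from the bound on
    \<open>m\<close>. Later 4 sqrt 1944 = sqrt 31104 is rounded up to 180 = sqrt 32400.\<close>
  define \<rho>2 where "\<rho>2 = 1944 * \<tau> * \<beta> / real m"
  have m0: "0 < real m" using \<open>2 * k \<le> m\<close> k0 by simp
  have \<rho>2: "0 < \<rho>2" using \<tau> m0 \<beta> by (simp add: \<rho>2_def \<tau>_def)
  have Gj: "G j \<subseteq> {..<m}" "card (G j) = l" if "j < k" for j
    using G that by (auto simp: is_grouping_def k_def l_def)
  have big: "216 * tr (covariance d D) \<le> \<rho>2 * real (card (G j))" if "j < k" for j
  proof -
    have "216 * \<tau> * real m \<le> 216 * \<tau> * (9 * \<beta> * real l)"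
      using ml \<tau> by (intro mult_left_mono) (auto simp: \<tau>_def)
    then show ?thesis using m0 by (simp add: \<rho>2_def Gj(2)[OF that] \<tau>_def[symmetric] field_simps)
  qed
  define bad where "bad x = card {j \<in> {..<k}. \<rho>2 < (vnorm (group_mean d (G j) x - mean_vec d D))\<^sup>2}" for x
  define B where "B = {x \<in> space ?P. k \<le> 3 * bad x}"
  have pB: "P.prob B \<le> (1 / 3) ^ k"
    unfolding B_def bad_def
  proof (rule prob_many_far_groups[OF _ _ \<rho>2 big])
    show "disjoint_family_on G {..<k}" using G by (simp add: is_grouping_def k_def)
    show "G j \<subseteq> {..<m} \<and> G j \<noteq> {}" if "j < k" for j using Gj[OF that] l2 by auto
  qed
  have Bm: "B \<in> sets ?P"
  proof -
    have "(\<lambda>x. \<Sum>j<k. if \<rho>2 < (vnorm (group_mean d (G j) x - mean_vec d D))\<^sup>2 then 1 else (0::real)) \<in> borel_measurable ?P"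
      using measurable_vnorm_group_mean[of _ m] Gj by (intro borel_measurable_sum measurable_If) auto
    moreover have "(\<Sum>j<k. if \<rho>2 < (vnorm (group_mean d (G j) x - mean_vec d D))\<^sup>2 then 1 else (0::real)) = real (bad x)" for x
      unfolding bad_def by (simp add: sum.If_cases Int_def)
    ultimately have [measurable]: "(\<lambda>x. real (bad x)) \<in> borel_measurable ?P" by simp
    have "B = {x \<in> space ?P. real k \<le> 3 * real (bad x)}" by (auto simp: B_def)
    then show ?thesis by simp
  qed
  have "(1 / 3 :: real) ^ k \<le> exp (- 1) ^ k"
    using exp_le by (intro power_mono) (auto simp: exp_minus field_simps)
  also have "\<dots> = exp (- real k)" by (simp flip: exp_of_nat_mult)
  also have "\<dots> \<le> exp (- 3 * \<beta>)" using k \<beta> by simp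
  finally have "1 - exp (- 3 * \<beta>) \<le> P.prob (space ?P - B)" using pB P.prob_compl[OF Bm] by simp
  moreover have "muhat x \<in> carrier_vec d \<and> vnorm (muhat x - mean_vec d D) \<le> 180 * sqrt (tr (covariance d D) * \<beta> / real m)"
    if x: "x \<in> space ?P - B" for x
  proof -
    have "x \<in> {..<m} \<rightarrow>\<^sub>E carrier_vec d" using x by (auto simp: sample_law_def space_PiM space_D)
    then have am: "is_arg_min (\<lambda>z. \<Sum>j<k. vnorm (z - group_mean d (G j) x)) (\<lambda>z. z \<in> carrier_vec d) (muhat x)"
      using muhat by (auto simp: is_mom_estimator_def k_def)
    then have mc: "muhat x \<in> carrier_vec d" by (simp add: is_arg_min_def)
    have "vnorm (muhat x - mean_vec d D) \<le> 4 * sqrt \<rho>2"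
    proof (rule geometric_median_close[where d = d and k = k and y = "\<lambda>j. group_mean d (G j) x"])
      show "(\<Sum>j<k. vnorm (muhat x - group_mean d (G j) x)) \<le> (\<Sum>j<k. vnorm (mean_vec d D - group_mean d (G j) x))"
        using am by (auto simp: is_arg_min_def not_less)
      have "sqrt \<rho>2 < y \<longleftrightarrow> \<rho>2 < y\<^sup>2" if "0 \<le> y" for y
        using that \<rho>2 by (metis real_sqrt_less_iff real_sqrt_abs abs_of_nonneg)
      then show "3 * card {j \<in> {..<k}. sqrt \<rho>2 < vnorm (group_mean d (G j) x - mean_vec d D)} < k"
        using x by (auto simp: B_def bad_def)
    qed (use mc \<rho>2 in auto)
    also have "4 * sqrt \<rho>2 \<le> 180 * sqrt (tr (covariance d D) * \<beta> / real m)"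
    proof -
      have "4 * sqrt \<rho>2 = sqrt (31104 * (\<tau> * \<beta> / real m))"
        by (simp add: \<rho>2_def real_sqrt_mult[of 16, simplified, symmetric] mult_ac)
      also have "\<dots> \<le> sqrt (32400 * (\<tau> * \<beta> / real m))" using \<rho>2 m0 \<beta> \<tau> by (simp add: \<tau>_def divide_right_mono)
      also have "\<dots> = 180 * sqrt (\<tau> * \<beta> / real m)"
      proof -
        have "sqrt 32400 = (180::real)" by (rule real_sqrt_unique) auto
        then show ?thesis by (simp only: real_sqrt_mult)
      qed
      finally show ?thesis by (simp add: \<tau>_def)
    qed
    finally show ?thesis using mc by simp
  qed
  ultimately show ?thesis using Bm by (intro bexI[of _ "space ?P - B"]) auto
qed


section \<open>Centered and truncated matrices\<close>

text \<open>If \<open>P\<close> lies between 0 and the identity, so does its mean, hence the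
  difference has norm at most 1 rather than 2. Centering removes the first moment and does not
  increase the second. The sign \<open>s\<close> gives both tails.\<close>

lemma centered_random_matrix:
  assumes s: "s = 1 \<or> s = - 1"
    and meas: "\<And>i j. i < d \<Longrightarrow> j < d \<Longrightarrow> (\<lambda>x. P x $$ (i, j)) \<in> borel_measurable D"
    and carr: "\<And>x. x \<in> carrier_vec d \<Longrightarrow> P x \<in> carrier_mat d d"
    and sym: "\<And>x. x \<in> carrier_vec d \<Longrightarrow> transpose_mat (P x) = P x"
    and quad: "\<And>x v. x \<in> carrier_vec d \<Longrightarrow> v \<in> carrier_vec d \<Longrightarrow>
      0 \<le> v \<bullet> (P x *\<^sub>v v) \<and> v \<bullet> (P x *\<^sub>v v) \<le> (vnorm v)\<^sup>2"
    and mom: "\<And>v. v \<in> carrier_vec d \<Longrightarrow> (\<integral>x. (vnorm (P x *\<^sub>v v))\<^sup>2 \<partial>D) \<le> \<rho> * (vnorm v)\<^sup>2" and \<rho>: "0 \<le> \<rho>"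
  shows "bounded_random_matrix D d (\<lambda>x. s \<cdot>\<^sub>m (P x - mat_expectation d D P)) \<rho>"
proof -
  define E where "E = mat_expectation d D P"
  have E: "E \<in> carrier_mat d d" by (simp add: E_def mat_expectation_def)
  have bP: "mat_bound d (P x) 1" if x: "x \<in> carrier_vec d" for x
  proof (rule quad_bounds_mat_bound[OF carr[OF x] sym[OF x]])
    fix v :: "real vec" assume v: "v \<in> carrier_vec d"
    show "- (1 * (vnorm v)\<^sup>2) \<le> v \<bullet> (P x *\<^sub>v v) \<and> v \<bullet> (P x *\<^sub>v v) \<le> 1 * (vnorm v)\<^sup>2"
      using quad[OF x v] zero_le_power2[of "vnorm v"] by linarith
  qed simp
  have int: "integrable D (\<lambda>x. P x $$ (i, j))" if "i < d" "j < d" for i j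
  proof (rule integrable_const_bound[where B = 1])
    show "AE x in D. norm (P x $$ (i, j)) \<le> 1"
      using abs_entry_le[OF bP that] by (intro AE_I2) (auto simp: space_D)
  qed (rule meas[OF that])
  have Esym: "transpose_mat E = E"
  proof (rule eq_matI)
    fix i j assume "i < dim_row E" "j < dim_col E"
    then have ij: "i < d" "j < d" using E by auto
    have "P x $$ (j, i) = P x $$ (i, j)" if "x \<in> carrier_vec d" for x
      using sym[OF that] carr[OF that] ij by (metis carrier_matD index_transpose_mat(1))
    then have "(\<integral>x. P x $$ (j, i) \<partial>D) = (\<integral>x. P x $$ (i, j) \<partial>D)"
      by (intro Bochner_Integration.integral_cong) (auto simp: space_D)
    then show "transpose_mat E $$ (i, j) = E $$ (i, j)" using ij E by (simp add: E_def mat_expectation_def)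
  qed (use E in auto)
  have Eq: "v \<bullet> (E *\<^sub>v v) = (\<integral>x. v \<bullet> (P x *\<^sub>v v) \<partial>D)" "integrable D (\<lambda>x. v \<bullet> (P x *\<^sub>v v))" if "v \<in> carrier_vec d" for v
    unfolding E_def using mat_expectation_quad[OF carr int that] by auto
  have EP: "0 \<le> v \<bullet> (E *\<^sub>v v) \<and> v \<bullet> (E *\<^sub>v v) \<le> (vnorm v)\<^sup>2" if v: "v \<in> carrier_vec d" for v
  proof -
    have "(\<integral>x. v \<bullet> (P x *\<^sub>v v) \<partial>D) \<le> (\<integral>x. (vnorm v)\<^sup>2 \<partial>D)"
      using quad[OF _ v] Eq(2)[OF v] by (intro integral_mono) (auto simp: space_D)
    moreover have "0 \<le> (\<integral>x. v \<bullet> (P x *\<^sub>v v) \<partial>D)" using quad[OF _ v] by (intro integral_nonneg_AE AE_I2) (auto simp: space_D)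
    ultimately show ?thesis using Eq(1)[OF v] by (simp add: prob_space)
  qed
  define F where "F x = s \<cdot>\<^sub>m (P x - E)" for x
  have Fc: "F x \<in> carrier_mat d d" if "x \<in> carrier_vec d" for x
    unfolding F_def using minus_carrier_mat[OF E, of "P x"] by simp
  have Fv: "F x *\<^sub>v v = s \<cdot>\<^sub>v (P x *\<^sub>v v - E *\<^sub>v v)" if "x \<in> carrier_vec d" "v \<in> carrier_vec d" for x v
    unfolding F_def using carr[OF that(1)] E that minus_carrier_mat[OF E, of "P x"]
    by (simp add: smult_mat_mult_vec[of _ d d] minus_mult_distrib_mat_vec[of _ d d])
  have Fq: "v \<bullet> (F x *\<^sub>v v) = s * (v \<bullet> (P x *\<^sub>v v) - v \<bullet> (E *\<^sub>v v))" if "x \<in> carrier_vec d" "v \<in> carrier_vec d" for x v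
    unfolding Fv[OF that] using carr[OF that(1)] E that
      mult_mat_vec_carrier[OF carr[OF that(1)] that(2)] mult_mat_vec_carrier[OF E that(2)]
    by (simp add: scalar_prod_minus_distrib[of _ d])
  have Fsym: "transpose_mat (F x) = F x" if x: "x \<in> carrier_vec d" for x
  proof (rule eq_matI)
    fix i j assume "i < dim_row (F x)" "j < dim_col (F x)"
    then have ij: "i < d" "j < d" using Fc[OF x] by auto
    have "P x $$ (j, i) = P x $$ (i, j)" "E $$ (j, i) = E $$ (i, j)"
      using sym[OF x] carr[OF x] Esym E ij by (metis carrier_matD index_transpose_mat(1))+
    then show "transpose_mat (F x) $$ (i, j) = F x $$ (i, j)" using ij E carr[OF x] by (simp add: F_def)
  qed (use Fc[OF x] in auto)
  have "bounded_random_matrix D d F \<rho>"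
  proof (unfold_locales)
    fix i j assume ij: "i < d" "j < d"
    have "F x $$ (i, j) = s * (P x $$ (i, j) - E $$ (i, j))" if "x \<in> space D" for x
      using ij E carr[of x] that by (simp add: F_def space_D)
    then show "(\<lambda>x. F x $$ (i, j)) \<in> borel_measurable D"
      using meas[OF ij] by (subst measurable_cong[of _ _ "\<lambda>x. s * (P x $$ (i, j) - E $$ (i, j))"]) auto
  next
    fix x assume "x \<in> space D"
    then have x: "x \<in> carrier_vec d" by (simp add: space_D)
    show "mat_bound d (F x) 1"
    proof (rule quad_bounds_mat_bound[OF Fc[OF x] Fsym[OF x]])
      fix v :: "real vec" assume v: "v \<in> carrier_vec d"
      show "- (1 * (vnorm v)\<^sup>2) \<le> v \<bullet> (F x *\<^sub>v v) \<and> v \<bullet> (F x *\<^sub>v v) \<le> 1 * (vnorm v)\<^sup>2"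
        using s quad[OF x v] EP[OF v] unfolding Fq[OF x v] by auto
    qed simp
    show "transpose_mat (F x) = F x" by (rule Fsym[OF x])
  next
    fix v :: "real vec" assume v: "v \<in> carrier_vec d"
    have Pi: "integrable D (\<lambda>x. (P x *\<^sub>v v) $ i)" "(E *\<^sub>v v) $ i = (\<integral>x. (P x *\<^sub>v v) $ i \<partial>D)"
      "integrable D (\<lambda>x. ((P x *\<^sub>v v) $ i)\<^sup>2)" if i: "i < d" for i
    proof -
      have c: "(P x *\<^sub>v v) $ i = (\<Sum>j<d. P x $$ (i, j) * v $ j)" if "x \<in> carrier_vec d" for x
        using carr[OF that] v i by (simp add: scalar_prod_def lessThan_atLeast0)
      have ii: "integrable D (\<lambda>x. (\<Sum>j<d. P x $$ (i, j) * v $ j))"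
        using int[OF i] by (intro Bochner_Integration.integrable_sum) auto
      then show 1: "integrable D (\<lambda>x. (P x *\<^sub>v v) $ i)"
        by (subst Bochner_Integration.integrable_cong[OF refl, of _ _ "\<lambda>x. (\<Sum>j<d. P x $$ (i, j) * v $ j)"]) (auto simp: space_D c)
      have "(\<integral>x. (P x *\<^sub>v v) $ i \<partial>D) = (\<integral>x. (\<Sum>j<d. P x $$ (i, j) * v $ j) \<partial>D)"
        by (intro Bochner_Integration.integral_cong) (auto simp: space_D c)
      also have "\<dots> = (\<Sum>j<d. (\<integral>x. P x $$ (i, j) \<partial>D) * v $ j)"
        using int[OF i] by (subst Bochner_Integration.integral_sum) auto
      also have "\<dots> = (E *\<^sub>v v) $ i"
        using E v i by (simp add: scalar_prod_def lessThan_atLeast0 E_def mat_expectation_def)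
      finally show "(E *\<^sub>v v) $ i = (\<integral>x. (P x *\<^sub>v v) $ i \<partial>D)" by simp
      show "integrable D (\<lambda>x. ((P x *\<^sub>v v) $ i)\<^sup>2)"
      proof (rule integrable_const_bound[where B = "(vnorm v)\<^sup>2"])
        show "AE x in D. norm (((P x *\<^sub>v v) $ i)\<^sup>2) \<le> (vnorm v)\<^sup>2"
        proof (rule AE_I2)
          fix x assume "x \<in> space D"
          then have x: "x \<in> carrier_vec d" by (simp add: space_D)
          have "\<bar>(P x *\<^sub>v v) $ i\<bar> \<le> vnorm (P x *\<^sub>v v)"
            by (rule abs_index_le_vnorm[of _ d]) (use carr[OF x] v i in auto)
          also have "\<dots> \<le> vnorm v" using mat_boundD(2)[OF bP[OF x] v] by simp
          finally show "norm (((P x *\<^sub>v v) $ i)\<^sup>2) \<le> (vnorm v)\<^sup>2"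
            using power_mono[of "\<bar>(P x *\<^sub>v v) $ i\<bar>" "vnorm v" 2] by simp
        qed
      qed (use 1 in measurable)
    qed
    have F2: "(vnorm (F x *\<^sub>v v))\<^sup>2 = (\<Sum>i<d. ((P x *\<^sub>v v) $ i - (E *\<^sub>v v) $ i)\<^sup>2)" if "x \<in> space D" for x
    proof -
      have x: "x \<in> carrier_vec d" using that by (simp add: space_D)
      have "(vnorm (F x *\<^sub>v v))\<^sup>2 = (vnorm (P x *\<^sub>v v - E *\<^sub>v v))\<^sup>2" using s Fv[OF x v] by auto
      then show ?thesis
        using carr[OF x] E v by (subst (asm) vnorm_sq_sum[of _ d]) (auto simp del: index_mult_mat_vec)
    qed
    have int_sq: "integrable D (\<lambda>x. ((P x *\<^sub>v v) $ i - (E *\<^sub>v v) $ i)\<^sup>2)" if "i < d" for i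
    proof -
      have "integrable D (\<lambda>x. ((P x *\<^sub>v v) $ i)\<^sup>2 - 2 * (E *\<^sub>v v) $ i * (P x *\<^sub>v v) $ i + ((E *\<^sub>v v) $ i)\<^sup>2)"
        using Pi[OF that] by simp
      then show ?thesis by (simp add: power2_eq_square algebra_simps)
    qed
    have "(\<integral>x. v \<bullet> (F x *\<^sub>v v) + (vnorm (F x *\<^sub>v v))\<^sup>2 \<partial>D)
        = (\<integral>x. s * (v \<bullet> (P x *\<^sub>v v) - v \<bullet> (E *\<^sub>v v)) + (\<Sum>i<d. ((P x *\<^sub>v v) $ i - (E *\<^sub>v v) $ i)\<^sup>2) \<partial>D)"
      by (intro Bochner_Integration.integral_cong) (auto simp: F2 Fq[OF _ v] space_D)
    also have "\<dots> = (\<integral>x. s * (v \<bullet> (P x *\<^sub>v v) - v \<bullet> (E *\<^sub>v v)) \<partial>D) + (\<integral>x. (\<Sum>i<d. ((P x *\<^sub>v v) $ i - (E *\<^sub>v v) $ i)\<^sup>2) \<partial>D)"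
      using Eq(2)[OF v] int_sq by (intro Bochner_Integration.integral_add Bochner_Integration.integrable_sum) auto
    also have "(\<integral>x. s * (v \<bullet> (P x *\<^sub>v v) - v \<bullet> (E *\<^sub>v v)) \<partial>D) = 0"
      using Eq[OF v] by (simp add: prob_space)
    also have "(\<integral>x. (\<Sum>i<d. ((P x *\<^sub>v v) $ i - (E *\<^sub>v v) $ i)\<^sup>2) \<partial>D) = (\<Sum>i<d. \<integral>x. ((P x *\<^sub>v v) $ i - (E *\<^sub>v v) $ i)\<^sup>2 \<partial>D)"
      using int_sq by (intro Bochner_Integration.integral_sum) auto
    \<comment> \<open>Coordinatewise: a variance is at most the second moment.\<close>
    also have "\<dots> \<le> (\<Sum>i<d. \<integral>x. ((P x *\<^sub>v v) $ i)\<^sup>2 \<partial>D)"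
    proof (rule sum_mono)
      fix i assume "i \<in> {..<d}"
      then have i: "i < d" by simp
      show "(\<integral>x. ((P x *\<^sub>v v) $ i - (E *\<^sub>v v) $ i)\<^sup>2 \<partial>D) \<le> (\<integral>x. ((P x *\<^sub>v v) $ i)\<^sup>2 \<partial>D)"
        using variance_eq[OF Pi(1)[OF i] Pi(3)[OF i]] by (simp add: Pi(2)[OF i])
    qed
    also have "\<dots> = (\<integral>x. (\<Sum>i<d. ((P x *\<^sub>v v) $ i)\<^sup>2) \<partial>D)"
      using Pi(3) by (intro Bochner_Integration.integral_sum[symmetric]) auto
    also have "\<dots> = (\<integral>x. (vnorm (P x *\<^sub>v v))\<^sup>2 \<partial>D)"
    proof (intro Bochner_Integration.integral_cong refl)
      fix x assume "x \<in> space D"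
      then have "P x *\<^sub>v v \<in> carrier_vec d" using carr v by (auto simp: space_D intro: mult_mat_vec_carrier)
      then show "(\<Sum>i<d. ((P x *\<^sub>v v) $ i)\<^sup>2) = (vnorm (P x *\<^sub>v v))\<^sup>2" by (simp only: vnorm_sq_sum)
    qed
    also have "\<dots> \<le> \<rho> * (vnorm v)\<^sup>2" by (rule mom[OF v])
    finally show "(\<integral>x. v \<bullet> (F x *\<^sub>v v) + (vnorm (F x *\<^sub>v v))\<^sup>2 \<partial>D) \<le> \<rho> * (vnorm v)\<^sup>2" by simp
  qed (rule \<rho>)
  then show ?thesis by (simp add: F_def[abs_def] E_def)
qed

section \<open>Deviation and bias of the vectors clipped around the true mean\<close>

lemma measurable_clip_index:
  assumes "i < d"
  shows "(\<lambda>x. clip \<theta> (Z x) $ i) \<in> borel_measurable D"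
proof -
  have "(\<lambda>x. if \<theta> * (vnorm (Z x))\<^sup>2 \<le> 1 then Z x $ i else 1 / (sqrt \<theta> * vnorm (Z x)) * Z x $ i) \<in> borel_measurable D"
    using assms by measurable
  moreover have "clip \<theta> (Z x) $ i = (if \<theta> * (vnorm (Z x))\<^sup>2 \<le> 1 then Z x $ i else 1 / (sqrt \<theta> * vnorm (Z x)) * Z x $ i)" for x
    using assms by (simp add: clip_def)
  ultimately show ?thesis by simp
qed

lemma clip_outer_facts:
  assumes \<theta>: "0 < \<theta>" and x: "x \<in> carrier_vec d" and v: "v \<in> carrier_vec d"
  shows "v \<bullet> (\<theta> \<cdot>\<^sub>m outer (clip \<theta> (Z x)) *\<^sub>v v) = \<theta> * (clip \<theta> (Z x) \<bullet> v)\<^sup>2"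
    and "\<theta> * (clip \<theta> (Z x) \<bullet> v)\<^sup>2 \<le> (vnorm v)\<^sup>2"
    and "(vnorm (\<theta> \<cdot>\<^sub>m outer (clip \<theta> (Z x)) *\<^sub>v v))\<^sup>2 \<le> \<theta>\<^sup>2 * ((vnorm (Z x))\<^sup>2 * (Z x \<bullet> v)\<^sup>2)"
proof -
  define c where "c = clip \<theta> (Z x)"
  have c: "c \<in> carrier_vec d" using x by (simp add: c_def)
  have ov: "outer c *\<^sub>v v = (c \<bullet> v) \<cdot>\<^sub>v c"
    using c v by (intro eq_vecI) (auto simp: outer_def scalar_prod_def sum_distrib_left sum_distrib_right mult_ac)
  have e: "\<theta> \<cdot>\<^sub>m outer c *\<^sub>v v = (\<theta> * (c \<bullet> v)) \<cdot>\<^sub>v c"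
    using c v by (simp add: smult_mat_mult_vec[of _ d d] ov smult_smult_assoc)
  show "v \<bullet> (\<theta> \<cdot>\<^sub>m outer (clip \<theta> (Z x)) *\<^sub>v v) = \<theta> * (clip \<theta> (Z x) \<bullet> v)\<^sup>2"
    unfolding c_def[symmetric] e using c v comm_scalar_prod[OF c v] by (simp add: power2_eq_square)
  have "\<theta> * (c \<bullet> v)\<^sup>2 \<le> (\<theta> * (vnorm c)\<^sup>2) * (vnorm v)\<^sup>2"
    using scalar_prod_sq_le[OF c v] \<theta> by (simp add: mult.assoc)
  also have "\<dots> \<le> 1 * (vnorm v)\<^sup>2" using vnorm_clip_le(1)[OF \<theta>] by (intro mult_right_mono) (auto simp: c_def)
  finally show "\<theta> * (clip \<theta> (Z x) \<bullet> v)\<^sup>2 \<le> (vnorm v)\<^sup>2" by (simp add: c_def)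
  have "(vnorm c)\<^sup>2 * (c \<bullet> v)\<^sup>2 \<le> (vnorm (Z x))\<^sup>2 * (Z x \<bullet> v)\<^sup>2"
    unfolding c_def using vnorm_clip_le(2)[OF \<theta>] clip_scalar_prod_sq_le[OF \<theta> Z_carrier[OF x] v]
    by (intro mult_mono[OF power_mono]) auto
  then show "(vnorm (\<theta> \<cdot>\<^sub>m outer (clip \<theta> (Z x)) *\<^sub>v v))\<^sup>2 \<le> \<theta>\<^sup>2 * ((vnorm (Z x))\<^sup>2 * (Z x \<bullet> v)\<^sup>2)"
    unfolding c_def[symmetric] e using \<theta> by (simp add: power_mult_distrib abs_mult mult_ac)
qed

lemma integrable_clip_sq:
  assumes \<theta>: "0 < \<theta>" and v: "v \<in> carrier_vec d"
  shows "integrable D (\<lambda>x. (clip \<theta> (Z x) \<bullet> v)\<^sup>2)"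
proof (rule Bochner_Integration.integrable_bound[OF integrable_Z_prod(2)[OF v]])
  have "(\<lambda>x. clip \<theta> (Z x) \<bullet> v) \<in> borel_measurable D"
    using measurable_clip_index v by (intro measurable_scalar_prod) auto
  then show "(\<lambda>x. (clip \<theta> (Z x) \<bullet> v)\<^sup>2) \<in> borel_measurable D" by measurable
  show "AE x in D. norm ((clip \<theta> (Z x) \<bullet> v)\<^sup>2) \<le> norm ((Z x \<bullet> v)\<^sup>2)"
    using clip_scalar_prod_sq_le[OF \<theta> Z_carrier v] by (intro AE_I2) (auto simp: space_D)
qed

text \<open>The matrix tail bound for the centered clipped outer products, whose second moment is at
  most \<open>\<theta>\<^sup>2 * (sigma0 d D)\<^sup>2\<close>. Division by m \<theta> will give the
  error \<theta> \<open>sigma0\<close>^2 + b / (m \<theta>).\<close>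

lemma truncated_covariance_tail:
  assumes \<theta>: "0 < \<theta>" and b: "0 \<le> b" and s: "s = 1 \<or> s = - 1"
  shows "\<exists>A\<in>sets (sample_law m D). 1 - real d * exp (- b) \<le> measure (sample_law m D) A \<and>
    (\<forall>x\<in>A. \<forall>v\<in>carrier_vec d.
      (\<Sum>k<m. s * (\<theta> * (clip \<theta> (Z (x k)) \<bullet> v)\<^sup>2 - \<theta> * (\<integral>x. (clip \<theta> (Z x) \<bullet> v)\<^sup>2 \<partial>D)))
        \<le> (real m * (\<theta>\<^sup>2 * (sigma0 d D)\<^sup>2) + b) * (vnorm v)\<^sup>2)"
proof -
  define P where "P x = \<theta> \<cdot>\<^sub>m outer (clip \<theta> (Z x))" for x
  define E where "E = mat_expectation d D P"
  have E: "E \<in> carrier_mat d d" by (simp add: E_def mat_expectation_def)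
  have Pc: "P x \<in> carrier_mat d d" if "x \<in> carrier_vec d" for x
    using that by (simp add: P_def)
  have Pi: "P x $$ (i, j) = \<theta> * (clip \<theta> (Z x) $ i * clip \<theta> (Z x) $ j)"
    if "x \<in> carrier_vec d" "i < d" "j < d" for x i j
    using that carrier_matD[OF outer_carrier[OF clip_carrier[OF Z_carrier[OF that(1)]], of \<theta>]]
    by (simp add: P_def outer_index[of _ d])
  have Pq: "v \<bullet> (P x *\<^sub>v v) = \<theta> * (clip \<theta> (Z x) \<bullet> v)\<^sup>2" if "x \<in> carrier_vec d" "v \<in> carrier_vec d" for x v
    unfolding P_def by (rule clip_outer_facts(1)[OF \<theta> that])
  have meas: "(\<lambda>x. P x $$ (i, j)) \<in> borel_measurable D" if "i < d" "j < d" for i j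
    using that measurable_clip_index Pi
    by (subst measurable_cong[of _ _ "\<lambda>x. \<theta> * (clip \<theta> (Z x) $ i * clip \<theta> (Z x) $ j)"]) (auto simp: space_D)
  interpret B: bounded_random_matrix D d "\<lambda>x. s \<cdot>\<^sub>m (P x - mat_expectation d D P)" "\<theta>\<^sup>2 * (sigma0 d D)\<^sup>2"
  proof (rule centered_random_matrix[OF s meas Pc])
    show "transpose_mat (P x) = P x" if x: "x \<in> carrier_vec d" for x
      using carrier_matD[OF Pc[OF x]] Pi[OF x] by (intro eq_matI) auto
    show "0 \<le> v \<bullet> (P x *\<^sub>v v) \<and> v \<bullet> (P x *\<^sub>v v) \<le> (vnorm v)\<^sup>2" if "x \<in> carrier_vec d" "v \<in> carrier_vec d" for x v
      using clip_outer_facts(2)[OF \<theta> that] \<theta> by (simp add: Pq[OF that])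
    fix v :: "real vec" assume v: "v \<in> carrier_vec d"
    have "(\<integral>x. (vnorm (P x *\<^sub>v v))\<^sup>2 \<partial>D) \<le> (\<integral>x. \<theta>\<^sup>2 * ((vnorm (Z x))\<^sup>2 * (Z x \<bullet> v)\<^sup>2) \<partial>D)"
    proof (rule integral_mono')
      show "integrable D (\<lambda>x. \<theta>\<^sup>2 * ((vnorm (Z x))\<^sup>2 * (Z x \<bullet> v)\<^sup>2))" using integrable_Z_prod[OF v] by simp
      show "(vnorm (P x *\<^sub>v v))\<^sup>2 \<le> \<theta>\<^sup>2 * ((vnorm (Z x))\<^sup>2 * (Z x \<bullet> v)\<^sup>2)" if "x \<in> space D" for x
        unfolding P_def using that by (intro clip_outer_facts(3)[OF \<theta> _ v]) (simp add: space_D)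
    qed simp
    also have "\<dots> \<le> \<theta>\<^sup>2 * ((sigma0 d D)\<^sup>2 * (vnorm v)\<^sup>2)" using moment4_le[OF v] by (simp add: mult_left_mono)
    finally show "(\<integral>x. (vnorm (P x *\<^sub>v v))\<^sup>2 \<partial>D) \<le> \<theta>\<^sup>2 * (sigma0 d D)\<^sup>2 * (vnorm v)\<^sup>2" by (simp add: mult.assoc)
  qed simp_all
  have int: "integrable D (\<lambda>x. P x $$ (i, j))" if "i < d" "j < d" for i j
  proof (rule integrable_const_bound[where B = 1])
    show "AE x in D. norm (P x $$ (i, j)) \<le> 1"
    proof (rule AE_I2)
      fix x assume "x \<in> space D"
      then have x: "x \<in> carrier_vec d" by (simp add: space_D)
      define c where "c = clip \<theta> (Z x)"
      have c: "c \<in> carrier_vec d" using x by (simp add: c_def)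
      have "\<bar>c $ i\<bar> * \<bar>c $ j\<bar> \<le> vnorm c * vnorm c"
        using that c by (intro mult_mono abs_index_le_vnorm[of _ d]) auto
      then have "\<theta> * (\<bar>c $ i\<bar> * \<bar>c $ j\<bar>) \<le> \<theta> * (vnorm c)\<^sup>2" using \<theta> by (simp add: power2_eq_square)
      also have "\<dots> \<le> 1" unfolding c_def by (rule vnorm_clip_le(1)[OF \<theta>])
      finally show "norm (P x $$ (i, j)) \<le> 1" using \<theta> by (simp add: Pi[OF x that] c_def abs_mult)
    qed
  qed (rule meas[OF that])
  have quad: "v \<bullet> ((s \<cdot>\<^sub>m (P x - mat_expectation d D P)) *\<^sub>v v)
      = s * (\<theta> * (clip \<theta> (Z x) \<bullet> v)\<^sup>2 - \<theta> * (\<integral>x. (clip \<theta> (Z x) \<bullet> v)\<^sup>2 \<partial>D))"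
    if x: "x \<in> carrier_vec d" and v: "v \<in> carrier_vec d" for x v
  proof -
    have "v \<bullet> (E *\<^sub>v v) = (\<integral>x. v \<bullet> (P x *\<^sub>v v) \<partial>D)"
      unfolding E_def by (rule mat_expectation_quad(1)[OF Pc int v])
    also have "\<dots> = (\<integral>x. \<theta> * (clip \<theta> (Z x) \<bullet> v)\<^sup>2 \<partial>D)"
      by (intro Bochner_Integration.integral_cong) (auto simp: space_D Pq[OF _ v])
    finally have e: "v \<bullet> (E *\<^sub>v v) = \<theta> * (\<integral>x. (clip \<theta> (Z x) \<bullet> v)\<^sup>2 \<partial>D)" by simp
    show ?thesis
      unfolding E_def[symmetric] e[symmetric] Pq[OF x v, symmetric]
      using Pc[OF x] E v minus_carrier_mat[OF E, of "P x"] mult_mat_vec_carrier[OF Pc[OF x] v] mult_mat_vec_carrier[OF E v]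
      by (simp add: smult_mat_mult_vec[of _ d d] minus_mult_distrib_mat_vec[of _ d d] scalar_prod_minus_distrib[of _ d])
  qed
  obtain A where A: "A \<in> sets (sample_law m D)" "1 - real d * exp (- b) \<le> measure (sample_law m D) A"
    and q: "\<And>x v. x \<in> A \<Longrightarrow> v \<in> carrier_vec d \<Longrightarrow>
      (\<Sum>k<m. v \<bullet> ((s \<cdot>\<^sub>m (P (x k) - mat_expectation d D P)) *\<^sub>v v)) \<le> (real m * (\<theta>\<^sup>2 * (sigma0 d D)\<^sup>2) + b) * (vnorm v)\<^sup>2"
    using B.matrix_tail[OF b, of m] unfolding sample_law_def by blast
  show ?thesis
  proof (intro bexI[OF _ A(1)] conjI A(2) ballI)
    fix x and v :: "real vec" assume x: "x \<in> A" and v: "v \<in> carrier_vec d"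
    have "x \<in> space (sample_law m D)" using A(1) x sets.sets_into_space by blast
    then have "x k \<in> carrier_vec d" if "k < m" for k using sample_carrier that by blast
    then show "(\<Sum>k<m. s * (\<theta> * (clip \<theta> (Z (x k)) \<bullet> v)\<^sup>2 - \<theta> * (\<integral>x. (clip \<theta> (Z x) \<bullet> v)\<^sup>2 \<partial>D)))
        \<le> (real m * (\<theta>\<^sup>2 * (sigma0 d D)\<^sup>2) + b) * (vnorm v)\<^sup>2"
      using q[OF x v] quad[OF _ v] by simp
  qed
qed

text \<open>With \<open>y = \<theta> \<parallel>z\<parallel>\<^sup>2\<close>, clipping multiplies \<open>\<langle>z, v\<rangle>\<^sup>2\<close> by \<open>min 1 (1 / y)\<close>, and \<open>1 - 1 / y \<le> y / 4\<close>.\<close>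

lemma clip_bias:
  assumes \<theta>: "0 < \<theta>" and v: "v \<in> carrier_vec d"
  shows "(\<integral>x. (clip \<theta> (Z x) \<bullet> v)\<^sup>2 \<partial>D) \<le> v \<bullet> (covariance d D *\<^sub>v v)"
    and "v \<bullet> (covariance d D *\<^sub>v v) - (\<integral>x. (clip \<theta> (Z x) \<bullet> v)\<^sup>2 \<partial>D) \<le> \<theta> * (sigma0 d D)\<^sup>2 / 4 * (vnorm v)\<^sup>2"
proof -
  note i1 = integrable_Z_prod(2)[OF v] and i2 = integrable_clip_sq[OF \<theta> v]
  show "(\<integral>x. (clip \<theta> (Z x) \<bullet> v)\<^sup>2 \<partial>D) \<le> v \<bullet> (covariance d D *\<^sub>v v)"
    unfolding covariance_quad[OF v] using clip_scalar_prod_sq_le[OF \<theta> Z_carrier v]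
    by (intro integral_mono i1 i2) (auto simp: space_D)
  have pt: "(Z x \<bullet> v)\<^sup>2 - (clip \<theta> (Z x) \<bullet> v)\<^sup>2 \<le> \<theta> / 4 * ((vnorm (Z x))\<^sup>2 * (Z x \<bullet> v)\<^sup>2)" if x: "x \<in> carrier_vec d" for x
  proof (cases "\<theta> * (vnorm (Z x))\<^sup>2 \<le> 1")
    case True
    then show ?thesis using \<theta> by (simp add: clip_def)
  next
    case False
    define y where "y = \<theta> * (vnorm (Z x))\<^sup>2"
    have y: "1 < y" using False by (simp add: y_def)
    have "clip \<theta> (Z x) \<bullet> v = (Z x \<bullet> v) / (sqrt \<theta> * vnorm (Z x))"
      using False x v by (simp add: clip_def)
    then have c: "(clip \<theta> (Z x) \<bullet> v)\<^sup>2 = (Z x \<bullet> v)\<^sup>2 * (1 / y)"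
      using \<theta> by (simp add: power_divide power_mult_distrib y_def)
    have "0 \<le> (y - 2)\<^sup>2" by simp
    then have "1 - 1 / y \<le> y / 4" using y by (simp add: field_simps power2_eq_square)
    from mult_left_mono[OF this, of "(Z x \<bullet> v)\<^sup>2"]
    show ?thesis unfolding c by (simp add: y_def algebra_simps)
  qed
  have "v \<bullet> (covariance d D *\<^sub>v v) - (\<integral>x. (clip \<theta> (Z x) \<bullet> v)\<^sup>2 \<partial>D)
      = (\<integral>x. (Z x \<bullet> v)\<^sup>2 - (clip \<theta> (Z x) \<bullet> v)\<^sup>2 \<partial>D)"
    using i1 i2 by (simp add: covariance_quad[OF v])
  also have "\<dots> \<le> (\<integral>x. \<theta> / 4 * ((vnorm (Z x))\<^sup>2 * (Z x \<bullet> v)\<^sup>2) \<partial>D)"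
    using i1 i2 integrable_Z_prod(4)[OF v] pt by (intro integral_mono) (auto simp: space_D)
  also have "\<dots> = \<theta> / 4 * (\<integral>x. (vnorm (Z x))\<^sup>2 * (Z x \<bullet> v)\<^sup>2 \<partial>D)" by (rule integral_mult_right_zero)
  also have "\<dots> \<le> \<theta> / 4 * ((sigma0 d D)\<^sup>2 * (vnorm v)\<^sup>2)" using moment4_le[OF v] \<theta> by (intro mult_left_mono) auto
  finally show "v \<bullet> (covariance d D *\<^sub>v v) - (\<integral>x. (clip \<theta> (Z x) \<bullet> v)\<^sup>2 \<partial>D) \<le> \<theta> * (sigma0 d D)\<^sup>2 / 4 * (vnorm v)\<^sup>2"
    by (simp add: mult_ac)
qed


text \<open>Beyond half the truncation radius. All other points remain untruncated under a shift of
  at most half that radius.\<close>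

definition far :: "real \<Rightarrow> real vec \<Rightarrow> bool" where
  "far \<theta> x \<longleftrightarrow> 1 \<le> 4 * \<theta> * (vnorm (Z x))\<^sup>2"

lemma measurable_far [measurable]: "Measurable.pred D (far \<theta>)"
  unfolding far_def[abs_def] by measurable

text \<open>Only an upper bound on positive matrices is wanted, so no centering occurs. On far
  points 1 \<le> 4 \<theta> |Z|^2 converts the first moment into 4 times the fourth-moment bound;
  the second moment adds 1, whence the 5.\<close>

lemma far_points_tail:
  assumes \<theta>: "0 < \<theta>" and b: "0 \<le> b"
  shows "\<exists>A\<in>sets (sample_law m D). 1 - real d * exp (- b) \<le> measure (sample_law m D) A \<and>
    (\<forall>x\<in>A. \<forall>v\<in>carrier_vec d. (\<Sum>k<m. if far \<theta> (x k) then \<theta> * (clip \<theta> (Z (x k)) \<bullet> v)\<^sup>2 else 0)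
        \<le> (real m * (5 * \<theta>\<^sup>2 * (sigma0 d D)\<^sup>2) + b) * (vnorm v)\<^sup>2)"
proof -
  define F where "F x = (if far \<theta> x then \<theta> else 0) \<cdot>\<^sub>m outer (clip \<theta> (Z x))" for x
  have Fc: "F x \<in> carrier_mat d d" if "x \<in> carrier_vec d" for x
    using that by (simp add: F_def)
  have Fi: "F x $$ (i, j) = (if far \<theta> x then \<theta> else 0) * (clip \<theta> (Z x) $ i * clip \<theta> (Z x) $ j)"
    if "x \<in> carrier_vec d" "i < d" "j < d" for x i j
    using that carrier_matD[OF outer_carrier[OF clip_carrier[OF Z_carrier[OF that(1)]], of \<theta>]]
    by (simp add: F_def outer_index[of _ d])
  have zero: "0 \<cdot>\<^sub>m outer (clip \<theta> (Z x)) *\<^sub>v v = 0\<^sub>v d" if "x \<in> carrier_vec d" "v \<in> carrier_vec d" for x v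
  proof -
    have "outer (clip \<theta> (Z x)) \<in> carrier_mat d d" using that by simp
    moreover have "0 \<cdot>\<^sub>v w = 0\<^sub>v d" if "w \<in> carrier_vec d" for w :: "real vec"
      using that by (intro eq_vecI) auto
    ultimately show ?thesis
      using smult_mat_mult_vec[of "outer (clip \<theta> (Z x))" d d v 0] mult_mat_vec_carrier[of _ d d v] that(2) by simp
  qed
  have Fq: "v \<bullet> (F x *\<^sub>v v) = (if far \<theta> x then \<theta> * (clip \<theta> (Z x) \<bullet> v)\<^sup>2 else 0)"
    if "x \<in> carrier_vec d" "v \<in> carrier_vec d" for x v
    unfolding F_def using clip_outer_facts(1)[OF \<theta> that] zero[OF that] that by simp
  have Fn: "(vnorm (F x *\<^sub>v v))\<^sup>2 \<le> \<theta>\<^sup>2 * ((vnorm (Z x))\<^sup>2 * (Z x \<bullet> v)\<^sup>2)"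
    if "x \<in> carrier_vec d" "v \<in> carrier_vec d" for x v
    unfolding F_def using clip_outer_facts(3)[OF \<theta> that] zero[OF that] by simp
  interpret B: bounded_random_matrix D d F "5 * \<theta>\<^sup>2 * (sigma0 d D)\<^sup>2"
  proof (unfold_locales)
    show "(\<lambda>x. F x $$ (i, j)) \<in> borel_measurable D" if "i < d" "j < d" for i j
    proof -
      have [measurable]: "(\<lambda>x. clip \<theta> (Z x) $ i) \<in> borel_measurable D" "(\<lambda>x. clip \<theta> (Z x) $ j) \<in> borel_measurable D"
        using that measurable_clip_index by auto
      have "(\<lambda>x. (if far \<theta> x then \<theta> else 0) * (clip \<theta> (Z x) $ i * clip \<theta> (Z x) $ j)) \<in> borel_measurable D"
        by measurable
      then show ?thesis
        using Fi[OF _ that] by (subst measurable_cong) (auto simp: space_D)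
    qed
  next
    fix x assume "x \<in> space D"
    then have x: "x \<in> carrier_vec d" by (simp add: space_D)
    show sym: "transpose_mat (F x) = F x"
      using carrier_matD[OF Fc[OF x]] Fi[OF x] by (intro eq_matI) auto
    show "mat_bound d (F x) 1"
    proof (rule quad_bounds_mat_bound[OF Fc[OF x] sym])
      fix v :: "real vec" assume v: "v \<in> carrier_vec d"
      have "0 \<le> \<theta> * (clip \<theta> (Z x) \<bullet> v)\<^sup>2" using \<theta> by simp
      then show "- (1 * (vnorm v)\<^sup>2) \<le> v \<bullet> (F x *\<^sub>v v) \<and> v \<bullet> (F x *\<^sub>v v) \<le> 1 * (vnorm v)\<^sup>2"
        unfolding Fq[OF x v] using clip_outer_facts(2)[OF \<theta> x v] zero_le_power2[of "vnorm v"]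
        by (cases "far \<theta> x") ((simp | linarith)+)
    qed simp
  next
    fix v :: "real vec" assume v: "v \<in> carrier_vec d"
    have pt: "v \<bullet> (F x *\<^sub>v v) + (vnorm (F x *\<^sub>v v))\<^sup>2 \<le> 5 * \<theta>\<^sup>2 * ((vnorm (Z x))\<^sup>2 * (Z x \<bullet> v)\<^sup>2)"
      if x: "x \<in> carrier_vec d" for x
    proof -
      have "(if far \<theta> x then \<theta> * (clip \<theta> (Z x) \<bullet> v)\<^sup>2 else 0) \<le> 4 * \<theta>\<^sup>2 * ((vnorm (Z x))\<^sup>2 * (Z x \<bullet> v)\<^sup>2)"
      proof (cases "far \<theta> x")
        case True
        have "\<theta> * (clip \<theta> (Z x) \<bullet> v)\<^sup>2 \<le> \<theta> * (Z x \<bullet> v)\<^sup>2"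
          using clip_scalar_prod_sq_le[OF \<theta> Z_carrier[OF x] v] \<theta> by simp
        also have "\<dots> \<le> (\<theta> * (Z x \<bullet> v)\<^sup>2) * (4 * \<theta> * (vnorm (Z x))\<^sup>2)"
          using True \<theta> mult_left_mono[of 1 "4 * \<theta> * (vnorm (Z x))\<^sup>2" "\<theta> * (Z x \<bullet> v)\<^sup>2"] by (simp add: far_def)
        finally show ?thesis using True by (simp add: power2_eq_square mult_ac)
      qed simp
      then show ?thesis using Fn[OF x v] unfolding Fq[OF x v] by linarith
    qed
    have "(\<integral>x. v \<bullet> (F x *\<^sub>v v) + (vnorm (F x *\<^sub>v v))\<^sup>2 \<partial>D)
        \<le> (\<integral>x. 5 * \<theta>\<^sup>2 * ((vnorm (Z x))\<^sup>2 * (Z x \<bullet> v)\<^sup>2) \<partial>D)"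
    proof (rule integral_mono')
      show "integrable D (\<lambda>x. 5 * \<theta>\<^sup>2 * ((vnorm (Z x))\<^sup>2 * (Z x \<bullet> v)\<^sup>2))" using integrable_Z_prod(4)[OF v] by simp
    qed (use pt in \<open>auto simp: space_D\<close>)
    also have "\<dots> \<le> 5 * \<theta>\<^sup>2 * ((sigma0 d D)\<^sup>2 * (vnorm v)\<^sup>2)" using moment4_le[OF v] by (simp add: mult_left_mono)
    finally show "(\<integral>x. v \<bullet> (F x *\<^sub>v v) + (vnorm (F x *\<^sub>v v))\<^sup>2 \<partial>D) \<le> 5 * \<theta>\<^sup>2 * (sigma0 d D)\<^sup>2 * (vnorm v)\<^sup>2"
      by (simp add: mult.assoc)
  qed simp
  obtain A where A: "A \<in> sets (sample_law m D)" "1 - real d * exp (- b) \<le> measure (sample_law m D) A"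
    and q: "\<And>x v. x \<in> A \<Longrightarrow> v \<in> carrier_vec d \<Longrightarrow>
      (\<Sum>k<m. v \<bullet> (F (x k) *\<^sub>v v)) \<le> (real m * (5 * \<theta>\<^sup>2 * (sigma0 d D)\<^sup>2) + b) * (vnorm v)\<^sup>2"
    using B.matrix_tail[OF b, of m] unfolding sample_law_def by blast
  show ?thesis
  proof (intro bexI[OF _ A(1)] conjI A(2) ballI)
    fix x and v :: "real vec" assume x: "x \<in> A" and v: "v \<in> carrier_vec d"
    have "x \<in> space (sample_law m D)" using A(1) x sets.sets_into_space by blast
    then have "x k \<in> carrier_vec d" if "k < m" for k using sample_carrier that by blast
    then show "(\<Sum>k<m. if far \<theta> (x k) then \<theta> * (clip \<theta> (Z (x k)) \<bullet> v)\<^sup>2 else 0)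
        \<le> (real m * (5 * \<theta>\<^sup>2 * (sigma0 d D)\<^sup>2) + b) * (vnorm v)\<^sup>2"
      using q[OF x v] Fq[OF _ v] by simp
  qed
qed

section \<open>Dilation of a vector\<close>

text \<open>The dilation turns the norm of a sum of vectors into the largest eigenvalue of a sum of symmetric matrices.\<close>

definition dilation :: "real vec \<Rightarrow> real mat" where
  "dilation w = Matrix.mat (Suc d) (Suc d) (\<lambda>(i, j).
     if i = d \<and> j < d then w $ j else if i < d \<and> j = d then w $ i else 0)"

lemma dilation_carrier [simp]: "dilation w \<in> carrier_mat (Suc d) (Suc d)"
  by (simp add: dilation_def)

lemma dilation_mult:
  assumes w: "w \<in> carrier_vec d" and v: "v \<in> carrier_vec (Suc d)"
  defines "v' \<equiv> Matrix.vec d (\<lambda>i. v $ i)"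
  shows "v \<bullet> (dilation w *\<^sub>v v) = 2 * (v $ d) * (w \<bullet> v')"
    and "(vnorm (dilation w *\<^sub>v v))\<^sup>2 = (v $ d)\<^sup>2 * (vnorm w)\<^sup>2 + (w \<bullet> v')\<^sup>2"
    and "(vnorm v)\<^sup>2 = (vnorm v')\<^sup>2 + (v $ d)\<^sup>2"
proof -
  have wv: "w \<bullet> v' = (\<Sum>i<d. w $ i * v $ i)"
    by (simp add: v'_def scalar_prod_def lessThan_atLeast0)
  have row: "(dilation w *\<^sub>v v) $ i = (if i = d then w \<bullet> v' else w $ i * v $ d)" if i: "i < Suc d" for i
  proof -
    have "(dilation w *\<^sub>v v) $ i = (\<Sum>j<Suc d. dilation w $$ (i, j) * v $ j)"
      using i v by (simp add: scalar_prod_def lessThan_atLeast0 dilation_def del: sum.op_ivl_Suc)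
    also have "\<dots> = (\<Sum>j<d. dilation w $$ (i, j) * v $ j) + dilation w $$ (i, d) * v $ d" by simp
    also have "\<dots> = (if i = d then w \<bullet> v' else w $ i * v $ d)"
      using i by (auto simp: dilation_def wv intro!: sum.neutral)
    finally show ?thesis .
  qed
  have dv: "dilation w *\<^sub>v v \<in> carrier_vec (Suc d)" using v by (simp add: mult_mat_vec_carrier[of _ "Suc d" "Suc d"])
  have "v \<bullet> (dilation w *\<^sub>v v) = (\<Sum>i<Suc d. v $ i * (dilation w *\<^sub>v v) $ i)"
    using dv by (simp add: scalar_prod_def lessThan_atLeast0 dilation_def)
  also have "\<dots> = (\<Sum>i<d. v $ i * (w $ i * v $ d)) + v $ d * (w \<bullet> v')"
    using row by (simp del: index_mult_mat_vec)
  also have "(\<Sum>i<d. v $ i * (w $ i * v $ d)) = v $ d * (w \<bullet> v')"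
    by (simp add: wv sum_distrib_left mult_ac)
  finally show "v \<bullet> (dilation w *\<^sub>v v) = 2 * (v $ d) * (w \<bullet> v')" by simp
  have "(vnorm (dilation w *\<^sub>v v))\<^sup>2 = (\<Sum>i<Suc d. ((dilation w *\<^sub>v v) $ i)\<^sup>2)" by (rule vnorm_sq_sum[OF dv])
  also have "\<dots> = (\<Sum>i<d. (w $ i * v $ d)\<^sup>2) + (w \<bullet> v')\<^sup>2"
    using row by (simp del: index_mult_mat_vec)
  also have "(\<Sum>i<d. (w $ i * v $ d)\<^sup>2) = (v $ d)\<^sup>2 * (vnorm w)\<^sup>2"
    by (simp add: vnorm_sq_sum[OF w] power_mult_distrib sum_distrib_left mult_ac)
  finally show "(vnorm (dilation w *\<^sub>v v))\<^sup>2 = (v $ d)\<^sup>2 * (vnorm w)\<^sup>2 + (w \<bullet> v')\<^sup>2" .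
  have "v' \<in> carrier_vec d" by (simp add: v'_def)
  then show "(vnorm v)\<^sup>2 = (vnorm v')\<^sup>2 + (v $ d)\<^sup>2"
    by (simp add: vnorm_sq_sum[OF v] vnorm_sq_sum[of v' d]) (simp add: v'_def)
qed

text \<open>The points on which clipping acts as the identity before and after the shift. The cross
  term is linear in their sum.\<close>

definition near_part :: "real \<Rightarrow> real vec \<Rightarrow> real vec" where
  "near_part \<theta> x = (if far \<theta> x then 0\<^sub>v d else Z x)"

lemma near_part_carrier [simp]: "x \<in> carrier_vec d \<Longrightarrow> near_part \<theta> x \<in> carrier_vec d"
  by (simp add: near_part_def)

lemma near_part_facts:
  assumes "0 < \<theta>" "x \<in> carrier_vec d" "v \<in> carrier_vec d"
  shows "4 * \<theta> * (vnorm (near_part \<theta> x))\<^sup>2 \<le> 1" "vnorm (near_part \<theta> x) \<le> vnorm (Z x)"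
    "(near_part \<theta> x \<bullet> v)\<^sup>2 \<le> (Z x \<bullet> v)\<^sup>2"
  using assms by (auto simp: near_part_def far_def)

text \<open>Since Z is centered, the mean of the near part is minus that of the far part. Jensen and
  1 \<le> 4 \<theta> |Z|^2 on far points bound the latter.\<close>

lemma near_part_mean:
  assumes \<theta>: "0 < \<theta>" and v: "v \<in> carrier_vec d"
  shows "\<bar>\<integral>x. near_part \<theta> x \<bullet> v \<partial>D\<bar> \<le> 2 * sqrt \<theta> * sigma0 d D * vnorm v"
proof -
  define f where "f x = (if far \<theta> x then Z x \<bullet> v else 0)" for x
  note [measurable] = measurable_Z_prod[OF v]
  have fm: "f \<in> borel_measurable D" unfolding f_def by measurable
  have if1: "integrable D f"
    by (rule Bochner_Integration.integrable_bound[OF integrable_Z_prod(1)[OF v] fm]) (auto simp: f_def)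
  have if2: "integrable D (\<lambda>x. (f x)\<^sup>2)"
    by (rule Bochner_Integration.integrable_bound[OF integrable_Z_prod(2)[OF v]]) (use fm in \<open>auto simp: f_def\<close>)
  have "(\<integral>x. near_part \<theta> x \<bullet> v \<partial>D) = (\<integral>x. Z x \<bullet> v - f x \<partial>D)"
    using v by (intro Bochner_Integration.integral_cong) (auto simp: near_part_def f_def)
  also have "\<dots> = - (\<integral>x. f x \<partial>D)" using integrable_Z_prod(1)[OF v] if1 integral_Z_prod[OF v] by simp
  finally have e: "\<bar>\<integral>x. near_part \<theta> x \<bullet> v \<partial>D\<bar> = \<bar>\<integral>x. f x \<partial>D\<bar>" by simp
  have "(\<integral>x. f x \<partial>D)\<^sup>2 \<le> (\<integral>x. (f x)\<^sup>2 \<partial>D)" by (rule integral_sq_le[OF if1 if2])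
  also have "\<dots> \<le> (\<integral>x. 4 * \<theta> * ((vnorm (Z x))\<^sup>2 * (Z x \<bullet> v)\<^sup>2) \<partial>D)"
  proof (intro integral_mono if2)
    show "integrable D (\<lambda>x. 4 * \<theta> * ((vnorm (Z x))\<^sup>2 * (Z x \<bullet> v)\<^sup>2))" using integrable_Z_prod(4)[OF v] by simp
    show "(f x)\<^sup>2 \<le> 4 * \<theta> * ((vnorm (Z x))\<^sup>2 * (Z x \<bullet> v)\<^sup>2)" if "x \<in> space D" for x
    proof (cases "far \<theta> x")
      case True
      then show ?thesis using mult_right_mono[of 1 "4 * \<theta> * (vnorm (Z x))\<^sup>2" "(Z x \<bullet> v)\<^sup>2"]
        by (simp add: f_def far_def mult.assoc)
    qed (use \<theta> in \<open>simp add: f_def\<close>)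
  qed
  also have "\<dots> = 4 * \<theta> * (\<integral>x. (vnorm (Z x))\<^sup>2 * (Z x \<bullet> v)\<^sup>2 \<partial>D)" by (rule integral_mult_right_zero)
  also have "\<dots> \<le> 4 * \<theta> * ((sigma0 d D)\<^sup>2 * (vnorm v)\<^sup>2)" using moment4_le[OF v] \<theta> by (intro mult_left_mono) auto
  also have "\<dots> = (2 * sqrt \<theta> * sigma0 d D * vnorm v)\<^sup>2" using \<theta> by (simp add: power_mult_distrib)
  finally have "\<bar>\<integral>x. f x \<partial>D\<bar> \<le> \<bar>2 * sqrt \<theta> * sigma0 d D * vnorm v\<bar>" by (simp only: abs_le_square_iff)
  then show ?thesis unfolding e using \<theta> sigma0_nonneg by (simp add: abs_mult)
qed

text \<open>The matrix tail bound for dilations scaled by \<open>l\<close>; the condition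
  \<open>l\<^sup>2 \<le> \<theta>\<close> keeps them bounded by 1. Dividing by \<open>l\<close> at
  the end leaves the three terms bias, \<open>l\<close> times the variance, and b / l, between which
  \<open>l\<close> is chosen later.\<close>

lemma near_part_mean_tail:
  assumes \<theta>: "0 < \<theta>" and l: "0 < l" "l\<^sup>2 \<le> \<theta>" and b: "0 \<le> b"
  shows "\<exists>A\<in>sets (sample_law m D). 1 - real (Suc d) * exp (- b) \<le> measure (sample_law m D) A \<and>
    (\<forall>x\<in>A. \<forall>v\<in>carrier_vec d. \<bar>\<Sum>k<m. near_part \<theta> (x k) \<bullet> v\<bar>
        \<le> (real m * (2 * sqrt \<theta> * sigma0 d D + l * tr (covariance d D)) + b / l) * vnorm v)"
proof -
  define \<tau> where "\<tau> = tr (covariance d D)"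
  have \<tau>: "\<tau> = (\<integral>x. (vnorm (Z x))\<^sup>2 \<partial>D)" by (simp add: \<tau>_def tr_covariance)
  \<comment> \<open>The linear part comes from the nonzero mean of the near points, the quadratic
    part from their second moment.\<close>
  define \<rho> where "\<rho> = l * (2 * sqrt \<theta> * sigma0 d D + l * \<tau>)"
  define F where "F x = l \<cdot>\<^sub>m dilation (near_part \<theta> x)" for x
  have Fc: "F x \<in> carrier_mat (Suc d) (Suc d)" for x by (simp add: F_def)
  have Fv: "F x *\<^sub>v v = l \<cdot>\<^sub>v (dilation (near_part \<theta> x) *\<^sub>v v)" if "v \<in> carrier_vec (Suc d)" for x v
    unfolding F_def by (rule smult_mat_mult_vec[OF dilation_carrier that])
  have Fq: "v \<bullet> (F x *\<^sub>v v) = 2 * l * (v $ d) * (near_part \<theta> x \<bullet> Matrix.vec d (\<lambda>i. v $ i))"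
    if "x \<in> carrier_vec d" "v \<in> carrier_vec (Suc d)" for x v
    unfolding Fv[OF that(2)] using dilation_mult(1)[OF near_part_carrier[OF that(1)] that(2), of \<theta>] that
      mult_mat_vec_carrier[OF dilation_carrier that(2), of "near_part \<theta> x"]
    by (simp add: mult_ac)
  have Fn: "(vnorm (F x *\<^sub>v v))\<^sup>2 = l\<^sup>2 * ((v $ d)\<^sup>2 * (vnorm (near_part \<theta> x))\<^sup>2
      + (near_part \<theta> x \<bullet> Matrix.vec d (\<lambda>i. v $ i))\<^sup>2)"
    if "x \<in> carrier_vec d" "v \<in> carrier_vec (Suc d)" for x v
    unfolding Fv[OF that(2)] using dilation_mult(2)[OF near_part_carrier[OF that(1)] that(2), of \<theta>]
    by (simp add: power_mult_distrib)
  interpret B: bounded_random_matrix D "Suc d" F \<rho>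
  proof (unfold_locales)
    show "(\<lambda>x. F x $$ (i, j)) \<in> borel_measurable D" if ij: "i < Suc d" "j < Suc d" for i j
    proof -
      have [measurable]: "(\<lambda>x. near_part \<theta> x $ i) \<in> borel_measurable D" if "i < d" for i
      proof -
        have "(\<lambda>x. if far \<theta> x then 0 else Z x $ i) \<in> borel_measurable D" using that by measurable
        moreover have "near_part \<theta> x $ i = (if far \<theta> x then 0 else Z x $ i)" for x
          using that by (simp add: near_part_def)
        ultimately show ?thesis by simp
      qed
      consider "i = d" "j < d" | "i < d" "j = d" | "i < d" "j < d" | "i = d" "j = d"
        using ij by (auto simp: less_Suc_eq)
      then show ?thesis by cases (simp_all add: F_def dilation_def)
    qed
  next
    fix x assume "x \<in> space D"
    then have x: "x \<in> carrier_vec d" by (simp add: space_D)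
    show sym: "transpose_mat (F x) = F x"
      unfolding F_def by (intro eq_matI) (auto simp: dilation_def)
    show "mat_bound (Suc d) (F x) 1"
    proof (rule mat_bound_quad[OF Fc sym])
      fix v :: "real vec" assume v: "v \<in> carrier_vec (Suc d)"
      define v' where "v' = Matrix.vec d (\<lambda>i. v $ i)"
      define w where "w = near_part \<theta> x"
      have w: "w \<in> carrier_vec d" "4 * \<theta> * (vnorm w)\<^sup>2 \<le> 1"
        using near_part_facts(1)[OF \<theta> x zero_carrier_vec] x by (auto simp: w_def)
      have lw: "l * vnorm w \<le> 1"
      proof -
        have "(l * vnorm w)\<^sup>2 \<le> \<theta> * (vnorm w)\<^sup>2" using l by (simp add: power_mult_distrib mult_right_mono)
        also have "\<dots> \<le> 1\<^sup>2" using w \<theta> zero_le_power2[of "vnorm w"] mult_nonneg_nonneg[of \<theta> "(vnorm w)\<^sup>2"] by simp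
        finally show ?thesis by (rule power2_le_imp_le) simp
      qed
      have "\<bar>v \<bullet> (F x *\<^sub>v v)\<bar> = 2 * l * \<bar>v $ d\<bar> * \<bar>w \<bullet> v'\<bar>"
        unfolding Fq[OF x v] using l by (simp add: abs_mult v'_def w_def)
      also have "\<dots> \<le> 2 * l * \<bar>v $ d\<bar> * (vnorm w * vnorm v')"
        using w l by (intro mult_left_mono abs_scalar_prod_le[of _ d]) (auto simp: v'_def)
      also have "\<dots> = (l * vnorm w) * (2 * \<bar>v $ d\<bar> * vnorm v')" by simp
      also have "\<dots> \<le> 1 * (2 * \<bar>v $ d\<bar> * vnorm v')" using lw by (intro mult_right_mono) auto
      also have "\<dots> \<le> (vnorm v)\<^sup>2"
        using dilation_mult(3)[OF w(1) v] sum_squares_bound[of "\<bar>v $ d\<bar>" "vnorm v'"] by (simp add: v'_def)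
      finally show "\<bar>v \<bullet> (F x *\<^sub>v v)\<bar> \<le> 1 * (vnorm v)\<^sup>2" by simp
    qed simp
  next
    fix v :: "real vec" assume v: "v \<in> carrier_vec (Suc d)"
    define v' where "v' = Matrix.vec d (\<lambda>i. v $ i)"
    have v': "v' \<in> carrier_vec d" by (simp add: v'_def)
    have n: "(vnorm v)\<^sup>2 = (vnorm v')\<^sup>2 + (v $ d)\<^sup>2"
      using dilation_mult(3)[OF zero_carrier_vec v] by (simp add: v'_def)
    have im: "(\<lambda>x. near_part \<theta> x \<bullet> v') \<in> borel_measurable D"
    proof -
      note [measurable] = measurable_Z_prod[OF v']
      have "(\<lambda>x. if far \<theta> x then 0 else Z x \<bullet> v') \<in> borel_measurable D" by measurable
      moreover have "near_part \<theta> x \<bullet> v' = (if far \<theta> x then 0 else Z x \<bullet> v')" for x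
        using v' by (simp add: near_part_def)
      ultimately show ?thesis by simp
    qed
    have i1: "integrable D (\<lambda>x. near_part \<theta> x \<bullet> v')"
      by (rule Bochner_Integration.integrable_bound[OF integrable_Z_prod(1)[OF v'] im])
        (use v' in \<open>auto simp: near_part_def\<close>)
    have i2: "integrable D (\<lambda>x. (vnorm (Z x))\<^sup>2)" using integrable_vnorm_pow[of 2] by simp
    have pt: "v \<bullet> (F x *\<^sub>v v) + (vnorm (F x *\<^sub>v v))\<^sup>2
        \<le> 2 * l * (v $ d) * (near_part \<theta> x \<bullet> v') + (l\<^sup>2 * (vnorm v)\<^sup>2) * (vnorm (Z x))\<^sup>2" if x: "x \<in> carrier_vec d" for x
    proof -
      have "(v $ d)\<^sup>2 * (vnorm (near_part \<theta> x))\<^sup>2 + (near_part \<theta> x \<bullet> v')\<^sup>2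
          \<le> (v $ d)\<^sup>2 * (vnorm (Z x))\<^sup>2 + (vnorm v')\<^sup>2 * (vnorm (Z x))\<^sup>2"
        using near_part_facts(2,3)[OF \<theta> x v'] Z_prod_sq_le[OF v' x]
        by (intro add_mono mult_left_mono power_mono order_trans[OF near_part_facts(3)[OF \<theta> x v']]) auto
      also have "\<dots> = (vnorm v)\<^sup>2 * (vnorm (Z x))\<^sup>2" by (simp add: n algebra_simps)
      finally have "l\<^sup>2 * ((v $ d)\<^sup>2 * (vnorm (near_part \<theta> x))\<^sup>2 + (near_part \<theta> x \<bullet> v')\<^sup>2)
          \<le> l\<^sup>2 * ((vnorm v)\<^sup>2 * (vnorm (Z x))\<^sup>2)" by (intro mult_left_mono) auto
      then show ?thesis unfolding Fq[OF x v] Fn[OF x v] v'_def[symmetric] by (simp add: mult.assoc)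
    qed
    have meas: "(\<lambda>x. v \<bullet> (F x *\<^sub>v v) + (vnorm (F x *\<^sub>v v))\<^sup>2) \<in> borel_measurable D"
    proof -
      have [measurable]: "(\<lambda>x. vnorm (near_part \<theta> x)) \<in> borel_measurable D"
      proof -
        have "(\<lambda>x. if far \<theta> x then 0 else vnorm (Z x)) \<in> borel_measurable D" by measurable
        moreover have "vnorm (near_part \<theta> x) = (if far \<theta> x then 0 else vnorm (Z x))" for x
          by (simp add: near_part_def)
        ultimately show ?thesis by simp
      qed
      note [measurable] = im
      have "(\<lambda>x. 2 * l * (v $ d) * (near_part \<theta> x \<bullet> v') + l\<^sup>2 * ((v $ d)\<^sup>2 * (vnorm (near_part \<theta> x))\<^sup>2
          + (near_part \<theta> x \<bullet> v')\<^sup>2)) \<in> borel_measurable D" by measurable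
      then show ?thesis
        using Fq[OF _ v] Fn[OF _ v] by (subst measurable_cong) (auto simp: space_D v'_def)
    qed
    have "(\<integral>x. v \<bullet> (F x *\<^sub>v v) + (vnorm (F x *\<^sub>v v))\<^sup>2 \<partial>D)
        \<le> (\<integral>x. 2 * l * (v $ d) * (near_part \<theta> x \<bullet> v') + (l\<^sup>2 * (vnorm v)\<^sup>2) * (vnorm (Z x))\<^sup>2 \<partial>D)"
    proof (rule integral_mono)
      have i3: "integrable D (\<lambda>x. l\<^sup>2 * ((v $ d)\<^sup>2 * (vnorm (near_part \<theta> x))\<^sup>2 + (near_part \<theta> x \<bullet> v')\<^sup>2))"
      proof (rule integrable_dominated[of 2 _ "l\<^sup>2 * (vnorm v)\<^sup>2"])
        show "(\<lambda>x. l\<^sup>2 * ((v $ d)\<^sup>2 * (vnorm (near_part \<theta> x))\<^sup>2 + (near_part \<theta> x \<bullet> v')\<^sup>2)) \<in> borel_measurable D"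
        proof -
          have "(\<lambda>x. (v \<bullet> (F x *\<^sub>v v) + (vnorm (F x *\<^sub>v v))\<^sup>2) - 2 * l * (v $ d) * (near_part \<theta> x \<bullet> v')) \<in> borel_measurable D"
            using meas im by measurable
          then show ?thesis using Fq[OF _ v] Fn[OF _ v] by (subst (asm) measurable_cong) (auto simp: space_D v'_def)
        qed
        fix x :: "real vec" assume x: "x \<in> carrier_vec d"
        show "\<bar>l\<^sup>2 * ((v $ d)\<^sup>2 * (vnorm (near_part \<theta> x))\<^sup>2 + (near_part \<theta> x \<bullet> v')\<^sup>2)\<bar> \<le> l\<^sup>2 * (vnorm v)\<^sup>2 * vnorm (Z x) ^ 2"
          using pt[OF x] unfolding Fq[OF x v] Fn[OF x v] v'_def[symmetric] by simp
      qed simp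
      have "integrable D (\<lambda>x. 2 * l * (v $ d) * (near_part \<theta> x \<bullet> v')
          + l\<^sup>2 * ((v $ d)\<^sup>2 * (vnorm (near_part \<theta> x))\<^sup>2 + (near_part \<theta> x \<bullet> v')\<^sup>2))"
        using i1 i3 by (intro Bochner_Integration.integrable_add) auto
      then show "integrable D (\<lambda>x. v \<bullet> (F x *\<^sub>v v) + (vnorm (F x *\<^sub>v v))\<^sup>2)"
        using Fq[OF _ v] Fn[OF _ v] by (subst Bochner_Integration.integrable_cong[OF refl]) (auto simp: space_D v'_def)
      show "integrable D (\<lambda>x. 2 * l * (v $ d) * (near_part \<theta> x \<bullet> v') + (l\<^sup>2 * (vnorm v)\<^sup>2) * (vnorm (Z x))\<^sup>2)"
        using i1 i2 by simp
    qed (use pt in \<open>auto simp: space_D\<close>)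
    also have "\<dots> = 2 * l * (v $ d) * (\<integral>x. near_part \<theta> x \<bullet> v' \<partial>D) + (l\<^sup>2 * (vnorm v)\<^sup>2) * \<tau>"
      using i1 i2 by (simp add: \<tau>)
    also have "2 * l * (v $ d) * (\<integral>x. near_part \<theta> x \<bullet> v' \<partial>D) \<le> 2 * l * (\<bar>v $ d\<bar> * (2 * sqrt \<theta> * sigma0 d D * vnorm v'))"
    proof -
      have "(v $ d) * (\<integral>x. near_part \<theta> x \<bullet> v' \<partial>D) \<le> \<bar>v $ d\<bar> * \<bar>\<integral>x. near_part \<theta> x \<bullet> v' \<partial>D\<bar>"
        by (metis abs_ge_self abs_mult)
      also have "\<dots> \<le> \<bar>v $ d\<bar> * (2 * sqrt \<theta> * sigma0 d D * vnorm v')"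
        using near_part_mean[OF \<theta> v'] by (intro mult_left_mono) auto
      finally have "2 * l * ((v $ d) * (\<integral>x. near_part \<theta> x \<bullet> v' \<partial>D))
          \<le> 2 * l * (\<bar>v $ d\<bar> * (2 * sqrt \<theta> * sigma0 d D * vnorm v'))"
        using l by (intro mult_left_mono) auto
      then show ?thesis by (simp only: mult.assoc)
    qed
    also have "2 * l * (\<bar>v $ d\<bar> * (2 * sqrt \<theta> * sigma0 d D * vnorm v')) = l * (2 * sqrt \<theta> * sigma0 d D) * (2 * \<bar>v $ d\<bar> * vnorm v')"
      by simp
    also have "\<dots> \<le> l * (2 * sqrt \<theta> * sigma0 d D) * (vnorm v)\<^sup>2"
      using n sum_squares_bound[of "\<bar>v $ d\<bar>" "vnorm v'"] l \<theta> sigma0_nonneg by (intro mult_left_mono) auto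
    finally show "(\<integral>x. v \<bullet> (F x *\<^sub>v v) + (vnorm (F x *\<^sub>v v))\<^sup>2 \<partial>D) \<le> \<rho> * (vnorm v)\<^sup>2"
      by (simp add: \<rho>_def algebra_simps power2_eq_square)
  next
    show "0 \<le> \<rho>" using l \<theta> sigma0_nonneg by (simp add: \<rho>_def \<tau>)
  qed
  obtain A where A: "A \<in> sets (sample_law m D)" "1 - real (Suc d) * exp (- b) \<le> measure (sample_law m D) A"
    and q: "\<And>x v. x \<in> A \<Longrightarrow> v \<in> carrier_vec (Suc d) \<Longrightarrow>
      (\<Sum>k<m. v \<bullet> (F (x k) *\<^sub>v v)) \<le> (real m * \<rho> + b) * (vnorm v)\<^sup>2"
    using B.matrix_tail[OF b, of m] unfolding sample_law_def by blast
  show ?thesis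
  proof (intro bexI[OF _ A(1)] conjI A(2) ballI)
    fix x and v :: "real vec" assume x: "x \<in> A" and v: "v \<in> carrier_vec d"
    have "x \<in> space (sample_law m D)" using A(1) x sets.sets_into_space by blast
    then have xs: "x k \<in> carrier_vec d" if "k < m" for k using sample_carrier that by blast
    define T where "T u = (\<Sum>k<m. near_part \<theta> (x k) \<bullet> u)" for u
    have "s * T v \<le> ((real m * \<rho> + b) / l) * vnorm v" if s: "s = 1 \<or> s = - 1" for s
    proof (cases "vnorm v = 0")
      case True
      then have "v = 0\<^sub>v d" using v vnorm_eq_0_iff by blast
      then show ?thesis using True xs by (simp add: T_def)
    next
      case False
      then have n0: "0 < vnorm v" using vnorm_nonneg[of v] by linarith
      \<comment> \<open>The extra coordinate has the length of \<open>v\<close> and sign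
        \<open>s\<close>. The quadratic form of the dilation is then 2 s |v| times the inner
        product, and |u|^2 = 2 |v|^2, so the factors 2 cancel.\<close>
      define u where "u = Matrix.vec (Suc d) (\<lambda>i. if i < d then v $ i else s * vnorm v)"
      have u: "u \<in> carrier_vec (Suc d)" by (simp add: u_def)
      have u': "Matrix.vec d (\<lambda>i. u $ i) = v" using v by (intro eq_vecI) (auto simp: u_def)
      have ud: "u $ d = s * vnorm v" by (simp add: u_def)
      have nu: "(vnorm u)\<^sup>2 = 2 * (vnorm v)\<^sup>2"
        using dilation_mult(3)[OF zero_carrier_vec u] s unfolding u' ud by auto
      have "(\<Sum>k<m. u \<bullet> (F (x k) *\<^sub>v u)) = (\<Sum>k<m. 2 * l * (s * vnorm v) * (near_part \<theta> (x k) \<bullet> v))"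
        using xs Fq[OF _ u] unfolding u' ud by (intro sum.cong) auto
      also have "\<dots> = 2 * l * (s * vnorm v) * T v" by (simp add: T_def sum_distrib_left)
      finally have "2 * l * (s * vnorm v) * T v \<le> (real m * \<rho> + b) * (2 * (vnorm v)\<^sup>2)"
        using q[OF x u] nu by simp
      then have "(2 * vnorm v) * (l * (s * T v)) \<le> (2 * vnorm v) * ((real m * \<rho> + b) * vnorm v)"
        by (simp add: power2_eq_square mult_ac)
      then have "l * (s * T v) \<le> (real m * \<rho> + b) * vnorm v" using n0 by simp
      then show ?thesis using l by (simp add: pos_le_divide_eq mult.commute)
    qed
    from this[of 1] this[of "- 1"] have "\<bar>T v\<bar> \<le> ((real m * \<rho> + b) / l) * vnorm v" by simp
    moreover have "(real m * \<rho> + b) / l = real m * (2 * sqrt \<theta> * sigma0 d D + l * \<tau>) + b / l"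
      using l by (simp add: \<rho>_def add_divide_distrib)
    ultimately show "\<bar>\<Sum>k<m. near_part \<theta> (x k) \<bullet> v\<bar>
        \<le> (real m * (2 * sqrt \<theta> * sigma0 d D + l * tr (covariance d D)) + b / l) * vnorm v"
      by (simp add: T_def \<tau>_def)
  qed
qed

end

section \<open>The effect of estimating the mean\<close>

context moment_law
begin

text \<open>The clipped vector changes by \<open>g i\<close>, of length at most that of
  \<open>\<delta>\<close>. In the cross term, near points have \<open>g i = - \<delta>\<close> and
  add up to the near sum, while far points are handled by Cauchy-Schwarz against the far sum. No
  independence is involved, so \<open>\<delta>\<close> may depend on the sample.\<close>

lemma shifted_clip_sum:
  fixes \<delta> v :: "real vec"
  assumes \<theta>: "0 < \<theta>" and x: "\<And>i. i < m \<Longrightarrow> x i \<in> carrier_vec d"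
    and \<delta>: "\<delta> \<in> carrier_vec d" "4 * \<theta> * (vnorm \<delta>)\<^sup>2 \<le> 1" and v: "v \<in> carrier_vec d"
    and far_sum: "(\<Sum>k<m. if far \<theta> (x k) then \<theta> * (clip \<theta> (Z (x k)) \<bullet> v)\<^sup>2 else 0) \<le> real m * \<theta> * a * (vnorm v)\<^sup>2"
    and near_sum: "\<bar>\<Sum>k<m. near_part \<theta> (x k) \<bullet> v\<bar> \<le> real m * b * vnorm v" and a: "0 \<le> a"
  shows "\<bar>(\<Sum>i<m. (clip \<theta> (Z (x i) - \<delta>) \<bullet> v)\<^sup>2) - (\<Sum>i<m. (clip \<theta> (Z (x i)) \<bullet> v)\<^sup>2)\<bar>
    \<le> real m * ((vnorm \<delta>)\<^sup>2 + 2 * vnorm \<delta> * b + 2 * vnorm \<delta> * sqrt a) * (vnorm v)\<^sup>2"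
proof -
  define c where "c i = clip \<theta> (Z (x i))" for i
  define g where "g i = clip \<theta> (Z (x i) - \<delta>) - c i" for i
  have zc: "Z (x i) \<in> carrier_vec d" "c i \<in> carrier_vec d" "g i \<in> carrier_vec d" if "i < m" for i
    using x[OF that] \<delta> by (auto simp: c_def g_def)
  have gb: "\<bar>g i \<bullet> v\<bar> \<le> vnorm \<delta> * vnorm v" if i: "i < m" for i
  proof -
    have "vnorm (g i) \<le> vnorm (Z (x i) - \<delta> - Z (x i))"
      unfolding g_def c_def using zc[OF i] \<delta> by (intro clip_lipschitz[OF \<theta>, of _ d]) auto
    also have "Z (x i) - \<delta> - Z (x i) = - \<delta>" using zc[OF i] \<delta> by (intro eq_vecI) auto
    finally have "vnorm (g i) \<le> vnorm \<delta>" by simp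
    then show ?thesis using abs_scalar_prod_le[OF zc(3)[OF i] v] mult_right_mono[of "vnorm (g i)" "vnorm \<delta>" "vnorm v"] by simp
  qed
  have sq: "(clip \<theta> (Z (x i) - \<delta>) \<bullet> v)\<^sup>2 - (c i \<bullet> v)\<^sup>2 = (g i \<bullet> v)\<^sup>2 + 2 * ((g i \<bullet> v) * (c i \<bullet> v))" if i: "i < m" for i
  proof -
    have "clip \<theta> (Z (x i) - \<delta>) \<in> carrier_vec d" using zc[OF i] \<delta> by simp
    then have gv: "g i \<bullet> v = clip \<theta> (Z (x i) - \<delta>) \<bullet> v - c i \<bullet> v"
      unfolding g_def using zc[OF i] v by (simp add: minus_scalar_prod_distrib[of _ d])
    show ?thesis unfolding gv by (simp add: power2_eq_square algebra_simps)
  qed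
  have split: "(g i \<bullet> v) * (c i \<bullet> v) = - (\<delta> \<bullet> v) * (near_part \<theta> (x i) \<bullet> v)
      + (if far \<theta> (x i) then (g i \<bullet> v) * (c i \<bullet> v) else 0)" if i: "i < m" for i
  proof (cases "far \<theta> (x i)")
    case True
    then show ?thesis using v by (simp add: near_part_def)
  next
    case False
    then have "4 * \<theta> * (vnorm (Z (x i)))\<^sup>2 < 1" by (simp add: far_def)
    from clip_shift[OF \<theta> zc(1)[OF i] \<delta> this] have "c i = Z (x i)" "g i = - \<delta>"
      using zc(1)[OF i] \<delta> by (auto simp: c_def g_def intro!: eq_vecI)
    then show ?thesis using False \<delta> v by (simp add: near_part_def)
  qed
  define Q where "Q = (\<Sum>i<m. (g i \<bullet> v)\<^sup>2)"
  define T where "T = (\<Sum>i<m. near_part \<theta> (x i) \<bullet> v)"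
  define H where "H = (\<Sum>i<m. if far \<theta> (x i) then (g i \<bullet> v) * (c i \<bullet> v) else 0)"
  have "(\<Sum>i<m. (clip \<theta> (Z (x i) - \<delta>) \<bullet> v)\<^sup>2) - (\<Sum>i<m. (c i \<bullet> v)\<^sup>2)
      = (\<Sum>i<m. (g i \<bullet> v)\<^sup>2 + 2 * ((g i \<bullet> v) * (c i \<bullet> v)))"
    using sq by (simp add: sum_subtractf[symmetric])
  also have "\<dots> = Q + 2 * (\<Sum>i<m. (g i \<bullet> v) * (c i \<bullet> v))"
    by (simp add: Q_def sum.distrib sum_distrib_left)
  also have "(\<Sum>i<m. (g i \<bullet> v) * (c i \<bullet> v)) = (\<Sum>i<m. - (\<delta> \<bullet> v) * (near_part \<theta> (x i) \<bullet> v)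
      + (if far \<theta> (x i) then (g i \<bullet> v) * (c i \<bullet> v) else 0))"
    using split by (intro sum.cong) auto
  also have "\<dots> = - (\<delta> \<bullet> v) * T + H" unfolding T_def H_def sum_distrib_left sum.distrib ..
  finally have e: "(\<Sum>i<m. (clip \<theta> (Z (x i) - \<delta>) \<bullet> v)\<^sup>2) - (\<Sum>i<m. (c i \<bullet> v)\<^sup>2) = Q + 2 * (- (\<delta> \<bullet> v) * T + H)" .
  have Q: "0 \<le> Q" "Q \<le> real m * (vnorm \<delta>)\<^sup>2 * (vnorm v)\<^sup>2"
  proof -
    show "0 \<le> Q" by (simp add: Q_def sum_nonneg)
    have "Q \<le> (\<Sum>i<m. (vnorm \<delta> * vnorm v)\<^sup>2)"
      unfolding Q_def using gb by (intro sum_mono) (auto simp: abs_le_square_iff[symmetric] abs_mult)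
    then show "Q \<le> real m * (vnorm \<delta>)\<^sup>2 * (vnorm v)\<^sup>2" by (simp add: power_mult_distrib)
  qed
  have T: "\<bar>(\<delta> \<bullet> v) * T\<bar> \<le> real m * (vnorm \<delta> * b) * (vnorm v)\<^sup>2"
  proof -
    have "\<bar>\<delta> \<bullet> v\<bar> * \<bar>T\<bar> \<le> (vnorm \<delta> * vnorm v) * (real m * b * vnorm v)"
      using near_sum abs_scalar_prod_le[OF \<delta>(1) v] by (intro mult_mono) (auto simp: T_def)
    then show ?thesis by (simp add: abs_mult power2_eq_square mult_ac)
  qed
  have H: "\<bar>H\<bar> \<le> real m * (vnorm \<delta> * sqrt a) * (vnorm v)\<^sup>2"
  proof -
    \<comment> \<open>Only far indices contribute, so the sum of squares is the far sum divided by
      \<theta>; Cauchy-Schwarz against the constant 1 costs sqrt m.\<close>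
    define h where "h i = (if far \<theta> (x i) then \<bar>c i \<bullet> v\<bar> else 0)" for i
    have hs: "(\<Sum>i<m. (h i)\<^sup>2) \<le> real m * a * (vnorm v)\<^sup>2"
    proof -
      have "\<theta> * (\<Sum>i<m. (h i)\<^sup>2) = (\<Sum>k<m. if far \<theta> (x k) then \<theta> * (c k \<bullet> v)\<^sup>2 else 0)"
        unfolding sum_distrib_left h_def by (intro sum.cong) auto
      also have "\<dots> \<le> \<theta> * (real m * a * (vnorm v)\<^sup>2)" using far_sum unfolding c_def by (simp add: mult_ac)
      finally show ?thesis using \<theta> by simp
    qed
    have "(\<Sum>i<m. h i)\<^sup>2 \<le> (\<Sum>i<m. (1::real)\<^sup>2) * (\<Sum>i<m. (h i)\<^sup>2)"
      using Cauchy_Schwarz_ineq_sum[of "\<lambda>_. 1" h "{..<m}"] by simp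
    also have "\<dots> \<le> real m * (real m * a * (vnorm v)\<^sup>2)" using hs by (simp add: mult_left_mono)
    also have "\<dots> = (real m * sqrt a * vnorm v)\<^sup>2" using a by (simp add: power_mult_distrib power2_eq_square)
    finally have hl: "(\<Sum>i<m. h i) \<le> real m * sqrt a * vnorm v" by (rule power2_le_imp_le) (use a in auto)
    have "\<bar>H\<bar> \<le> (\<Sum>i<m. (vnorm \<delta> * vnorm v) * h i)"
      unfolding H_def
    proof (intro order_trans[OF sum_abs] sum_mono)
      fix i assume "i \<in> {..<m}"
      then show "\<bar>if far \<theta> (x i) then (g i \<bullet> v) * (c i \<bullet> v) else 0\<bar> \<le> (vnorm \<delta> * vnorm v) * h i"
        using mult_right_mono[OF gb[of i], of "\<bar>c i \<bullet> v\<bar>"] by (simp add: h_def abs_mult)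
    qed
    also have "\<dots> = (vnorm \<delta> * vnorm v) * (\<Sum>i<m. h i)" by (simp add: sum_distrib_left)
    also have "\<dots> \<le> (vnorm \<delta> * vnorm v) * (real m * sqrt a * vnorm v)" using hl by (intro mult_left_mono) auto
    finally show ?thesis by (simp add: power2_eq_square mult_ac)
  qed
  have "\<bar>Q + 2 * (- (\<delta> \<bullet> v) * T + H)\<bar> \<le> Q + 2 * \<bar>(\<delta> \<bullet> v) * T\<bar> + 2 * \<bar>H\<bar>"
  proof -
    have "\<bar>Q + 2 * (- p + h)\<bar> \<le> Q + 2 * \<bar>p\<bar> + 2 * \<bar>h\<bar>" for p h :: real using Q(1) by argo
    from this[of "(\<delta> \<bullet> v) * T" H] show ?thesis by simp
  qed
  also have "\<dots> \<le> real m * (vnorm \<delta>)\<^sup>2 * (vnorm v)\<^sup>2 + 2 * (real m * (vnorm \<delta> * b) * (vnorm v)\<^sup>2)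
      + 2 * (real m * (vnorm \<delta> * sqrt a) * (vnorm v)\<^sup>2)"
    using Q(2) T H by linarith
  also have "\<dots> = real m * ((vnorm \<delta>)\<^sup>2 + 2 * vnorm \<delta> * b + 2 * vnorm \<delta> * sqrt a) * (vnorm v)\<^sup>2"
    by (simp add: algebra_simps)
  finally show ?thesis using e by (simp add: c_def)
qed

text \<open>Triangle inequality through the sum clipped around the true mean and its expectation:
  shift, deviation and bias. The deviation and the bias contribute 1 and 1/4 to the coefficient of
  \<theta> \<open>sigma0\<close>^2.\<close>

lemma trunc_cov_error:
  assumes \<theta>: "0 < \<theta>" and m: "0 < m" and x: "\<And>i. i < m \<Longrightarrow> x i \<in> carrier_vec d" and mu: "mu \<in> carrier_vec d"
    and \<delta>: "4 * \<theta> * (vnorm (mu - mean_vec d D))\<^sup>2 \<le> 1" and \<beta>: "0 \<le> \<beta>" and l: "0 < l"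
    and dev: "\<And>s v. s = 1 \<or> s = - 1 \<Longrightarrow> v \<in> carrier_vec d \<Longrightarrow>
      (\<Sum>k<m. s * (\<theta> * (clip \<theta> (Z (x k)) \<bullet> v)\<^sup>2 - \<theta> * (\<integral>x. (clip \<theta> (Z x) \<bullet> v)\<^sup>2 \<partial>D)))
        \<le> (real m * (\<theta>\<^sup>2 * (sigma0 d D)\<^sup>2) + \<beta>) * (vnorm v)\<^sup>2"
    and far_sum: "\<And>v. v \<in> carrier_vec d \<Longrightarrow> (\<Sum>k<m. if far \<theta> (x k) then \<theta> * (clip \<theta> (Z (x k)) \<bullet> v)\<^sup>2 else 0)
        \<le> (real m * (5 * \<theta>\<^sup>2 * (sigma0 d D)\<^sup>2) + 3 * \<beta>) * (vnorm v)\<^sup>2"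
    and near_sum: "\<And>v. v \<in> carrier_vec d \<Longrightarrow> \<bar>\<Sum>k<m. near_part \<theta> (x k) \<bullet> v\<bar>
        \<le> (real m * (2 * sqrt \<theta> * sigma0 d D + l * tr (covariance d D)) + 3 * \<beta> / l) * vnorm v"
  defines "\<epsilon> \<equiv> vnorm (mu - mean_vec d D)"
  shows "op_norm (trunc_cov d m \<theta> mu x - covariance d D)
    \<le> 5 / 4 * \<theta> * (sigma0 d D)\<^sup>2 + \<beta> / (real m * \<theta>) + \<epsilon>\<^sup>2
      + 2 * \<epsilon> * (2 * sqrt \<theta> * sigma0 d D + l * tr (covariance d D) + 3 * \<beta> / (real m * l))
      + 2 * \<epsilon> * sqrt (5 * \<theta> * (sigma0 d D)\<^sup>2 + 3 * \<beta> / (real m * \<theta>))" (is "_ \<le> ?B")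
proof -
  define \<delta>v where "\<delta>v = mu - mean_vec d D"
  have \<delta>v: "\<delta>v \<in> carrier_vec d" "4 * \<theta> * (vnorm \<delta>v)\<^sup>2 \<le> 1" using mu \<delta> by (auto simp: \<delta>v_def)
  define a where "a = 5 * \<theta> * (sigma0 d D)\<^sup>2 + 3 * \<beta> / (real m * \<theta>)"
  define b where "b = 2 * sqrt \<theta> * sigma0 d D + l * tr (covariance d D) + 3 * \<beta> / (real m * l)"
  have a0: "0 \<le> a" using \<theta> \<beta> by (simp add: a_def)
  have b0: "0 \<le> b" using \<theta> \<beta> l sigma0_nonneg by (simp add: b_def tr_covariance)
  have B0: "0 \<le> ?B" unfolding a_def[symmetric] b_def[symmetric] using \<theta> \<beta> a0 b0 by (simp add: \<epsilon>_def)
  let ?T = "trunc_cov d m \<theta> mu x"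
  have xm: "x i - mu \<in> carrier_vec d" if "i < m" for i using x[OF that] mu by simp
  have xd: "x i - mu = Z (x i) - \<delta>v" if "i < m" for i
    using x[OF that] mu mean_carrier by (intro eq_vecI) (auto simp: Z_def \<delta>v_def)
  have c: "?T - covariance d D \<in> carrier_mat d d" by (intro minus_carrier_mat covariance_carrier)
  have sym: "transpose_mat (?T - covariance d D) = ?T - covariance d D"
  proof (rule eq_matI)
    fix i j assume "i < dim_row (?T - covariance d D)" "j < dim_col (?T - covariance d D)"
    then have ij: "i < d" "j < d" using c by auto
    have "?T $$ (j, i) = ?T $$ (i, j)"
      by (rule symmetric_entry[OF trunc_cov_carrier trunc_cov_symmetric[OF \<theta> xm] ij])
    moreover have "covariance d D $$ (j, i) = covariance d D $$ (i, j)"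
      by (rule symmetric_entry[OF covariance_carrier covariance_symmetric ij])
    ultimately show "transpose_mat (?T - covariance d D) $$ (i, j) = (?T - covariance d D) $$ (i, j)"
      using ij carrier_matD[OF covariance_carrier] carrier_matD[OF trunc_cov_carrier[of d m \<theta> mu x]] by simp
  qed (use carrier_matD[OF c] in auto)
  show ?thesis
  proof (rule op_norm_le_quad[OF c sym B0])
    fix v :: "real vec" assume v: "v \<in> carrier_vec d"
    define S where "S = (\<Sum>i<m. (clip \<theta> (Z (x i)) \<bullet> v)\<^sup>2)"
    define S' where "S' = (\<Sum>i<m. (clip \<theta> (Z (x i) - \<delta>v) \<bullet> v)\<^sup>2)"
    define E where "E = (\<integral>x. (clip \<theta> (Z x) \<bullet> v)\<^sup>2 \<partial>D)"
    have q: "v \<bullet> ((?T - covariance d D) *\<^sub>v v) = S' / real m - v \<bullet> (covariance d D *\<^sub>v v)"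
    proof -
      have "v \<bullet> ((?T - covariance d D) *\<^sub>v v) = v \<bullet> (?T *\<^sub>v v) - v \<bullet> (covariance d D *\<^sub>v v)"
        using v mult_mat_vec_carrier[OF covariance_carrier v] mult_mat_vec_carrier[OF trunc_cov_carrier v, of m \<theta> mu x]
        by (subst minus_mult_distrib_mat_vec[of _ d d]) (auto simp: scalar_prod_minus_distrib[of _ d])
      also have "v \<bullet> (?T *\<^sub>v v) = (\<Sum>i<m. (clip \<theta> (x i - mu) \<bullet> v)\<^sup>2) / real m"
        by (rule trunc_cov_quad[OF \<theta> xm v])
      also have "(\<Sum>i<m. (clip \<theta> (x i - mu) \<bullet> v)\<^sup>2) = S'"
        unfolding S'_def using xd by (intro sum.cong) auto
      finally show ?thesis .
    qed
    have 1: "\<bar>S' - S\<bar> \<le> real m * (\<epsilon>\<^sup>2 + 2 * \<epsilon> * b + 2 * \<epsilon> * sqrt a) * (vnorm v)\<^sup>2"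
      unfolding S_def S'_def \<epsilon>_def \<delta>v_def[symmetric]
    proof (rule shifted_clip_sum[OF \<theta> x \<delta>v v _ _ a0])
      have "real m * \<theta> * a = real m * (5 * \<theta>\<^sup>2 * (sigma0 d D)\<^sup>2) + 3 * \<beta>"
        using \<theta> m by (simp add: a_def distrib_left power2_eq_square)
      then show "(\<Sum>k<m. if far \<theta> (x k) then \<theta> * (clip \<theta> (Z (x k)) \<bullet> v)\<^sup>2 else 0) \<le> real m * \<theta> * a * (vnorm v)\<^sup>2"
        using far_sum[OF v] by simp
      have "real m * b = real m * (2 * sqrt \<theta> * sigma0 d D + l * tr (covariance d D)) + 3 * \<beta> / l"
        using l m by (simp add: b_def distrib_left)
      then show "\<bar>\<Sum>k<m. near_part \<theta> (x k) \<bullet> v\<bar> \<le> real m * b * vnorm v" using near_sum[OF v] by simp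
    qed
    have "s * (\<theta> * (S - real m * E)) \<le> (real m * (\<theta>\<^sup>2 * (sigma0 d D)\<^sup>2) + \<beta>) * (vnorm v)\<^sup>2" if s: "s = 1 \<or> s = - 1" for s
    proof -
      have "(\<Sum>k<m. s * (\<theta> * (clip \<theta> (Z (x k)) \<bullet> v)\<^sup>2 - \<theta> * E)) = s * (\<theta> * (S - real m * E))"
        by (simp add: S_def sum_distrib_left[symmetric] sum_subtractf right_diff_distrib mult_ac)
      then show ?thesis using dev[OF s v] by (simp add: E_def)
    qed
    from this[of 1] this[of "- 1"]
    have "\<bar>\<theta> * (S - real m * E)\<bar> \<le> (real m * (\<theta>\<^sup>2 * (sigma0 d D)\<^sup>2) + \<beta>) * (vnorm v)\<^sup>2"
      by (simp only: abs_le_iff) simp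
    then have "\<theta> * \<bar>S - real m * E\<bar> \<le> (real m * (\<theta>\<^sup>2 * (sigma0 d D)\<^sup>2) + \<beta>) * (vnorm v)\<^sup>2"
      using \<theta> by (simp add: abs_mult)
    also have "\<dots> = \<theta> * (real m * (\<theta> * (sigma0 d D)\<^sup>2 + \<beta> / (real m * \<theta>)) * (vnorm v)\<^sup>2)"
    proof -
      have "real m * (\<theta>\<^sup>2 * (sigma0 d D)\<^sup>2) + \<beta>
          = \<theta> * (real m * (\<theta> * (sigma0 d D)\<^sup>2 + \<beta> / (real m * \<theta>)))"
        using \<theta> m by (simp add: distrib_left power2_eq_square)
      then show ?thesis by (simp only: mult.assoc)
    qed
    finally have 2: "\<bar>S - real m * E\<bar> \<le> real m * (\<theta> * (sigma0 d D)\<^sup>2 + \<beta> / (real m * \<theta>)) * (vnorm v)\<^sup>2"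
      using \<theta> by simp
    have 3: "\<bar>E - v \<bullet> (covariance d D *\<^sub>v v)\<bar> \<le> \<theta> * (sigma0 d D)\<^sup>2 / 4 * (vnorm v)\<^sup>2"
      using clip_bias[OF \<theta> v] by (simp add: E_def)
    have "\<bar>S' - real m * E\<bar> \<le> \<bar>S' - S\<bar> + \<bar>S - real m * E\<bar>" by linarith
    also have "\<dots> \<le> real m * ((\<epsilon>\<^sup>2 + 2 * \<epsilon> * b + 2 * \<epsilon> * sqrt a) + (\<theta> * (sigma0 d D)\<^sup>2 + \<beta> / (real m * \<theta>))) * (vnorm v)\<^sup>2"
    proof -
      have "M * p * V + M * r * V = M * (p + r) * V" for M p r V :: real by (simp add: algebra_simps)
      with add_mono[OF 1 2] show ?thesis by metis
    qed
    finally have "\<bar>S' - real m * E\<bar> / real m \<le> ((\<epsilon>\<^sup>2 + 2 * \<epsilon> * b + 2 * \<epsilon> * sqrt a) + (\<theta> * (sigma0 d D)\<^sup>2 + \<beta> / (real m * \<theta>))) * (vnorm v)\<^sup>2"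
      using m by (subst pos_divide_le_eq) (simp_all add: mult.commute mult.left_commute)
    moreover have "\<bar>S' - real m * E\<bar> / real m = \<bar>S' / real m - E\<bar>"
    proof -
      have "S' / real m - E = (S' - real m * E) / real m" using m by (simp add: field_simps)
      then show ?thesis using m by simp
    qed
    ultimately have 4: "\<bar>S' / real m - E\<bar>
        \<le> ((\<epsilon>\<^sup>2 + 2 * \<epsilon> * b + 2 * \<epsilon> * sqrt a) + (\<theta> * (sigma0 d D)\<^sup>2 + \<beta> / (real m * \<theta>))) * (vnorm v)\<^sup>2"
      by simp
    have "\<bar>S' / real m - v \<bullet> (covariance d D *\<^sub>v v)\<bar> \<le> \<bar>S' / real m - E\<bar> + \<bar>E - v \<bullet> (covariance d D *\<^sub>v v)\<bar>"
      by linarith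
    also have "\<dots> \<le> ((\<epsilon>\<^sup>2 + 2 * \<epsilon> * b + 2 * \<epsilon> * sqrt a) + (\<theta> * (sigma0 d D)\<^sup>2 + \<beta> / (real m * \<theta>))) * (vnorm v)\<^sup>2
          + \<theta> * (sigma0 d D)\<^sup>2 / 4 * (vnorm v)\<^sup>2"
      by (rule add_mono[OF 4 3])
    also have "\<dots> = ?B * (vnorm v)\<^sup>2"
    proof -
      have "((e + f + g) + (u + w)) * V + u / 4 * V = (5 / 4 * u + w + e + f + g) * V" for e f g u w V :: real
        by (simp add: field_simps)
      from this[of "\<epsilon>\<^sup>2"] show ?thesis unfolding a_def[symmetric] b_def[symmetric] by (simp only: mult.assoc)
    qed
    finally show "\<bar>v \<bullet> ((?T - covariance d D) *\<^sub>v v)\<bar> \<le> ?B * (vnorm v)\<^sup>2" by (simp add: q)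
  qed
qed

end

text \<open>With \<open>\<theta> = q / \<sigma>\<close>, all terms containing \<open>\<epsilon>\<close> carry a factor \<open>sqrt (\<tau> q)\<close>, which is tiny compared with
  \<open>sqrt S\<close>.\<close>

lemma error_budget:
  fixes q \<sigma> \<sigma>0 S \<tau> \<epsilon> :: real
  assumes q: "0 < q" "q \<le> 1" and \<sigma>: "0 < \<sigma>0" "\<sigma>0 \<le> \<sigma>" "\<sigma>0 \<le> S" and \<tau>: "0 < \<tau>" "\<tau> * q \<le> (1 / 18000)\<^sup>2 * S"
    and \<epsilon>: "0 \<le> \<epsilon>" "\<epsilon> \<le> 180 * q * sqrt \<tau>"
  defines "\<theta> \<equiv> q / \<sigma>"
  defines "l \<equiv> 1 / (1 / sqrt \<theta> + sqrt \<tau> / q)"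
  shows "0 < l" "l\<^sup>2 \<le> \<theta>"
    and "5 / 4 * \<theta> * \<sigma>0\<^sup>2 + q\<^sup>2 / \<theta> + \<epsilon>\<^sup>2 + 2 * \<epsilon> * (2 * sqrt \<theta> * \<sigma>0 + l * \<tau> + 3 * q\<^sup>2 / l)
      + 2 * \<epsilon> * sqrt (5 * \<theta> * \<sigma>0\<^sup>2 + 3 * q\<^sup>2 / \<theta>) \<le> q * (1.5 * \<sigma> + 1.25 * \<sigma>0 + 0.5 * S)"
proof -
  have \<sigma>': "0 < \<sigma>" and S: "0 < S" using \<sigma> by auto
  have \<theta>: "0 < \<theta>" using q \<sigma>' by (simp add: \<theta>_def)
  \<comment> \<open>The value l = q / sqrt \<tau> would balance l \<tau> against q^2 / l, but
    boundedness requires l \<le> sqrt \<theta>. Adding the reciprocals makes \<open>l\<close> at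
    most both values, while 1/l is only their sum.\<close>
  have d: "0 < 1 / sqrt \<theta>" "0 < sqrt \<tau> / q" using \<theta> \<tau> q by auto
  have "0 < 1 / sqrt \<theta> + sqrt \<tau> / q" by (rule add_pos_pos[OF d])
  then show l: "0 < l" unfolding l_def by (simp only: zero_less_divide_1_iff)
  have l1: "l \<le> sqrt \<theta>"
  proof -
    have "l \<le> 1 / (1 / sqrt \<theta>)" unfolding l_def by (rule frac_le) (use d in auto)
    then show ?thesis by simp
  qed
  have "l\<^sup>2 \<le> (sqrt \<theta>)\<^sup>2" using l l1 by (intro power_mono) auto
  then show "l\<^sup>2 \<le> \<theta>" using \<theta> by simp
  define \<eta> where "\<eta> = (1 / 18000 :: real)"
  define W where "W = S + \<sigma>"
  have W: "0 < W" using S \<sigma>' by (simp add: W_def)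
  \<comment> \<open>The factor sqrt(\<tau> q) brings in sqrt S; the arithmetic-geometric mean
    inequality splits sqrt(S \<sigma>) into parts proportional to S and to \<sigma>.\<close>
  have rt: "sqrt \<tau> * sqrt (q * y) \<le> \<eta> * (W / 2)" if y: "0 \<le> y" "y \<le> \<sigma>" for y
  proof -
    have "sqrt \<tau> * sqrt (q * y) = sqrt (\<tau> * q * y)" by (simp add: real_sqrt_mult)
    also have "\<dots> \<le> sqrt (\<eta>\<^sup>2 * S * \<sigma>)"
      unfolding \<eta>_def by (intro real_sqrt_le_mono mult_mono[OF \<tau>(2) y(2)]) (use S y in auto)
    also have "\<dots> = \<eta> * sqrt (S * \<sigma>)" by (simp add: real_sqrt_mult \<eta>_def)
    also have "\<dots> \<le> \<eta> * (W / 2)"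
      using arith_geo_mean_sqrt[of S \<sigma>] S \<sigma>' unfolding W_def \<eta>_def by (intro mult_left_mono) auto
    finally show ?thesis .
  qed
  have tq: "sqrt \<tau> * (q * sqrt \<tau>) \<le> \<eta> * W"
  proof -
    have "sqrt \<tau> * (q * sqrt \<tau>) = \<tau> * q" using \<tau> by simp
    also have "\<dots> \<le> \<eta>\<^sup>2 * S" using \<tau> by (simp add: \<eta>_def)
    also have "\<dots> \<le> \<eta> * S" using S by (intro mult_right_mono) (auto simp: \<eta>_def power2_eq_square)
    also have "\<dots> \<le> \<eta> * W" using \<sigma>' by (simp add: W_def \<eta>_def)
    finally show ?thesis .
  qed
  have s1: "\<theta> * \<sigma>0\<^sup>2 \<le> q * \<sigma>0"
  proof -
    have "\<sigma>0\<^sup>2 \<le> \<sigma>0 * \<sigma>" using \<sigma> by (simp add: power2_eq_square)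
    from mult_left_mono[OF this, of \<theta>] show ?thesis using \<theta> \<sigma>' by (simp add: \<theta>_def)
  qed
  have s2: "q\<^sup>2 / \<theta> = q * \<sigma>" using q \<sigma>' by (simp add: \<theta>_def power2_eq_square)
  have b1: "sqrt \<theta> * \<sigma>0 \<le> sqrt (q * \<sigma>0)"
  proof (rule power2_le_imp_le)
    show "(sqrt \<theta> * \<sigma>0)\<^sup>2 \<le> (sqrt (q * \<sigma>0))\<^sup>2" using s1 \<theta> q \<sigma> by (simp add: power_mult_distrib)
  qed (use q \<sigma> in auto)
  have b2: "l * \<tau> \<le> q * sqrt \<tau>"
  proof -
    have "l \<le> 1 / (sqrt \<tau> / q)" unfolding l_def by (rule frac_le) (use d in auto)
    then have "l * \<tau> \<le> q / sqrt \<tau> * \<tau>" using \<tau> by (intro mult_right_mono) auto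
    also have "\<dots> = q * (\<tau> / sqrt \<tau>)" by simp
    also have "\<dots> = q * sqrt \<tau>" using \<tau> by (simp only: real_div_sqrt less_imp_le)
    finally show ?thesis .
  qed
  have b3: "q\<^sup>2 / l \<le> sqrt (q * \<sigma>) + q * sqrt \<tau>"
  proof -
    have "q\<^sup>2 / l = q\<^sup>2 * (1 / sqrt \<theta>) + q\<^sup>2 * (sqrt \<tau> / q)" by (simp add: l_def distrib_left)
    also have "q\<^sup>2 * (sqrt \<tau> / q) = q * sqrt \<tau>" using q by (simp add: power2_eq_square)
    also have "q\<^sup>2 * (1 / sqrt \<theta>) = q * sqrt (q * \<sigma>)"
    proof -
      have "1 / sqrt \<theta> = sqrt (\<sigma> / q)" unfolding \<theta>_def by (simp add: real_sqrt_divide)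
      moreover have "q * sqrt (\<sigma> / q) = sqrt (q * \<sigma>)"
      proof -
        have "q * sqrt (\<sigma> / q) = sqrt (q\<^sup>2) * sqrt (\<sigma> / q)" using q by simp
        also have "\<dots> = sqrt (q\<^sup>2 * (\<sigma> / q))" by (simp only: real_sqrt_mult)
        also have "q\<^sup>2 * (\<sigma> / q) = q * \<sigma>" using q by (simp add: power2_eq_square)
        finally show ?thesis .
      qed
      ultimately show ?thesis by (simp add: power2_eq_square mult.assoc)
    qed
    also have "q * sqrt (q * \<sigma>) \<le> 1 * sqrt (q * \<sigma>)" using q \<sigma>' by (intro mult_right_mono) auto
    finally show ?thesis by simp
  qed
  define B where "B = 2 * sqrt \<theta> * \<sigma>0 + l * \<tau> + 3 * q\<^sup>2 / l"
  have B: "B \<le> 2 * sqrt (q * \<sigma>0) + 4 * (q * sqrt \<tau>) + 3 * sqrt (q * \<sigma>)" using b1 b2 b3 by (simp add: B_def)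
  have B0: "0 \<le> B" using \<theta> \<sigma> l \<tau> by (simp add: B_def)
  have T1: "\<epsilon>\<^sup>2 \<le> q * (0.01 * W)"
  proof -
    have "\<epsilon>\<^sup>2 \<le> (180 * q * sqrt \<tau>)\<^sup>2" using \<epsilon> by (intro power_mono) auto
    also have "\<dots> = q * (32400 * (\<tau> * q))" using \<tau> by (simp add: power_mult_distrib power2_eq_square)
    also have "\<dots> \<le> q * (32400 * ((1 / 18000)\<^sup>2 * S))" using \<tau> q by (intro mult_left_mono) auto
    also have "\<dots> \<le> q * (0.01 * W)" using q S \<sigma>' unfolding W_def by (intro mult_left_mono) (auto simp: power2_eq_square)
    finally show ?thesis .
  qed
  have T2: "2 * \<epsilon> * B \<le> q * (0.13 * W)"
  proof -
    have "2 * \<epsilon> * B \<le> 2 * (180 * q * sqrt \<tau>) * (2 * sqrt (q * \<sigma>0) + 4 * (q * sqrt \<tau>) + 3 * sqrt (q * \<sigma>))"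
      using \<epsilon> B B0 q \<tau> by (intro mult_mono) auto
    also have "\<dots> = 360 * q * (2 * (sqrt \<tau> * sqrt (q * \<sigma>0)) + 4 * (sqrt \<tau> * (q * sqrt \<tau>)) + 3 * (sqrt \<tau> * sqrt (q * \<sigma>)))"
      by (simp add: algebra_simps)
    also have "\<dots> \<le> 360 * q * (2 * (\<eta> * (W / 2)) + 4 * (\<eta> * W) + 3 * (\<eta> * (W / 2)))"
      using rt[of \<sigma>0] rt[of \<sigma>] tq \<sigma> \<sigma>' q by (intro mult_left_mono add_mono) auto
    \<comment> \<open>360 * (1 + 4 + 1.5) / 18000 = 0.13.\<close>
    also have "\<dots> = q * (0.13 * W)" by (simp add: \<eta>_def field_simps)
    finally show ?thesis .
  qed
  have T3: "2 * \<epsilon> * sqrt (5 * \<theta> * \<sigma>0\<^sup>2 + 3 * q\<^sup>2 / \<theta>) \<le> q * (0.03 * W)"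
  proof -
    have "5 * \<theta> * \<sigma>0\<^sup>2 + 3 * q\<^sup>2 / \<theta> \<le> 9 * (q * \<sigma>)"
    proof -
      have "q * \<sigma>0 \<le> q * \<sigma>" "0 \<le> q * \<sigma>" using q \<sigma> \<sigma>' by auto
      then show ?thesis using s1 s2 by simp
    qed
    then have "sqrt (5 * \<theta> * \<sigma>0\<^sup>2 + 3 * q\<^sup>2 / \<theta>) \<le> sqrt (9 * (q * \<sigma>))" by simp
    also have "\<dots> = 3 * sqrt (q * \<sigma>)"
    proof -
      have "sqrt 9 = (3::real)" by (rule real_sqrt_unique) auto
      then show ?thesis by (simp only: real_sqrt_mult)
    qed
    finally have "2 * \<epsilon> * sqrt (5 * \<theta> * \<sigma>0\<^sup>2 + 3 * q\<^sup>2 / \<theta>) \<le> 2 * (180 * q * sqrt \<tau>) * (3 * sqrt (q * \<sigma>))"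
      using \<epsilon> \<theta> q \<tau> by (intro mult_mono) auto
    also have "\<dots> = 1080 * q * (sqrt \<tau> * sqrt (q * \<sigma>))" by simp
    also have "\<dots> \<le> 1080 * q * (\<eta> * (W / 2))" using rt[of \<sigma>] \<sigma>' q by (intro mult_left_mono) auto
    also have "\<dots> = q * (0.03 * W)" by (simp add: \<eta>_def field_simps)
    finally show ?thesis .
  qed
  have "5 / 4 * \<theta> * \<sigma>0\<^sup>2 + q\<^sup>2 / \<theta> + \<epsilon>\<^sup>2 + 2 * \<epsilon> * B + 2 * \<epsilon> * sqrt (5 * \<theta> * \<sigma>0\<^sup>2 + 3 * q\<^sup>2 / \<theta>)
      \<le> 5 / 4 * (q * \<sigma>0) + q * \<sigma> + q * (0.01 * W) + q * (0.13 * W) + q * (0.03 * W)"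
    using s1 s2 T1 T2 T3 by linarith
  \<comment> \<open>All terms with \<open>\<epsilon>\<close> add up to 0.17 (S + \<sigma>), well
    below the allowed (S + \<sigma>) / 2.\<close>
  also have "\<dots> = q * (1.25 * \<sigma>0 + \<sigma> + 0.17 * W)" by (simp add: algebra_simps)
  also have "\<dots> \<le> q * (1.5 * \<sigma> + 1.25 * \<sigma>0 + 0.5 * S)"
  proof (rule mult_left_mono)
    show "1.25 * \<sigma>0 + \<sigma> + 0.17 * W \<le> 1.5 * \<sigma> + 1.25 * \<sigma>0 + 0.5 * S"
      using S \<sigma>' unfolding W_def by (simp add: field_simps)
  qed (use q in simp)
  finally show "5 / 4 * \<theta> * \<sigma>0\<^sup>2 + q\<^sup>2 / \<theta> + \<epsilon>\<^sup>2 + 2 * \<epsilon> * (2 * sqrt \<theta> * \<sigma>0 + l * \<tau> + 3 * q\<^sup>2 / l)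
      + 2 * \<epsilon> * sqrt (5 * \<theta> * \<sigma>0\<^sup>2 + 3 * q\<^sup>2 / \<theta>) \<le> q * (1.5 * \<sigma> + 1.25 * \<sigma>0 + 0.5 * S)"
    by (simp add: B_def)
qed

section \<open>The grid and the selection rule\<close>

lemma grid_mono: "0 < smin \<Longrightarrow> j \<le> k \<Longrightarrow> grid smin j \<le> grid smin k"
  by (simp add: grid_def power_int_increasing)

lemma grid_pos: "0 < smin \<Longrightarrow> 0 < grid smin j"
  by (simp add: grid_def)

lemma grid_Suc: "grid smin (j + 1) = 2 * grid smin j"
  by (simp add: grid_def power_int_add)

text \<open>The lower condition on the scales forces nonnegative indices. The rounding in the count
  is absorbed by a factor 2, because the logarithm is at least 1.\<close>

lemma J_set_bounds:
  assumes smin: "0 < smin" "smin \<le> smax"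
  shows "J_set smin smax \<subseteq> {0..<\<lceil>log 2 (2 * smax / smin)\<rceil>}" "0 \<in> J_set smin smax"
    "finite (J_set smin smax)" "real (card (J_set smin smax)) \<le> 2 * log 2 (2 * smax / smin)"
    "1 \<le> log 2 (2 * smax / smin)"
proof -
  let ?L = "log 2 (2 * smax / smin)"
  have L1: "1 \<le> ?L"
  proof -
    have "2 \<le> 2 * smax / smin" using smin by (simp add: pos_le_divide_eq)
    then have "log 2 2 \<le> ?L" using smin by (subst log_le_cancel_iff) auto
    then show ?thesis by simp
  qed
  show "1 \<le> ?L" by (rule L1)
  show sub: "J_set smin smax \<subseteq> {0..<\<lceil>?L\<rceil>}"
  proof
    fix j assume "j \<in> J_set smin smax"
    then have j: "smin * 1 \<le> smin * 2 powi j" "smin * 2 powi j < 2 * smax" by (auto simp: J_set_def grid_def)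
    have j0: "0 \<le> j"
    proof (rule ccontr)
      assume "\<not> 0 \<le> j"
      then have "(2::real) powi j \<le> 2 powi (- 1)" by (intro power_int_increasing) auto
      then show False using j(1) smin by simp
    qed
    have "2 powr real_of_int j < 2 * smax / smin"
      using j(2) smin by (simp add: powr_real_of_int' pos_less_divide_eq mult.commute)
    then have "real_of_int j < ?L" using smin by (subst less_log_iff) auto
    then show "j \<in> {0..<\<lceil>?L\<rceil>}" using j0 by (simp add: less_ceiling_iff)
  qed
  show "0 \<in> J_set smin smax" using smin by (simp add: J_set_def grid_def)
  show "finite (J_set smin smax)" by (rule finite_subset[OF sub]) simp
  have "card (J_set smin smax) \<le> card {0..<\<lceil>?L\<rceil>}" by (rule card_mono[OF _ sub]) simp
  then have "real (card (J_set smin smax)) \<le> real (nat \<lceil>?L\<rceil>)" by simp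
  also have "\<dots> = real_of_int \<lceil>?L\<rceil>" using L1 by simp
  also have "\<dots> \<le> ?L + 1" by (rule of_int_ceiling_le_add_one)
  also have "\<dots> \<le> 2 * ?L" using L1 by simp
  finally show "real (card (J_set smin smax)) \<le> 2 * ?L" .
qed

lemma op_norm_diff_triangle:
  assumes A: "A \<in> carrier_mat n n" and B: "B \<in> carrier_mat n n" and C: "C \<in> carrier_mat n n"
  shows "op_norm (A - C) \<le> op_norm (A - B) + op_norm (B - C)"
proof -
  have AB: "A - B \<in> carrier_mat n n" and BC: "B - C \<in> carrier_mat n n"
    using minus_carrier_mat[OF B, of A] minus_carrier_mat[OF C, of B] by auto
  have "A - C = (A - B) + (B - C)" using A B C by (intro eq_matI) auto
  then have "mat_bound n (A - C) (op_norm (A - B) + op_norm (B - C))"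
    using mat_bound_add[OF mat_bound_op_norm[OF AB] mat_bound_op_norm[OF BC]] by simp
  then show ?thesis by (rule op_norm_le) (use op_norm_nonneg[OF AB] op_norm_nonneg[OF BC] in simp)
qed

lemma op_norm_minus_commute:
  assumes A: "A \<in> carrier_mat n n" and B: "B \<in> carrier_mat n n"
  shows "op_norm (A - B) = op_norm (B - A)"
proof -
  have le: "op_norm (X - Y) \<le> op_norm (Y - X)" if X: "X \<in> carrier_mat n n" and Y: "Y \<in> carrier_mat n n" for X Y
  proof -
    have c: "Y - X \<in> carrier_mat n n" by (rule minus_carrier_mat[OF X])
    have "X - Y = (- 1) \<cdot>\<^sub>m (Y - X)" using X Y by (intro eq_matI) auto
    then show ?thesis
      using op_norm_le[OF mat_bound_smult[OF mat_bound_op_norm[OF c], of "- 1"]] op_norm_nonneg[OF c] by simp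
  qed
  show ?thesis using le[OF A B] le[OF B A] by simp
qed

text \<open>If the selected index exceeds the oracle index \<open>j\<^sub>1\<close>, its predecessor was rejected; the rejection
  inequality then bounds the selected scale by a multiple of \<open>S\<close>.\<close>

lemma lepski_selection:
  fixes T :: "int \<Rightarrow> real mat" and smin smax q \<sigma>0 S :: real
  assumes smin: "0 < smin" "smin \<le> \<sigma>0" "\<sigma>0 \<le> smax" and q: "0 < q" and S: "\<sigma>0 \<le> S"
    and T: "\<And>j. T j \<in> carrier_mat n n" and V: "V \<in> carrier_mat n n"
    and err: "\<And>j. j \<in> J_set smin smax \<Longrightarrow> \<sigma>0 \<le> grid smin j \<Longrightarrow>
      op_norm (T j - V) \<le> q * (1.5 * grid smin j + 1.25 * \<sigma>0 + 0.5 * S)"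
  defines "js \<equiv> Min {j \<in> J_set smin smax. \<forall>k\<in>J_set smin smax. j < k \<longrightarrow> op_norm (T k - T j) \<le> 6 * grid smin k * q}"
  shows "op_norm (T js - V) \<le> 18 * S * q"
proof -
  define J where "J = J_set smin smax"
  define ok where "ok j \<longleftrightarrow> (\<forall>k\<in>J. j < k \<longrightarrow> op_norm (T k - T j) \<le> 6 * grid smin k * q)" for j
  define g where "g = grid smin"
  have ss: "smin \<le> smax" and s0: "0 < \<sigma>0" using smin by auto
  have J: "finite J" "0 \<in> J" "\<And>j. j \<in> J \<Longrightarrow> 0 \<le> j"
    using J_set_bounds[OF smin(1) ss] unfolding J_def by auto
  have gmono: "g j \<le> g k" if "j \<le> k" for j k using grid_mono[OF smin(1) that] by (simp add: g_def)
  have g2: "2 * g j \<le> g k" if "j < k" for j k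
    using gmono[of "j + 1" k] that grid_Suc[of smin j] by (simp add: g_def)
  have gpos: "0 < g j" for j using grid_pos[OF smin(1)] by (simp add: g_def)
  have g0: "g 0 = smin" by (simp add: g_def grid_def)
  have Jdown: "i \<in> J" if "j \<in> J" "0 \<le> i" "i \<le> j" for i j
    using that gmono[of 0 i] gmono[of i j] g0 by (auto simp: J_def J_set_def g_def)
  have JMax: "Max J \<in> J" using Max_in[OF J(1)] J(2) by auto
  have "Max J + 1 \<notin> J" using Max_ge[OF J(1), of "Max J + 1"] by auto
  moreover have "smin \<le> g (Max J + 1)" using gmono[of 0 "Max J + 1"] J(3)[OF JMax] g0 by simp
  ultimately have "2 * smax \<le> g (Max J + 1)" by (auto simp: J_def J_set_def g_def)
  \<comment> \<open>The scale after the last index violates the upper condition, hence the last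
    scale is at least \<open>smax\<close>. An oracle index therefore exists.\<close>
  then have gMax: "\<sigma>0 \<le> g (Max J)" using grid_Suc[of smin "Max J"] smin by (simp add: g_def)
  define j1 where "j1 = Min {j \<in> J. \<sigma>0 \<le> g j}"
  have fin1: "finite {j \<in> J. \<sigma>0 \<le> g j}" "{j \<in> J. \<sigma>0 \<le> g j} \<noteq> {}" using J JMax gMax by auto
  have j1: "j1 \<in> J" "\<sigma>0 \<le> g j1" using Min_in[OF fin1] by (auto simp: j1_def)
  have gj1: "g j1 \<le> 2 * \<sigma>0"
  proof (cases "j1 = 0")
    case True
    then show ?thesis using g0 smin s0 by simp
  next
    case False
    then have "0 \<le> j1 - 1" using J(3)[OF j1(1)] by simp
    then have "j1 - 1 \<in> J" by (intro Jdown[OF j1(1)]) auto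
    moreover have "j1 - 1 \<notin> {j \<in> J. \<sigma>0 \<le> g j}" using Min_le[OF fin1(1), of "j1 - 1"] by (auto simp: j1_def)
    ultimately have "g (j1 - 1) < \<sigma>0" by auto
    then show ?thesis using grid_Suc[of smin "j1 - 1"] by (simp add: g_def)
  qed
  have js_def': "js = Min {j \<in> J. ok j}" by (simp add: js_def J_def ok_def)
  \<comment> \<open>Vacuously, as no larger index exists; thus the minimum defining
    \<open>js\<close> is taken over a nonempty set.\<close>
  have "ok (Max J)" using Max_ge[OF J(1)] by (force simp: ok_def)
  then have fin2: "finite {j \<in> J. ok j}" "{j \<in> J. ok j} \<noteq> {}" using J JMax by auto
  have js: "js \<in> J" "ok js" using Min_in[OF fin2] by (auto simp: js_def')
  have e: "op_norm (T j - V) \<le> q * (1.5 * g j + 1.25 * \<sigma>0 + 0.5 * S)" if "j \<in> J" "\<sigma>0 \<le> g j" for j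
    using err[of j] that by (simp add: J_def g_def)
  consider "js < j1" | "js = j1" | "j1 < js" by linarith
  then show ?thesis
  proof cases
    case 1
    have "op_norm (T js - V) \<le> op_norm (T js - T j1) + op_norm (T j1 - V)" by (rule op_norm_diff_triangle[OF T T V])
    also have "\<dots> \<le> 6 * g j1 * q + q * (1.5 * g j1 + 1.25 * \<sigma>0 + 0.5 * S)"
      using js(2) 1 j1 e[OF j1] op_norm_minus_commute[OF T T, of js j1]
      by (intro add_mono) (auto simp: ok_def g_def)
    also have "\<dots> = q * (7.5 * g j1 + 1.25 * \<sigma>0 + 0.5 * S)" by (simp add: algebra_simps)
    \<comment> \<open>With \<open>g j1 \<le> 2 * \<sigma>0 \<le> 2 * S\<close> the sum is at most
      (15 + 1.25 + 0.5) S. This case determines the constant 18.\<close>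
    also have "\<dots> \<le> q * (18 * S)" using q S s0 gj1 by (intro mult_left_mono) auto
    finally show ?thesis by (simp add: mult_ac)
  next
    case 2
    have "op_norm (T js - V) \<le> q * (1.5 * g j1 + 1.25 * \<sigma>0 + 0.5 * S)" using e[OF j1] 2 by simp
    also have "\<dots> \<le> q * (18 * S)" using q S s0 gj1 by (intro mult_left_mono) auto
    finally show ?thesis by (simp add: mult_ac)
  next
    case 3
    define j where "j = js - 1"
    have j: "j1 \<le> j" "j < js" using 3 by (auto simp: j_def)
    have jJ: "j \<in> J" using J(3)[OF j1(1)] j by (intro Jdown[OF js(1)]) auto
    have gj: "\<sigma>0 \<le> g j" using gmono[OF j(1)] j1 by simp
    have "\<not> ok j" using Min_le[OF fin2(1), of j] jJ j by (auto simp: js_def')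
    then obtain k where k: "k \<in> J" "j < k" "6 * g k * q < op_norm (T k - T j)" by (auto simp: ok_def g_def not_le)
    have gk: "2 * g j \<le> g k" by (rule g2[OF k(2)])
    have "6 * g k * q < op_norm (T k - V) + op_norm (V - T j)"
      using k(3) op_norm_diff_triangle[OF T V T, of k j] by simp
    also have "\<dots> \<le> q * (1.5 * g k + 1.25 * \<sigma>0 + 0.5 * S) + q * (1.5 * g j + 1.25 * \<sigma>0 + 0.5 * S)"
      using e[OF k(1)] e[OF jJ gj] gk gj gpos[of j] op_norm_minus_commute[OF V T, of j] by (intro add_mono) auto
    also have "\<dots> = q * (1.5 * g k + 1.5 * g j + 2.5 * \<sigma>0 + S)" by (simp add: algebra_simps)
    finally have "q * (6 * g k) < q * (1.5 * g k + 1.5 * g j + 2.5 * \<sigma>0 + S)" by (simp add: mult_ac)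
    then have "6 * g k < 1.5 * g k + 1.5 * g j + 2.5 * \<sigma>0 + S" using q by simp
    \<comment> \<open>Both \<open>\<sigma>0\<close> and \<open>g j\<close> are at most
      \<open>g k / 2\<close>, so the right side is at most 3.5 \<open>g k\<close> + S.\<close>
    then have "2.5 * g k < S" using gk gj by simp
    moreover have "g js \<le> g k" using k(2) by (intro gmono) (simp add: j_def)
    ultimately have gS: "2.5 * g js < S" by simp
    have "op_norm (T js - V) \<le> q * (1.5 * g js + 1.25 * \<sigma>0 + 0.5 * S)"
      using gmono[of j js] j gj by (intro e[OF js(1)]) auto
    also have "\<dots> \<le> q * (18 * S)" using q S s0 gS by (intro mult_left_mono) auto
    finally show ?thesis by (simp add: mult_ac)
  qed
qed

section \<open>Intersecting the good events\<close>

lemma (in prob_space) prob_Int_ge: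
  assumes "A \<in> events" "B \<in> events" "1 - a \<le> prob A" "1 - b \<le> prob B"
  shows "1 - (a + b) \<le> prob (A \<inter> B)"
proof -
  have "prob (space M - A \<inter> B) \<le> prob (space M - A) + prob (space M - B)"
    unfolding Diff_Int using assms by (intro measure_Un_le) auto
  then show ?thesis using assms prob_compl[of A] prob_compl[of B] prob_compl[of "A \<inter> B"] by simp
qed

text \<open>A common subevent instead of the intersection: over an empty index set the latter is the
  whole type, not the sample space.\<close>

lemma (in prob_space) prob_INT_ge:
  assumes "finite J" "\<And>j. j \<in> J \<Longrightarrow> A j \<in> events \<and> 1 - p \<le> prob (A j)"
  shows "\<exists>B\<in>events. 1 - real (card J) * p \<le> prob B \<and> (\<forall>j\<in>J. B \<subseteq> A j)"
  using assms
proof (induction J rule: finite_induct)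
  case empty
  show ?case by (rule bexI[of _ "space M"]) (simp_all add: prob_space)
next
  case (insert i J)
  then obtain B where B: "B \<in> events" "1 - real (card J) * p \<le> prob B" "\<forall>j\<in>J. B \<subseteq> A j" by auto
  have Ai: "A i \<in> events" "1 - p \<le> prob (A i)" using insert.prems by auto
  have "1 - (p + real (card J) * p) \<le> prob (A i \<inter> B)" by (rule prob_Int_ge[OF Ai(1) B(1) Ai(2) B(2)])
  moreover have "p + real (card J) * p = real (card (insert i J)) * p" using insert.hyps by (simp add: distrib_right)
  ultimately show ?case using Ai B by (intro bexI[of _ "A i \<inter> B"]) auto
qed

context moment_law
begin

text \<open>What a sample must satisfy at one scale, stated around the true mean only. The main
  deviation is taken at level \<beta>, the two auxiliary bounds at level 3\<beta>.\<close>

definition good_sample :: "nat \<Rightarrow> real \<Rightarrow> real \<Rightarrow> real \<Rightarrow> (nat \<Rightarrow> real vec) \<Rightarrow> bool" where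
  "good_sample m \<beta> \<theta> l x \<longleftrightarrow> (\<forall>v\<in>carrier_vec d.
    (\<forall>s. s = 1 \<or> s = - 1 \<longrightarrow> (\<Sum>k<m. s * (\<theta> * (clip \<theta> (Z (x k)) \<bullet> v)\<^sup>2 - \<theta> * (\<integral>x. (clip \<theta> (Z x) \<bullet> v)\<^sup>2 \<partial>D)))
      \<le> (real m * (\<theta>\<^sup>2 * (sigma0 d D)\<^sup>2) + \<beta>) * (vnorm v)\<^sup>2) \<and>
    (\<Sum>k<m. if far \<theta> (x k) then \<theta> * (clip \<theta> (Z (x k)) \<bullet> v)\<^sup>2 else 0)
      \<le> (real m * (5 * \<theta>\<^sup>2 * (sigma0 d D)\<^sup>2) + 3 * \<beta>) * (vnorm v)\<^sup>2 \<and>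
    \<bar>\<Sum>k<m. near_part \<theta> (x k) \<bullet> v\<bar>
      \<le> (real m * (2 * sqrt \<theta> * sigma0 d D + l * tr (covariance d D)) + 3 * \<beta> / l) * vnorm v)"

text \<open>Union bound: the two signs cost 2d at level \<beta>; at level 3\<beta> the far points
  cost d and the dilation, one dimension larger, d + 1.\<close>

lemma scale_good_event:
  assumes \<theta>: "0 < \<theta>" and l: "0 < l" "l\<^sup>2 \<le> \<theta>" and \<beta>: "0 \<le> \<beta>"
  shows "\<exists>A\<in>sets (sample_law m D).
    1 - (2 * real d * exp (- \<beta>) + (2 * real d + 1) * exp (- (3 * \<beta>))) \<le> measure (sample_law m D) A \<and>
    (\<forall>x\<in>A. good_sample m \<beta> \<theta> l x)"
proof -
  interpret P: prob_space "sample_law m D" by (rule prob_space_sample)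
  have b3: "0 \<le> 3 * \<beta>" using \<beta> by simp
  obtain A1 where A1: "A1 \<in> P.events" "1 - real d * exp (- \<beta>) \<le> P.prob A1"
    and A1': "\<forall>x\<in>A1. \<forall>v\<in>carrier_vec d.
      (\<Sum>k<m. 1 * (\<theta> * (clip \<theta> (Z (x k)) \<bullet> v)\<^sup>2 - \<theta> * (\<integral>x. (clip \<theta> (Z x) \<bullet> v)\<^sup>2 \<partial>D)))
        \<le> (real m * (\<theta>\<^sup>2 * (sigma0 d D)\<^sup>2) + \<beta>) * (vnorm v)\<^sup>2"
    using truncated_covariance_tail[OF \<theta> \<beta>, of 1 m] by blast
  obtain A2 where A2: "A2 \<in> P.events" "1 - real d * exp (- \<beta>) \<le> P.prob A2"
    and A2': "\<forall>x\<in>A2. \<forall>v\<in>carrier_vec d.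
      (\<Sum>k<m. (- 1) * (\<theta> * (clip \<theta> (Z (x k)) \<bullet> v)\<^sup>2 - \<theta> * (\<integral>x. (clip \<theta> (Z x) \<bullet> v)\<^sup>2 \<partial>D)))
        \<le> (real m * (\<theta>\<^sup>2 * (sigma0 d D)\<^sup>2) + \<beta>) * (vnorm v)\<^sup>2"
    using truncated_covariance_tail[OF \<theta> \<beta>, of "- 1" m] by blast
  obtain A3 where A3: "A3 \<in> P.events" "1 - real d * exp (- (3 * \<beta>)) \<le> P.prob A3"
    and A3': "\<forall>x\<in>A3. \<forall>v\<in>carrier_vec d. (\<Sum>k<m. if far \<theta> (x k) then \<theta> * (clip \<theta> (Z (x k)) \<bullet> v)\<^sup>2 else 0)
        \<le> (real m * (5 * \<theta>\<^sup>2 * (sigma0 d D)\<^sup>2) + 3 * \<beta>) * (vnorm v)\<^sup>2"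
    using far_points_tail[OF \<theta> b3, of m] by blast
  obtain A4 where A4: "A4 \<in> P.events" "1 - real (Suc d) * exp (- (3 * \<beta>)) \<le> P.prob A4"
    and A4': "\<forall>x\<in>A4. \<forall>v\<in>carrier_vec d. \<bar>\<Sum>k<m. near_part \<theta> (x k) \<bullet> v\<bar>
        \<le> (real m * (2 * sqrt \<theta> * sigma0 d D + l * tr (covariance d D)) + 3 * \<beta> / l) * vnorm v"
    using near_part_mean_tail[OF \<theta> l b3, of m] by blast
  define A where "A = (A1 \<inter> A2) \<inter> (A3 \<inter> A4)"
  have "1 - ((real d * exp (- \<beta>) + real d * exp (- \<beta>)) + (real d * exp (- (3 * \<beta>)) + real (Suc d) * exp (- (3 * \<beta>)))) \<le> P.prob A"
    unfolding A_def using A1 A2 A3 A4 by (intro P.prob_Int_ge) auto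
  moreover have "(real d * exp (- \<beta>) + real d * exp (- \<beta>)) + (real d * exp (- (3 * \<beta>)) + real (Suc d) * exp (- (3 * \<beta>)))
      = 2 * real d * exp (- \<beta>) + (2 * real d + 1) * exp (- (3 * \<beta>))" by (simp add: algebra_simps)
  ultimately have "1 - (2 * real d * exp (- \<beta>) + (2 * real d + 1) * exp (- (3 * \<beta>))) \<le> P.prob A" by simp
  moreover have "A \<in> P.events" using A1 A2 A3 A4 by (auto simp: A_def)
  ultimately show ?thesis
    using A1' A2' A3' A4' unfolding good_sample_def
    by (intro bexI[of _ A] conjI ballI allI impI) (auto simp: A_def)
qed

text \<open>On one event all scales above \<open>sigma0\<close> obey the error budget, and the
  selection rule does the rest. Smaller scales need no control, since the rule compares them with
  the oracle scale.\<close>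

lemma adaptive_estimator_bound:
  assumes nz: "covariance d D \<noteq> 0\<^sub>m d d" and bdd: "bdd_above (kurtosis_set d D)"
    and smin: "0 < smin" "smin \<le> sigma0 d D" "sigma0 d D \<le> smax" and \<beta>: "1 < \<beta>"
    and m: "real (num_groups \<beta>) \<le> real m / 2" and G: "is_grouping m \<beta> G" and muhat: "is_mom_estimator d m \<beta> G muhat"
    and C: "18000 ^ 4 * \<beta> * eff_rank (covariance d D) \<le> real m"
  shows "\<exists>A\<in>sets (sample_law m D).
    1 - 5 * real d * log 2 (2 * smax / smin) * exp (- \<beta>) \<le> measure (sample_law m D) A \<and>
    (\<forall>x\<in>A. op_norm (cov_star d m \<beta> smin smax (muhat x) x - covariance d D)
      \<le> 18 * Sup (kurtosis_set d D) * op_norm (covariance d D) * sqrt (eff_rank (covariance d D) * \<beta> / real m))"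
proof -
  interpret P: prob_space "sample_law m D" by (rule prob_space_sample)
  define \<tau> where "\<tau> = tr (covariance d D)"
  define N where "N = op_norm (covariance d D)"
  define R where "R = Sup (kurtosis_set d D)"
  define \<sigma>0 where "\<sigma>0 = sigma0 d D"
  define q where "q = sqrt (\<beta> / real m)"
  define S where "S = R * sqrt (\<tau> * N)"
  define L where "L = log 2 (2 * smax / smin)"
  have N: "0 < N" unfolding N_def by (rule op_norm_covariance_pos[OF nz])
  have N\<tau>: "N \<le> \<tau>" unfolding N_def \<tau>_def by (rule op_norm_covariance_le_tr)
  have \<tau>: "0 < \<tau>" using N N\<tau> by simp
  have N\<sigma>: "N \<le> \<sigma>0" unfolding N_def \<sigma>0_def by (rule op_norm_covariance_le_sigma0)
  have \<sigma>0: "0 < \<sigma>0" using N N\<sigma> by simp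
  have R: "1 \<le> R" unfolding R_def by (rule kurtosis_ge_1[OF bdd nz])
  have \<sigma>S: "\<sigma>0 \<le> S"
  proof (rule power2_le_imp_le)
    show "\<sigma>0\<^sup>2 \<le> S\<^sup>2"
      using sigma0_sq_le[OF bdd nz] \<tau> N by (simp add: S_def \<sigma>0_def R_def \<tau>_def N_def power_mult_distrib mult.assoc)
    show "0 \<le> S" using R \<tau> N by (simp add: S_def)
  qed
  have k: "3.5 * \<beta> \<le> real (num_groups \<beta>)" by (rule num_groups_bounds(1)[OF \<beta>])
  have m0: "0 < real m" using m k \<beta> by linarith
  have q: "0 < q" using m0 \<beta> by (simp add: q_def)
  have q2: "q\<^sup>2 = \<beta> / real m" using m0 \<beta> by (simp add: q_def)
  have q1: "q \<le> 1"
  proof (rule power2_le_imp_le)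
    show "q\<^sup>2 \<le> 1\<^sup>2" using m k \<beta> m0 by (simp add: q2 pos_divide_le_eq)
  qed simp
  have r: "eff_rank (covariance d D) = \<tau> / N" by (simp add: eff_rank_def \<tau>_def N_def)
  have \<tau>q2: "\<tau> * q\<^sup>2 \<le> (1 / 18000) ^ 4 * N"
  proof -
    have "18000 ^ 4 * (\<beta> * (\<tau> / N)) \<le> real m" using C by (simp add: r mult.assoc)
    then have "18000 ^ 4 * (\<beta> * \<tau>) \<le> real m * N" using N by (simp add: field_simps)
    then have "18000 ^ 4 * (\<tau> * q\<^sup>2) \<le> N" using m0 by (simp add: q2 field_simps)
    then show ?thesis by (simp add: power_divide)
  qed
  \<comment> \<open>The square of \<tau> q is \<tau> times \<tau> q^2, hence at most \<tau> N /
    18000^4. This square root is why the fourth power appears in the constant.\<close>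
  have \<tau>q: "\<tau> * q \<le> (1 / 18000)\<^sup>2 * S"
  proof -
    have "(\<tau> * q)\<^sup>2 = \<tau> * (\<tau> * q\<^sup>2)" by (simp add: power2_eq_square mult_ac)
    also have "\<dots> \<le> \<tau> * ((1 / 18000) ^ 4 * N)" using \<tau>q2 \<tau> by (intro mult_left_mono) auto
    also have "\<dots> = ((1 / 18000)\<^sup>2 * sqrt (\<tau> * N))\<^sup>2"
    proof -
      have "(sqrt (\<tau> * N))\<^sup>2 = \<tau> * N" using \<tau> N by simp
      then show ?thesis by (simp add: power_mult_distrib power_divide)
    qed
    finally have "\<tau> * q \<le> (1 / 18000)\<^sup>2 * sqrt (\<tau> * N)" by (rule power2_le_imp_le) (use \<tau> N in simp)
    also have "\<dots> \<le> (1 / 18000)\<^sup>2 * S"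
      unfolding S_def using R \<tau> N mult_right_mono[of 1 R "sqrt (\<tau> * N)"] by (intro mult_left_mono) auto
    finally show ?thesis .
  qed
  have ss: "smin \<le> smax" using smin by simp
  note Jb = J_set_bounds[OF smin(1) ss]
  define \<theta> where "\<theta> j = q / grid smin j" for j
  define l where "l j = 1 / (1 / sqrt (\<theta> j) + sqrt \<tau> / q)" for j
  define Jg where "Jg = {j \<in> J_set smin smax. \<sigma>0 \<le> grid smin j}"
  have gp: "0 < grid smin j" for j by (rule grid_pos[OF smin(1)])
  have \<theta>: "0 < \<theta> j" for j using gp q by (simp add: \<theta>_def)
  have lb: "0 < l j" "(l j)\<^sup>2 \<le> \<theta> j" if "\<sigma>0 \<le> grid smin j" for j
    \<comment> \<open>These two facts do not involve the error of the mean, so 0 is inserted for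
      it.\<close>
    using error_budget(1,2)[OF q q1 \<sigma>0 that \<sigma>S \<tau> \<tau>q, of 0] q \<tau> by (auto simp: l_def \<theta>_def)
  define p where "p = 2 * real d * exp (- \<beta>) + (2 * real d + 1) * exp (- (3 * \<beta>))"
  have "\<forall>j\<in>Jg. \<exists>A. (A \<in> P.events \<and> 1 - p \<le> P.prob A) \<and> (\<forall>x\<in>A. good_sample m \<beta> (\<theta> j) (l j) x)"
  proof
    fix j assume "j \<in> Jg"
    then have j: "\<sigma>0 \<le> grid smin j" by (simp add: Jg_def)
    have b0: "0 \<le> \<beta>" using \<beta> by simp
    show "\<exists>A. (A \<in> P.events \<and> 1 - p \<le> P.prob A) \<and> (\<forall>x\<in>A. good_sample m \<beta> (\<theta> j) (l j) x)"
      using scale_good_event[OF \<theta> lb[OF j] b0, of m] unfolding p_def by blast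
  qed
  then have "\<exists>A. \<forall>j\<in>Jg. (A j \<in> P.events \<and> 1 - p \<le> P.prob (A j)) \<and> (\<forall>x\<in>A j. good_sample m \<beta> (\<theta> j) (l j) x)"
    by (rule bchoice)
  then obtain A where A: "\<And>j. j \<in> Jg \<Longrightarrow> A j \<in> P.events \<and> 1 - p \<le> P.prob (A j)"
    and Agood: "\<And>j x. j \<in> Jg \<Longrightarrow> x \<in> A j \<Longrightarrow> good_sample m \<beta> (\<theta> j) (l j) x" by blast
  have Jgf: "finite Jg" using Jb(3) by (simp add: Jg_def)
  obtain B where B: "B \<in> P.events" "1 - real (card Jg) * p \<le> P.prob B" and BA': "\<forall>j\<in>Jg. B \<subseteq> A j"
  proof -
    have "\<exists>B\<in>P.events. 1 - real (card Jg) * p \<le> P.prob B \<and> (\<forall>j\<in>Jg. B \<subseteq> A j)"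
      by (rule P.prob_INT_ge[OF Jgf]) (rule A)
    then show thesis by (elim bexE conjE) (rule that)
  qed
  have BA: "B \<subseteq> A j" if "j \<in> Jg" for j using BA' that by simp
  obtain M where M: "M \<in> P.events" "1 - exp (- 3 * \<beta>) \<le> P.prob M"
    and Mmu': "\<forall>x\<in>M. muhat x \<in> carrier_vec d \<and>
      vnorm (muhat x - mean_vec d D) \<le> 180 * sqrt (tr (covariance d D) * \<beta> / real m)"
    using mom_concentration[OF \<beta> m G muhat \<tau>[unfolded \<tau>_def]] by (elim bexE conjE)
  have Mmu: "muhat x \<in> carrier_vec d \<and> vnorm (muhat x - mean_vec d D) \<le> 180 * sqrt (tr (covariance d D) * \<beta> / real m)"
    if "x \<in> M" for x using Mmu' that by simp
  have d1: "1 \<le> real d"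
  proof -
    have "d \<noteq> 0"
    proof
      assume d0: "d = 0"
      have "covariance d D = 0\<^sub>m d d" by (rule eq_matI) (use carrier_matD[OF covariance_carrier] d0 in auto)
      with nz show False by simp
    qed
    then show ?thesis by simp
  qed
  have L1: "1 \<le> L" using Jb(5) by (simp add: L_def)
  have prob: "1 - 5 * real d * L * exp (- \<beta>) \<le> P.prob (B \<inter> M)"
  proof -
    have cJ: "real (card Jg) \<le> 2 * L"
    proof -
      have "card Jg \<le> card (J_set smin smax)" by (rule card_mono[OF Jb(3)]) (auto simp: Jg_def)
      then show ?thesis using Jb(4) by (simp add: L_def)
    qed
    have p0: "0 \<le> p" by (simp add: p_def)
    have dL: "1 \<le> real d * L" using d1 L1 mult_mono[of 1 "real d" 1 L] by simp
    \<comment> \<open>Level 3\<beta> gains exp(-2 \<beta>), and \<beta> > 1 with e \<ge> 8/3 gives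
      exp 2 \<ge> 64/9 > 7.\<close>
    have e7: "7 * exp (- (3 * \<beta>)) \<le> exp (- \<beta>)"
    proof -
      have "7 \<le> exp (2::real)"
      proof -
        have "(1 + 1 + 1/2 + 1/6 :: real) \<le> exp 1"
          using e_approx_32 unfolding abs_le_iff by simp
        then have "(8/3)\<^sup>2 \<le> (exp 1 :: real)\<^sup>2" by (intro power_mono) auto
        also have "(exp 1 :: real)\<^sup>2 = exp 2" by (simp flip: exp_of_nat_mult)
        finally show ?thesis by (simp add: power2_eq_square)
      qed
      also have "\<dots> \<le> exp (2 * \<beta>)" using \<beta> by simp
      finally have "7 * exp (- (3 * \<beta>)) \<le> exp (2 * \<beta>) * exp (- (3 * \<beta>))" by (intro mult_right_mono) auto
      then show ?thesis by (simp flip: exp_add)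
    qed
    have "real (card Jg) * p + exp (- 3 * \<beta>) \<le> 2 * L * p + exp (- (3 * \<beta>))"
      using cJ p0 by (intro add_mono mult_right_mono) auto
    also have "\<dots> \<le> 2 * L * (2 * real d * exp (- \<beta>) + 3 * real d * exp (- (3 * \<beta>))) + (real d * L) * exp (- (3 * \<beta>))"
    proof (intro add_mono mult_left_mono)
      show "p \<le> 2 * real d * exp (- \<beta>) + 3 * real d * exp (- (3 * \<beta>))"
        unfolding p_def using d1 by (intro add_left_mono mult_right_mono) auto
      show "exp (- (3 * \<beta>)) \<le> (real d * L) * exp (- (3 * \<beta>))" using mult_right_mono[OF dL, of "exp (- (3 * \<beta>))"] by simp
    qed (use L1 in simp)
    \<comment> \<open>The 7 is 2 * 3 from the auxiliary events at no more than 2L scales, plus 1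
      from the median of means.\<close>
    also have "\<dots> = (real d * L) * (4 * exp (- \<beta>) + 7 * exp (- (3 * \<beta>)))" by (simp add: algebra_simps)
    also have "\<dots> \<le> (real d * L) * (4 * exp (- \<beta>) + exp (- \<beta>))" using e7 dL by (intro mult_left_mono add_left_mono) auto
    also have "\<dots> = 5 * real d * L * exp (- \<beta>)" by simp
    finally have "real (card Jg) * p + exp (- 3 * \<beta>) \<le> 5 * real d * L * exp (- \<beta>)" .
    moreover have "1 - (real (card Jg) * p + exp (- 3 * \<beta>)) \<le> P.prob (B \<inter> M)"
      by (rule P.prob_Int_ge[OF B(1) M(1) B(2) M(2)])
    ultimately show ?thesis by linarith
  qed
  have bound: "op_norm (cov_star d m \<beta> smin smax (muhat x) x - covariance d D) \<le> 18 * S * q" if x: "x \<in> B \<inter> M" for x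
  proof -
    have "x \<in> space (sample_law m D)" using x B(1) sets.sets_into_space by blast
    then have xc: "x i \<in> carrier_vec d" if "i < m" for i using sample_carrier that by blast
    have mu: "muhat x \<in> carrier_vec d" using Mmu x by auto
    define \<epsilon> where "\<epsilon> = vnorm (muhat x - mean_vec d D)"
    have \<epsilon>: "0 \<le> \<epsilon>" "\<epsilon> \<le> 180 * q * sqrt \<tau>"
    proof -
      have "\<epsilon> \<le> 180 * sqrt (\<tau> * \<beta> / real m)" using Mmu x by (auto simp: \<epsilon>_def \<tau>_def)
      also have "\<tau> * \<beta> / real m = (\<beta> / real m) * \<tau>" by simp
      also have "sqrt \<dots> = q * sqrt \<tau>" by (simp only: real_sqrt_mult q_def)
      finally show "\<epsilon> \<le> 180 * q * sqrt \<tau>" by simp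
    qed (simp add: \<epsilon>_def)
    define T where "T j = cov_j d m \<beta> smin (muhat x) x j" for j
    have T\<theta>: "T j = trunc_cov d m (\<theta> j) (muhat x) x" for j
      by (simp add: T_def cov_j_def \<theta>_def q_def)
    have err: "op_norm (T j - covariance d D) \<le> q * (1.5 * grid smin j + 1.25 * \<sigma>0 + 0.5 * S)"
      if j: "j \<in> J_set smin smax" "\<sigma>0 \<le> grid smin j" for j
    proof -
      have jg: "j \<in> Jg" using j by (simp add: Jg_def)
      then have gd: "good_sample m \<beta> (\<theta> j) (l j) x" using Agood BA x by blast
      \<comment> \<open>The error of the mean is at most half the truncation radius: 4 \<epsilon>^2
        \<le> N \<le> \<open>\<sigma>0\<close> \<le> \<open>grid smin j\<close>, so multiplying by
        \<open>\<theta> j\<close> leaves at most q \<le> 1.\<close>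
      have \<delta>: "4 * \<theta> j * (vnorm (muhat x - mean_vec d D))\<^sup>2 \<le> 1"
      proof -
        have "\<epsilon>\<^sup>2 \<le> (180 * q * sqrt \<tau>)\<^sup>2" using \<epsilon> by (intro power_mono) auto
        also have "\<dots> = 32400 * (\<tau> * q\<^sup>2)" using \<tau> by (simp add: power_mult_distrib)
        also have "\<dots> \<le> 32400 * ((1 / 18000) ^ 4 * N)" using \<tau>q2 by simp
        also have "\<dots> \<le> N / 4" using N by (simp add: power4_eq_xxxx)
        also have "\<dots> \<le> grid smin j / 4" using N\<sigma> j by simp
        finally have e2: "4 * \<epsilon>\<^sup>2 \<le> grid smin j" by simp
        have "\<theta> j * (4 * \<epsilon>\<^sup>2) \<le> \<theta> j * grid smin j" using e2 \<theta>[of j] by (intro mult_left_mono) auto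
        also have "\<dots> = q" using gp[of j] by (simp add: \<theta>_def)
        finally show ?thesis using q1 by (simp add: \<epsilon>_def mult_ac)
      qed
      have "op_norm (T j - covariance d D)
          \<le> 5 / 4 * \<theta> j * (sigma0 d D)\<^sup>2 + \<beta> / (real m * \<theta> j) + \<epsilon>\<^sup>2
          + 2 * \<epsilon> * (2 * sqrt (\<theta> j) * sigma0 d D + l j * tr (covariance d D) + 3 * \<beta> / (real m * l j))
          + 2 * \<epsilon> * sqrt (5 * \<theta> j * (sigma0 d D)\<^sup>2 + 3 * \<beta> / (real m * \<theta> j))"
        unfolding T\<theta> \<epsilon>_def
      proof (rule trunc_cov_error[OF \<theta> _ xc mu \<delta> _ lb(1)[OF j(2)]])
        show "0 < m" using m0 by simp
        show "0 \<le> \<beta>" using \<beta> by simp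
      qed (use gd[unfolded good_sample_def] in blast)+
      also have "\<beta> / (real m * \<theta> j) = q\<^sup>2 / \<theta> j" by (simp add: q2)
      also have "3 * \<beta> / (real m * l j) = 3 * q\<^sup>2 / l j" by (simp add: q2)
      also have "3 * \<beta> / (real m * \<theta> j) = 3 * q\<^sup>2 / \<theta> j" by (simp add: q2)
      also have "5 / 4 * \<theta> j * (sigma0 d D)\<^sup>2 + q\<^sup>2 / \<theta> j + \<epsilon>\<^sup>2
          + 2 * \<epsilon> * (2 * sqrt (\<theta> j) * sigma0 d D + l j * tr (covariance d D) + 3 * q\<^sup>2 / l j)
          + 2 * \<epsilon> * sqrt (5 * \<theta> j * (sigma0 d D)\<^sup>2 + 3 * q\<^sup>2 / \<theta> j)
        \<le> q * (1.5 * grid smin j + 1.25 * \<sigma>0 + 0.5 * S)"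
        using error_budget(3)[OF q q1 \<sigma>0 j(2) \<sigma>S \<tau> \<tau>q \<epsilon>]
        unfolding \<theta>_def[symmetric] l_def[symmetric] \<sigma>0_def[symmetric] \<tau>_def[symmetric] .
      finally show ?thesis .
    qed
    have "op_norm (T (Min {j \<in> J_set smin smax. \<forall>k\<in>J_set smin smax. j < k \<longrightarrow> op_norm (T k - T j) \<le> 6 * grid smin k * q}) - covariance d D)
        \<le> 18 * S * q"
      by (rule lepski_selection[OF smin(1) smin(2,3)[folded \<sigma>0_def] q \<sigma>S _ covariance_carrier err])
        (simp_all add: T\<theta>)
    then show ?thesis by (simp add: cov_star_def j_star_def T_def q_def)
  qed
  have rhs: "18 * S * q = 18 * R * N * sqrt (eff_rank (covariance d D) * \<beta> / real m)"
  proof -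
    \<comment> \<open>Moving N under the root turns the effective rank into the product \<tau> N
      that defines \<open>S\<close>.\<close>
    have "N * sqrt (\<tau> / N * \<beta> / real m) = sqrt (N\<^sup>2 * (\<tau> / N * \<beta> / real m))" 
    proof -
      have "sqrt (N\<^sup>2) = N" using N by simp
      then show ?thesis by (simp only: real_sqrt_mult[of "N\<^sup>2"])
    qed
    also have "N\<^sup>2 * (\<tau> / N * \<beta> / real m) = (\<tau> * N) * (\<beta> / real m)" using N by (simp add: power2_eq_square)
    also have "sqrt \<dots> = sqrt (\<tau> * N) * q" by (simp only: real_sqrt_mult q_def)
    finally show ?thesis by (simp add: S_def r)
  qed
  show ?thesis
  proof (intro bexI[of _ "B \<inter> M"] conjI ballI)
    show "B \<inter> M \<in> P.events" using B M by auto
    show "1 - 5 * real d * log 2 (2 * smax / smin) * exp (- \<beta>) \<le> P.prob (B \<inter> M)" using prob by (simp add: L_def)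
    fix x assume "x \<in> B \<inter> M"
    from bound[OF this] show "op_norm (cov_star d m \<beta> smin smax (muhat x) x - covariance d D)
      \<le> 18 * Sup (kurtosis_set d D) * op_norm (covariance d D) * sqrt (eff_rank (covariance d D) * \<beta> / real m)"
      unfolding rhs R_def N_def .
  qed
qed

end

text \<open>The constant is chosen before the dimension, the law and all parameters. The probability
  bound takes the form of a measurable event of large measure inside the set where the estimate
  holds, which itself may fail to be measurable for an arbitrary choice of minimizers.\<close>

theorem corollary4p2p2:
  "\<exists>C::real. C > 0 \<and>
    (\<forall>(d::nat) (m::nat) (D::real vec measure) (\<mu>\<^sub>0::real vec) (\<Sigma>\<^sub>0::real mat)
      (R::real) (\<sigma>_min::real) (\<sigma>_max::real) (\<beta>::real)
      (G::nat \<Rightarrow> nat set) (muhat::(nat \<Rightarrow> real vec) \<Rightarrow> real vec).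
        vec_law d D \<and>
        (\<forall>i<d. integrable D (\<lambda>x. x $ i)) \<and>
        \<mu>\<^sub>0 = mean_vec d D \<and>
        integrable D (\<lambda>x. vnorm (x - \<mu>\<^sub>0) ^ 4) \<and>
        \<Sigma>\<^sub>0 = covariance d D \<and>
        \<Sigma>\<^sub>0 \<noteq> 0\<^sub>m d d \<and>
        bdd_above (kurtosis_set d D) \<and>
        R = Sup (kurtosis_set d D) \<and>
        0 < \<sigma>_min \<and> \<sigma>_min \<le> sigma0 d D \<and> sigma0 d D \<le> \<sigma>_max \<and>
        \<beta> > 1 \<and>
        real (num_groups \<beta>) \<le> real m / 2 \<and>
        is_grouping m \<beta> G \<and>
        is_mom_estimator d m \<beta> G muhat \<and>
        real m \<ge> C * \<beta> * eff_rank \<Sigma>\<^sub>0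
      \<longrightarrow>
        (\<exists>A \<in> sets (sample_law m D).
          measure (sample_law m D) A
            \<ge> 1 - 5 * real d * log 2 (2 * \<sigma>_max / \<sigma>_min) * exp (- \<beta>) \<and>
          (\<forall>x \<in> A.
            op_norm (cov_star d m \<beta> \<sigma>_min \<sigma>_max (muhat x) x - \<Sigma>\<^sub>0)
              \<le> 18 * R * op_norm \<Sigma>\<^sub>0 * sqrt (eff_rank \<Sigma>\<^sub>0 * \<beta> / real m))))"
proof (intro exI[of _ "18000 ^ 4"] conjI allI impI, goal_cases)
  case 1
  show ?case by simp
next
  case (2 d m D \<mu>\<^sub>0 \<Sigma>\<^sub>0 R \<sigma>_min \<sigma>_max \<beta> G muhat)
  then interpret moment_law d D by unfold_locales auto
  show ?case using 2 adaptive_estimator_bound[of \<sigma>_min \<sigma>_max \<beta> m G muhat] by auto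
qed

end
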